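(* Let $(M^8,g,\rho)$ be a $\mathrm{PSU}(3)$-structure of type $\mathcal{W}_1\oplus\dots\oplus\mathcal{W}_5$. The characteristic torsion $\mathcal{T}^c$ of $(M^8,g,\rho)$ vanishes if and only if $(M^8,g,\rho)$ is integrable. Moreover, $\mathcal{T}^c\neq0$ is i) totally skew-symmetric if and only if $(M^8,g,\rho)$ is of type $\mathcal{W}_1\oplus\mathcal{W}_2\oplus\mathcal{W}_3$; ii) cyclic if and only if $(M^8,g,\rho)$ is of type $\mathcal{W}_4\oplus\mathcal{W}_5$; iii) not vectorial; iv) an element of $\mathfrak{T}_{160}$ if and only if $(M^8,g,\rho)$ is of type $\mathcal{W}_5$.
   Context: Algebraic setting. $\mathbb{R}^8$ is oriented Euclidean space, identified with its dual; $(e_1,\dots,e_8)$ is an oriented orthonormal basis, $e_{i_1\dots i_j}=e_{i_1}\wedge\dots\wedge e_{i_j}$, $\Lambda^k$ the space of $k$-forms. For $\alpha\in\Lambda^k,\beta\in\Lambda^l$ put $\sigma_0(\alpha,\beta)=\alpha\wedge\beta$ and $\sigma_j(\alpha,\beta)=\sum_{i_1<\dots<i_j}(e_{i_1}\lrcorner\cdots\lrcorner e_{i_j}\lrcorner\alpha)\wedge(e_{i_1}\lrcorner\cdots\lrcorner e_{i_j}\lrcorner\beta)$. For $k\le l$ the contraction is $\alpha\lrcorner\beta=\sigma_k(\alpha,\beta)$; $\ast$ is the Hodge operator. Let $$(\star)\quad\rho=e_{246}-e_{235}-e_{145}-e_{136}+(e_{12}+e_{34}-2e_{56})\wedge e_7+\sqrt3\,(e_{12}-e_{34})\wedge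 e_8 ,$$ $\mathrm{PSU}(3)\subset\mathrm{SO}(8)$ its isotropy group, $\sigma_+(\alpha)=\sigma_1(\rho,\alpha)$. Modules: $\Lambda^2_8=\sigma_+(\Lambda^1)$, $\Lambda^2_{20}=\{\omega\in\Lambda^2\mid\omega\wedge\ast\rho=0\}$, $\Lambda^3_8=\{\ast(\omega\wedge\rho)\mid\omega\in\Lambda^2_8\}$, $\Lambda^3_{20}=\sigma_+(\Lambda^2_{20})$, $\Lambda^3_{27}=\{T\in\Lambda^3\mid T\wedge\rho=0,\ T\wedge\ast\rho=0\}$, $\Lambda^4_8=\sigma_+(\Lambda^3_8)$, $\Lambda^4_{27}=\sigma_+(\Lambda^3_{27})$. With $\mathfrak{so}(8)=\Lambda^2$ one has $\mathfrak{psu}(3)=\Lambda^2_8$; let $\mathfrak m=\Lambda^2_{20}$ be its orthogonal complement and $\mathrm{pr}_{\mathfrak m}$ the projection. Maps: $\Phi_1(X\otimes\omega)=X\wedge\omega$ and $\Phi_2(X\otimes\omega)=(X\lrcorner\rho)\wedge\omega$ on $\mathbb{R}^8\otimes\mathfrak m$; $\Theta_1(T)=-\frac12\sum_i e_i\otimes\mathrm{pr}_{\mathfrak m}(e_i\lrcorner T)$ for $T\in\Lambda^3$; $\Theta_2(F)=-\sum_i e_i\otimes\mathrm{pr}_{\mathfrak m}((e_i\lrcorner\rho)\lrcorner F)$ for $F\in\Lambda^4$. Put $\mathcal{W}_1=\Theta_1(\Lambda^3_8)$, $\mathcal{W}_2=\Theta_1(\Lambda^3_{20})$, $\mathcal{W}_3=\Theta_1(\Lambda^3_{27})$,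 $\mathcal{W}_4=\Theta_2(\ast\Lambda^4_8)$, $\mathcal{W}_5=\Theta_2(\ast\Lambda^4_{27})$, $\mathcal{W}_6=\mathrm{Ker}(\Phi_1)\cap\mathrm{Ker}(\Phi_2)$; then $\mathbb{R}^8\otimes\mathfrak m=\mathcal{W}_1\oplus\dots\oplus\mathcal{W}_6$. Geometric setting. A $\mathrm{PSU}(3)$-structure $(M^8,g,\rho)$ is an (oriented) Riemannian 8-manifold with a 3-form $\rho$ such that at every point there is an oriented orthonormal frame (an adapted frame) realizing $(\star)$; the operators $\sigma_j,\sigma_+,\ast$, the modules $\Lambda^k_i$ and $\mathfrak m$, the maps $\Phi_1,\Phi_2,\Theta_1,\Theta_2$ and the spaces $\mathcal{W}_1,\dots,\mathcal{W}_6$ are applied pointwise in adapted frames. Let $\Omega^g=(\omega^g_{ij})$, $\omega^g_{ij}=g(\nabla^g e_i,e_j)$, in an adapted frame. The intrinsic torsion is $\Gamma=\mathrm{pr}_{\mathfrak m}(\Omega^g)=\Gamma_1+\dots+\Gamma_6$, $\Gamma_i\in\mathcal{W}_i$. The structure is integrable if $\Gamma=0$, and of type $\mathcal{W}_{i_1}\oplus\dots\oplus\mathcal{W}_{i_j}$ if $\Gamma\in\mathcal{W}_{i_1}\oplus\dots\oplus\mathcal{W}_{i_j}$. The characteristic forms are $T^c\in\Lambda^3_8\oplus\Lambda^3_{20}\oplus\Lambda^3_{27}$ with $\Theta_1(T^c)=\Gamma_1+\Gamma_2+\Gamma_3$ and $F^c\in\ast\Lambda^4_8\oplus\ast\Lambda^4_{27}$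 with $\Theta_2(F^c)=\Gamma_4+\Gamma_5$. For a structure of type $\mathcal{W}_1\oplus\dots\oplus\mathcal{W}_5$ the characteristic connection $\nabla^c$ is the metric connection $g(\nabla^c_XY,Z)=g(\nabla^g_XY,Z)+\frac12T^c(X,Y,Z)+((X\lrcorner\rho)\lrcorner F^c)(Y,Z)$ (it satisfies $\nabla^c\rho=0$). Its torsion, as a $(3,0)$-tensor $\mathcal{T}^c(X,Y,Z)=g(\nabla^c_XY-\nabla^c_YX-[X,Y],Z)$, is the characteristic torsion. Torsion types. $\mathfrak{T}=\{\mathcal{T}\in\Lambda^1\otimes\Lambda^1\otimes\Lambda^1\mid\mathcal{T}(X,Y,Z)+\mathcal{T}(Y,X,Z)=0\}=\mathfrak{T}_8\oplus\mathfrak{T}_{56}\oplus\mathfrak{T}_{160}$, where $\mathfrak{T}_8=\{\mathcal{T}\mid\exists V:\mathcal{T}(X,Y,Z)=g(g(V,X)Y-g(V,Y)X,Z)\}$, $\mathfrak{T}_{56}=\Lambda^3$, $\mathfrak{T}_{160}=\{\mathcal{T}\in\mathfrak{T}\mid\mathfrak{S}_{X,Y,Z}\mathcal{T}(X,Y,Z)=0\text{ and }\sum_i\mathcal{T}(X,e_i,e_i)=0\}$, with $\mathfrak{S}$ the cyclic sum. $\mathcal{T}$ is totally skew-symmetric if $\mathcal{T}\in\mathfrak{T}_{56}$, vectorial if $\mathcal{T}\in\mathfrak{T}_8$, cyclic if $\mathcal{T}\in\mathfrak{T}_8\oplus\mathfrak{T}_{160}$. *)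

theory Defs
  imports "HOL-Analysis.Analysis" "HOL-Library.Set_Algebras" "HOL-Library.Numeral_Type"
begin

section \<open>The exterior algebra of Euclidean 8-space\<close>

text \<open>
  The type \<open>8\<close> consists of the indices 0 < 1 < ... < 7, and \<open>8 = 0\<close> in this type. The basis
  vector called $e_n$ in the mathematics (n = 1, ..., 8) therefore has the index n - 1, so that the
  order of the indices is the order of the oriented basis.

  A form is given by its coefficients with respect to the basis vectors $e_I$ for index sets I,
  where $e_I$ is the wedge product of the $e_i$ in increasing order. Since \<open>8 set\<close> is a finite
  type, forms of mixed degree make up a Euclidean space in which the $e_I$ are orthonormal.
\<close>

type_synonym form = "(real, 8 set) vec"

definition Lam :: "nat \<Rightarrow> form set" where
  "Lam k = {\<alpha>. \<forall>I. \<alpha> $ I \<noteq> 0 \<longrightarrow> card I = k}"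

text \<open>The sign of the permutation that sorts (I in increasing order, J in increasing order).\<close>

definition shuffle_sign :: "8 set \<Rightarrow> 8 set \<Rightarrow> real" where
  "shuffle_sign I J = (-1) ^ card {(i, j). i \<in> I \<and> j \<in> J \<and> j < i}"

definition wedge :: "form \<Rightarrow> form \<Rightarrow> form"  (infixr "\<and>\<^sub>f" 70) where
  "\<alpha> \<and>\<^sub>f \<beta> = (\<chi> K. \<Sum>I\<in>Pow K. shuffle_sign I (K - I) * \<alpha> $ I * \<beta> $ (K - I))"

definition ebasis :: "nat \<Rightarrow> form" where
  "ebasis n = axis {of_nat (n - 1)} 1"

definition eform :: "nat list \<Rightarrow> form" where
  "eform ns = foldr (\<lambda>n \<alpha>. ebasis n \<and>\<^sub>f \<alpha>) ns (axis {} 1)"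

definition covector :: "real ^ 8 \<Rightarrow> form" where
  "covector X = (\<Sum>i\<in>UNIV. X $ i *\<^sub>R axis {i} 1)"

definition ip_basis :: "8 \<Rightarrow> form \<Rightarrow> form" where
  "ip_basis i \<alpha> =
     (\<chi> J. if i \<in> J then 0 else (-1) ^ card {j \<in> J. j < i} * \<alpha> $ (insert i J))"

definition ip :: "real ^ 8 \<Rightarrow> form \<Rightarrow> form" where
  "ip X \<alpha> = (\<Sum>i\<in>UNIV. X $ i *\<^sub>R ip_basis i \<alpha>)"

definition sigma_op :: "nat \<Rightarrow> form \<Rightarrow> form \<Rightarrow> form" where
  "sigma_op j \<alpha> \<beta> =
     (\<Sum>I\<in>{I. card I = j}. foldr ip_basis (sorted_list_of_set I) \<alpha>
        \<and>\<^sub>f foldr ip_basis (sorted_list_of_set I) \<beta>)"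

text \<open>The contraction of a k-form with a form of degree at least k.\<close>

abbreviation contraction :: "nat \<Rightarrow> form \<Rightarrow> form \<Rightarrow> form" where
  "contraction k \<alpha> \<beta> \<equiv> sigma_op k \<alpha> \<beta>"

text \<open>The Hodge operator: $e_I$ is mapped to the multiple of the basis form of the complement of I
  for which the wedge product of $e_I$ with its image is the volume form.\<close>

definition hodge :: "form \<Rightarrow> form" where
  "hodge \<alpha> = (\<chi> J. shuffle_sign (- J) J * \<alpha> $ (- J))"

text \<open>The value of a 2-form on two vectors.\<close>

definition eval2 :: "form \<Rightarrow> real ^ 8 \<Rightarrow> real ^ 8 \<Rightarrow> real" where
  "eval2 \<eta> Y Z = ip Z (ip Y \<eta>) $ {}"


section \<open>PSU(3)-modules\<close>

definition rho0 :: form where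
  "rho0 = eform [2,4,6] - eform [2,3,5] - eform [1,4,5] - eform [1,3,6]
     + (eform [1,2] + eform [3,4] - 2 *\<^sub>R eform [5,6]) \<and>\<^sub>f eform [7]
     + sqrt 3 *\<^sub>R ((eform [1,2] - eform [3,4]) \<and>\<^sub>f eform [8])"

definition sigma_plus :: "form \<Rightarrow> form" where
  "sigma_plus \<alpha> = sigma_op 1 rho0 \<alpha>"

definition Lam2_8 :: "form set" where "Lam2_8 = sigma_plus ` Lam 1"
definition Lam2_20 :: "form set" where "Lam2_20 = {\<omega> \<in> Lam 2. \<omega> \<and>\<^sub>f hodge rho0 = 0}"
definition Lam3_8 :: "form set" where "Lam3_8 = (\<lambda>\<omega>. hodge (\<omega> \<and>\<^sub>f rho0)) ` Lam2_8"
definition Lam3_20 :: "form set" where "Lam3_20 = sigma_plus ` Lam2_20"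
definition Lam3_27 :: "form set" where
  "Lam3_27 = {T \<in> Lam 3. T \<and>\<^sub>f rho0 = 0 \<and> T \<and>\<^sub>f hodge rho0 = 0}"
definition Lam4_8 :: "form set" where "Lam4_8 = sigma_plus ` Lam3_8"
definition Lam4_27 :: "form set" where "Lam4_27 = sigma_plus ` Lam3_27"

abbreviation mm :: "form set" where "mm \<equiv> Lam2_20"

text \<open>The orthogonal projection of 2-forms onto \<open>mm\<close>.\<close>

definition pr_m :: "form \<Rightarrow> form" where
  "pr_m \<omega> = (THE \<eta>. \<eta> \<in> mm \<and> (\<forall>\<zeta>\<in>mm. orthogonal (\<omega> - \<eta>) \<zeta>))"

text \<open>An element of the tensor product of Euclidean 8-space with the space of forms is written
  uniquely as the sum of the $e_i \otimes t_i$; it is represented by the vector t of the forms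
  $t_i$.\<close>

type_synonym vform = "form ^ 8"

definition R8_tensor_m :: "vform set" where
  "R8_tensor_m = {t. \<forall>i. t $ i \<in> mm}"

definition Phi1 :: "vform \<Rightarrow> form" where
  "Phi1 t = (\<Sum>i\<in>UNIV. covector (axis i 1) \<and>\<^sub>f (t $ i))"

definition Phi2 :: "vform \<Rightarrow> form" where
  "Phi2 t = (\<Sum>i\<in>UNIV. ip (axis i 1) rho0 \<and>\<^sub>f (t $ i))"

definition Theta1 :: "form \<Rightarrow> vform" where
  "Theta1 T = (\<chi> i. - (1/2) *\<^sub>R pr_m (ip (axis i 1) T))"

definition Theta2 :: "form \<Rightarrow> vform" where
  "Theta2 F = (\<chi> i. - pr_m (contraction 2 (ip (axis i 1) rho0) F))"

definition WW :: "nat \<Rightarrow> vform set" where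
  "WW n =
    (if n = 1 then Theta1 ` Lam3_8
     else if n = 2 then Theta1 ` Lam3_20
     else if n = 3 then Theta1 ` Lam3_27
     else if n = 4 then Theta2 ` (hodge ` Lam4_8)
     else if n = 5 then Theta2 ` (hodge ` Lam4_27)
     else if n = 6 then {t \<in> R8_tensor_m. Phi1 t = 0 \<and> Phi2 t = 0}
     else {0})"


section \<open>Oriented smooth 8-manifolds\<close>

text \<open>Smoothness is meant for functions on an open set S.\<close>

fun Ck_on :: "nat \<Rightarrow> 'a::euclidean_space set \<Rightarrow> ('a \<Rightarrow> 'b::real_normed_vector) \<Rightarrow> bool" where
  "Ck_on 0 S f = continuous_on S f"
| "Ck_on (Suc k) S f =
     (f differentiable_on S \<and> (\<forall>b\<in>Basis. Ck_on k S (\<lambda>x. frechet_derivative f (at x) b)))"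

definition smooth_on :: "'a::euclidean_space set \<Rightarrow> ('a \<Rightarrow> 'b::real_normed_vector) \<Rightarrow> bool" where
  "smooth_on S f \<longleftrightarrow> (\<forall>k. Ck_on k S f)"

text \<open>A chart is given by its domain and its coordinate map.\<close>

type_synonym 'm chart = "'m set \<times> ('m \<Rightarrow> real ^ 8)"

abbreviation dom_ch :: "'m chart \<Rightarrow> 'm set" where "dom_ch c \<equiv> fst c"
abbreviation coord :: "'m chart \<Rightarrow> 'm \<Rightarrow> real ^ 8" where "coord c \<equiv> snd c"

definition coord_inv :: "'m chart \<Rightarrow> real ^ 8 \<Rightarrow> 'm" where
  "coord_inv c = inv_into (dom_ch c) (coord c)"

text \<open>The differential at p of the transition map from the chart c to the chart d.\<close>

definition chart_change :: "'m chart \<Rightarrow> 'm chart \<Rightarrow> 'm \<Rightarrow> real ^ 8 \<Rightarrow> real ^ 8" where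
  "chart_change c d p = frechet_derivative (\<lambda>y. coord d (coord_inv c y)) (at (coord c p))"

definition oriented_smooth_atlas ::
  "('m::{t2_space, second_countable_topology}) chart set \<Rightarrow> bool" where
  "oriented_smooth_atlas A \<longleftrightarrow>
     (\<forall>c\<in>A. open (dom_ch c) \<and> open (coord c ` dom_ch c) \<and>
        homeomorphism (dom_ch c) (coord c ` dom_ch c) (coord c) (coord_inv c)) \<and>
     (\<Union>c\<in>A. dom_ch c) = UNIV \<and>
     (\<forall>c\<in>A. \<forall>d\<in>A.
        smooth_on (coord c ` (dom_ch c \<inter> dom_ch d)) (\<lambda>y. coord d (coord_inv c y)) \<and>
        (\<forall>p \<in> dom_ch c \<inter> dom_ch d. det (matrix (chart_change c d p)) > 0))"

text \<open>
  The tangent space at p is identified with \<open>real ^ 8\<close> by means of a fixed preferred chart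
  \<open>chart_at A p\<close> around p. Hence vector fields and tensor fields are functions with values in
  fixed spaces, but their components with respect to a chart c have to be computed with the
  differential of the transition map from the preferred chart.
\<close>

definition chart_at :: "'m chart set \<Rightarrow> 'm \<Rightarrow> 'm chart" where
  "chart_at A p = (SOME c. c \<in> A \<and> p \<in> dom_ch c)"

definition components :: "'m chart set \<Rightarrow> 'm chart \<Rightarrow> 'm \<Rightarrow> real ^ 8 \<Rightarrow> real ^ 8" where
  "components A c p v = chart_change (chart_at A p) c p v"

definition coord_vector :: "'m chart set \<Rightarrow> 'm chart \<Rightarrow> 'm \<Rightarrow> 8 \<Rightarrow> real ^ 8" where
  "coord_vector A c p i = chart_change c (chart_at A p) p (axis i 1)"

type_synonym 'm vfield = "'m \<Rightarrow> real ^ 8"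
type_synonym 'm tensor = "'m \<Rightarrow> (real ^ 8) list \<Rightarrow> real"

definition smooth_fun :: "'m chart set \<Rightarrow> 'm set \<Rightarrow> ('m \<Rightarrow> real) \<Rightarrow> bool" where
  "smooth_fun A U f \<longleftrightarrow>
     (\<forall>c\<in>A. smooth_on (coord c ` (U \<inter> dom_ch c)) (\<lambda>y. f (coord_inv c y)))"

definition smooth_vfield :: "'m chart set \<Rightarrow> 'm set \<Rightarrow> 'm vfield \<Rightarrow> bool" where
  "smooth_vfield A U X \<longleftrightarrow>
     (\<forall>c\<in>A. smooth_on (coord c ` (U \<inter> dom_ch c))
        (\<lambda>y. components A c (coord_inv c y) (X (coord_inv c y))))"

definition multilinear :: "nat \<Rightarrow> ((real ^ 8) list \<Rightarrow> real) \<Rightarrow> bool" where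
  "multilinear k t \<longleftrightarrow>
     (\<forall>xs i. length xs = k \<and> i < k \<longrightarrow> linear (\<lambda>v. t (xs[i := v])))"

definition smooth_tensor :: "'m chart set \<Rightarrow> nat \<Rightarrow> 'm tensor \<Rightarrow> bool" where
  "smooth_tensor A k \<tau> \<longleftrightarrow>
     (\<forall>p. multilinear k (\<tau> p)) \<and>
     (\<forall>c\<in>A. \<forall>is. length is = k \<longrightarrow>
        smooth_on (coord c ` dom_ch c)
          (\<lambda>y. \<tau> (coord_inv c y) (map (coord_vector A c (coord_inv c y)) is)))"

definition differential_form :: "'m chart set \<Rightarrow> nat \<Rightarrow> 'm tensor \<Rightarrow> bool" where
  "differential_form A k \<alpha> \<longleftrightarrow>
     smooth_tensor A k \<alpha> \<and> (\<forall>p xs. length xs = k \<and> \<not> distinct xs \<longrightarrow> \<alpha> p xs = 0)"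

definition riemannian_metric :: "'m chart set \<Rightarrow> 'm tensor \<Rightarrow> bool" where
  "riemannian_metric A g \<longleftrightarrow>
     smooth_tensor A 2 g \<and> (\<forall>p u v. g p [u, v] = g p [v, u]) \<and>
     (\<forall>p u. u \<noteq> 0 \<longrightarrow> g p [u, u] > 0)"

definition dir_deriv :: "'m chart set \<Rightarrow> 'm vfield \<Rightarrow> ('m \<Rightarrow> real) \<Rightarrow> 'm \<Rightarrow> real" where
  "dir_deriv A X f p =
     (let c = chart_at A p
      in frechet_derivative (\<lambda>y. f (coord_inv c y)) (at (coord c p)) (X p))"

definition lie_bracket :: "'m chart set \<Rightarrow> 'm vfield \<Rightarrow> 'm vfield \<Rightarrow> 'm vfield" where
  "lie_bracket A X Y p =
     (let c = chart_at A p;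
          loc = (\<lambda>Z y. components A c (coord_inv c y) (Z (coord_inv c y)))
      in frechet_derivative (loc Y) (at (coord c p)) (X p)
         - frechet_derivative (loc X) (at (coord c p)) (Y p))"


section \<open>Connections\<close>

text \<open>A connection acts on vector fields defined on arbitrary open sets, in a local way. (The
  values of a vector field outside of the open set under consideration are irrelevant.)\<close>

type_synonym 'm conn = "'m vfield \<Rightarrow> 'm vfield \<Rightarrow> 'm vfield"

definition affine_connection ::
  "('m::topological_space) chart set \<Rightarrow> 'm conn \<Rightarrow> bool" where
  "affine_connection A nabla \<longleftrightarrow>
    (\<forall>U X Y X' Y'. open U \<and> smooth_vfield A U X \<and> smooth_vfield A U Y \<and>
        (\<forall>p\<in>U. X' p = X p \<and> Y' p = Y p) \<longrightarrow>
        (\<forall>p\<in>U. nabla X' Y' p = nabla X Y p)) \<and>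
    (\<forall>U X Y Z f. open U \<and> smooth_vfield A U X \<and> smooth_vfield A U Y \<and> smooth_vfield A U Z \<and>
        smooth_fun A U f \<longrightarrow>
        smooth_vfield A U (nabla X Y) \<and>
        (\<forall>p\<in>U. nabla (\<lambda>q. X q + Y q) Z p = nabla X Z p + nabla Y Z p) \<and>
        (\<forall>p\<in>U. nabla (\<lambda>q. f q *\<^sub>R X q) Y p = f p *\<^sub>R nabla X Y p) \<and>
        (\<forall>p\<in>U. nabla X (\<lambda>q. Y q + Z q) p = nabla X Y p + nabla X Z p) \<and>
        (\<forall>p\<in>U. nabla X (\<lambda>q. f q *\<^sub>R Y q) p = dir_deriv A X f p *\<^sub>R Y p + f p *\<^sub>R nabla X Y p))"

definition metric_connection ::
  "('m::topological_space) chart set \<Rightarrow> 'm tensor \<Rightarrow> 'm conn \<Rightarrow> bool" where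
  "metric_connection A g nabla \<longleftrightarrow> affine_connection A nabla \<and>
    (\<forall>U X Y Z. open U \<and> smooth_vfield A U X \<and> smooth_vfield A U Y \<and> smooth_vfield A U Z \<longrightarrow>
       (\<forall>p\<in>U. dir_deriv A X (\<lambda>q. g q [Y q, Z q]) p =
                g p [nabla X Y p, Z p] + g p [Y p, nabla X Z p]))"

definition torsion :: "'m chart set \<Rightarrow> 'm conn \<Rightarrow> 'm vfield \<Rightarrow> 'm vfield \<Rightarrow> 'm vfield" where
  "torsion A nabla X Y p = nabla X Y p - nabla Y X p - lie_bracket A X Y p"

definition levi_civita ::
  "('m::topological_space) chart set \<Rightarrow> 'm tensor \<Rightarrow> 'm conn \<Rightarrow> bool" where
  "levi_civita A g nabla \<longleftrightarrow> metric_connection A g nabla \<and>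
    (\<forall>U X Y. open U \<and> smooth_vfield A U X \<and> smooth_vfield A U Y \<longrightarrow>
       (\<forall>p\<in>U. torsion A nabla X Y p = 0))"

text \<open>The torsion as a (3,0)-tensor: tangent vectors at p are extended arbitrarily to vector
  fields around p.\<close>

definition torsion_tensor ::
  "('m::topological_space) chart set \<Rightarrow> 'm tensor \<Rightarrow> 'm conn \<Rightarrow>
     'm \<Rightarrow> real ^ 8 \<Rightarrow> real ^ 8 \<Rightarrow> real ^ 8 \<Rightarrow> real" where
  "torsion_tensor A g nabla p u v w =
     (THE r. \<forall>U X Y Z. open U \<and> p \<in> U \<and>
        smooth_vfield A U X \<and> smooth_vfield A U Y \<and> smooth_vfield A U Z \<and>
        X p = u \<and> Y p = v \<and> Z p = w \<longrightarrow>
        r = g p [torsion A nabla X Y p, Z p])"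


section \<open>Torsion types\<close>

text \<open>The modules of torsion tensors on a tangent space with inner product h.\<close>

type_synonym tensor3 = "real ^ 8 \<Rightarrow> real ^ 8 \<Rightarrow> real ^ 8 \<Rightarrow> real"

definition trilinear :: "tensor3 \<Rightarrow> bool" where
  "trilinear t \<longleftrightarrow> (\<forall>Y Z. linear (\<lambda>X. t X Y Z)) \<and> (\<forall>X Z. linear (\<lambda>Y. t X Y Z)) \<and>
     (\<forall>X Y. linear (\<lambda>Z. t X Y Z))"

definition TT :: "tensor3 set" where
  "TT = {t. trilinear t \<and> (\<forall>X Y Z. t X Y Z + t Y X Z = 0)}"

definition orthonormal_basis :: "(real ^ 8 \<Rightarrow> real ^ 8 \<Rightarrow> real) \<Rightarrow> (8 \<Rightarrow> real ^ 8) \<Rightarrow> bool" where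
  "orthonormal_basis h b \<longleftrightarrow> (\<forall>i j. h (b i) (b j) = (if i = j then 1 else 0))"

definition TT_8 :: "(real ^ 8 \<Rightarrow> real ^ 8 \<Rightarrow> real) \<Rightarrow> tensor3 set" where
  "TT_8 h = {t \<in> TT. \<exists>V. \<forall>X Y Z. t X Y Z = h (h V X *\<^sub>R Y - h V Y *\<^sub>R X) Z}"

definition TT_56 :: "tensor3 set" where
  "TT_56 = {t. trilinear t \<and> (\<forall>X Y Z. t X Y Z = - t Y X Z \<and> t X Y Z = - t X Z Y)}"

definition TT_160 :: "(real ^ 8 \<Rightarrow> real ^ 8 \<Rightarrow> real) \<Rightarrow> tensor3 set" where
  "TT_160 h = {t \<in> TT. (\<forall>X Y Z. t X Y Z + t Y Z X + t Z X Y = 0) \<and>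
     (\<forall>b X. orthonormal_basis h b \<longrightarrow> (\<Sum>i\<in>UNIV. t X (b i) (b i)) = 0)}"

definition TT_cyclic :: "(real ^ 8 \<Rightarrow> real ^ 8 \<Rightarrow> real) \<Rightarrow> tensor3 set" where
  "TT_cyclic h = {\<lambda>X Y Z. s X Y Z + t X Y Z | s t. s \<in> TT_8 h \<and> t \<in> TT_160 h}"

abbreviation inner_at :: "'m tensor \<Rightarrow> 'm \<Rightarrow> real ^ 8 \<Rightarrow> real ^ 8 \<Rightarrow> real" where
  "inner_at g p \<equiv> (\<lambda>u v. g p [u, v])"


section \<open>PSU(3)-structures\<close>

text \<open>The k-form on Euclidean 8-space that corresponds to the value at p of a differential
  k-form by means of the frame e.\<close>

definition form_in_frame :: "nat \<Rightarrow> (8 \<Rightarrow> 'm vfield) \<Rightarrow> 'm tensor \<Rightarrow> 'm \<Rightarrow> form" where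
  "form_in_frame k e \<alpha> p =
     (\<chi> I. if card I = k then \<alpha> p (map (\<lambda>i. e i p) (sorted_list_of_set I)) else 0)"

text \<open>The components of a tangent vector with respect to an orthonormal frame.\<close>

definition vec_in_frame :: "'m tensor \<Rightarrow> (8 \<Rightarrow> 'm vfield) \<Rightarrow> 'm \<Rightarrow> real ^ 8 \<Rightarrow> real ^ 8" where
  "vec_in_frame g e p v = (\<chi> i. g p [v, e i p])"

definition adapted_frame ::
  "('m::topological_space) chart set \<Rightarrow> 'm tensor \<Rightarrow> 'm tensor \<Rightarrow> 'm set \<Rightarrow> (8 \<Rightarrow> 'm vfield) \<Rightarrow> bool"
where
  "adapted_frame A g \<rho> U e \<longleftrightarrow>
     open U \<and> (\<forall>i. smooth_vfield A U (e i)) \<and>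
     (\<forall>p\<in>U. orthonormal_basis (inner_at g p) (\<lambda>i. e i p) \<and>
        det (\<chi> i. e i p) > 0 \<and>
        form_in_frame 3 e \<rho> p = rho0)"

definition psu3_structure ::
  "('m::{t2_space, second_countable_topology}) chart set \<Rightarrow> 'm tensor \<Rightarrow> 'm tensor \<Rightarrow> bool" where
  "psu3_structure A g \<rho> \<longleftrightarrow>
     oriented_smooth_atlas A \<and> riemannian_metric A g \<and> differential_form A 3 \<rho> \<and>
     (\<forall>p. \<exists>U e. p \<in> U \<and> adapted_frame A g \<rho> U e)"

text \<open>The connection form of a connection, in the frame e and at p, and the intrinsic torsion.\<close>

definition connection_form ::
  "'m tensor \<Rightarrow> 'm conn \<Rightarrow> (8 \<Rightarrow> 'm vfield) \<Rightarrow> 'm \<Rightarrow> vform" where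
  "connection_form g nabla e p =
     (\<chi> k. \<Sum>(i, j)\<in>{(i, j). i < j}. g p [nabla (e k) (e i) p, e j p] *\<^sub>R axis {i, j} 1)"

definition intrinsic_torsion ::
  "'m tensor \<Rightarrow> 'm conn \<Rightarrow> (8 \<Rightarrow> 'm vfield) \<Rightarrow> 'm \<Rightarrow> vform" where
  "intrinsic_torsion g nabla_g e p = (\<chi> k. pr_m (connection_form g nabla_g e p $ k))"

definition integrable_structure ::
  "('m::topological_space) chart set \<Rightarrow> 'm tensor \<Rightarrow> 'm tensor \<Rightarrow> 'm conn \<Rightarrow> bool" where
  "integrable_structure A g \<rho> nabla_g \<longleftrightarrow>
     (\<forall>U e p. adapted_frame A g \<rho> U e \<and> p \<in> U \<longrightarrow> intrinsic_torsion g nabla_g e p = 0)"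

text \<open>The sum over J is a sum of sets of vectors.\<close>

definition of_type ::
  "('m::topological_space) chart set \<Rightarrow> 'm tensor \<Rightarrow> 'm tensor \<Rightarrow> 'm conn \<Rightarrow> nat set \<Rightarrow> bool" where
  "of_type A g \<rho> nabla_g J \<longleftrightarrow>
     (\<forall>U e p. adapted_frame A g \<rho> U e \<and> p \<in> U \<longrightarrow>
        intrinsic_torsion g nabla_g e p \<in> (\<Sum>i\<in>J. WW i))"

definition characteristic_forms ::
  "('m::topological_space) chart set \<Rightarrow> 'm tensor \<Rightarrow> 'm tensor \<Rightarrow> 'm conn \<Rightarrow>
     'm tensor \<Rightarrow> 'm tensor \<Rightarrow> bool" where
  "characteristic_forms A g \<rho> nabla_g T F \<longleftrightarrow>
     differential_form A 3 T \<and> differential_form A 4 F \<and>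
     (\<forall>U e p. adapted_frame A g \<rho> U e \<and> p \<in> U \<longrightarrow>
        form_in_frame 3 e T p \<in> Lam3_8 + Lam3_20 + Lam3_27 \<and>
        form_in_frame 4 e F p \<in> hodge ` Lam4_8 + hodge ` Lam4_27 \<and>
        (\<exists>\<Gamma>. (\<forall>i\<in>{1..6}. \<Gamma> i \<in> WW i) \<and>
            intrinsic_torsion g nabla_g e p = (\<Sum>i\<in>{1..6}. \<Gamma> i) \<and>
            Theta1 (form_in_frame 3 e T p) = \<Gamma> 1 + \<Gamma> 2 + \<Gamma> 3 \<and>
            Theta2 (form_in_frame 4 e F p) = \<Gamma> 4 + \<Gamma> 5))"

definition characteristic_connection ::
  "('m::topological_space) chart set \<Rightarrow> 'm tensor \<Rightarrow> 'm tensor \<Rightarrow> 'm conn \<Rightarrow>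
     'm tensor \<Rightarrow> 'm tensor \<Rightarrow> 'm conn \<Rightarrow> bool" where
  "characteristic_connection A g \<rho> nabla_g T F nabla_c \<longleftrightarrow>
     metric_connection A g nabla_c \<and>
     (\<forall>U e X Y Z. adapted_frame A g \<rho> U e \<and>
        smooth_vfield A U X \<and> smooth_vfield A U Y \<and> smooth_vfield A U Z \<longrightarrow>
        (\<forall>p\<in>U. g p [nabla_c X Y p, Z p] =
           g p [nabla_g X Y p, Z p] + 1/2 * T p [X p, Y p, Z p]
           + eval2 (contraction 2 (ip (vec_in_frame g e p (X p)) rho0) (form_in_frame 4 e F p))
               (vec_in_frame g e p (Y p)) (vec_in_frame g e p (Z p))))"

end

theory Submission
  imports Defs
begin

text \<open>
  The coefficients of \<open>rho0\<close> are the structure constants of su(3), so \<open>sigma_plus\<close> is the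
  Chevalley-Eilenberg differential d: a derivation with $d^2 = 0$ that vanishes in top degree.
  Hence every $F = \ast dS$ is orthogonal to all exact forms. For the 2-forms
  $b_i = (e_i \lrcorner \rho) \lrcorner F$ this means $\sum_i e_i \wedge b_i = 0$, which is the vanishing
  of the cyclic sum of the tensor $b_x(y, z)$, and $b_i \in \mathfrak m$, because
  $(e_i \lrcorner \rho) \wedge (e_k \lrcorner \rho) = d(e_i \wedge (e_k \lrcorner \rho))$.

  The forms $T^c$ and $F^c$ are determined by the intrinsic torsion: pairing
  $\Phi_1(\Theta_1(T)) = 0$ with T and $\Phi_2(\Theta_2(F)) = 0$ with F gives sums of squares, so that all
  $\mathrm{pr}_{\mathfrak m}(e_i \lrcorner T)$ and all $b_i$ vanish, and these are linear systems
  with the solutions $T \in \mathbb{R} \rho$ and $F = 0$.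

  The cyclic sum of the characteristic torsion is $3 T^c$, and its trace is the contraction of $F^c$
  with $\rho$, that is the Hodge dual of $3\, dS \wedge \rho = 3\, d(S \wedge \rho)$. It vanishes for S in
  $\Lambda^3_{27}$, and for $S = \ast(d\beta \wedge \rho)$ its pairing with $\beta$ is a multiple of
  $|d\beta \wedge \rho|^2$. A vectorial torsion would give $b_x = x \wedge V \in \mathfrak m$ for all
  x, which forces $V \lrcorner \rho = 0$.
\<close>

section \<open>Forms and interior products\<close>

text \<open>The hypotheses give the components \<Gamma>_i and the pair (T^c, F^c) through an
  existential statement only, and a type is membership in a sum of sets. The obstacle is therefore
  the uniqueness of such decompositions, which has to come out of the algebra. The line spanned by
  \<rho>, on which \<open>Theta1\<close> vanishes, is excluded because each of the three modules for
  T^c is orthogonal to \<rho>, for three different reasons.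

  Two devices take the place of representation theory. Taking adjoints for the inner product
  exchanges wedge products and contractions and reduces identities of forms to tests on basis forms.
  The coefficient at \<open>UNIV\<close> acts as an integral that satisfies Stokes' theorem for d,
  so that partial integration is available. The explicit coefficients of \<rho> serve for the Jacobi
  identity, for the two linear systems and for the injectivity of the contraction of vectors with
  \<rho>.

  On the manifold everything happens at one point and in one frame. Smoothness matters for extending
  tangent vectors to vector fields, which is what gives the definite description in
  \<open>torsion_tensor\<close> its value.\<close>

lemma shuffle_sign_insert_left:
  assumes "i \<notin> I"
  shows "shuffle_sign (insert i I) J = (-1) ^ card {j \<in> J. j < i} * shuffle_sign I J"
proof -
  have "{(a, j). a \<in> insert i I \<and> j \<in> J \<and> j < a}
      = {i} \<times> {j \<in> J. j < i} \<union> {(a, j). a \<in> I \<and> j \<in> J \<and> j < a}"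
    by auto
  moreover have "({i} \<times> {j \<in> J. j < i}) \<inter> {(a, j). a \<in> I \<and> j \<in> J \<and> j < a} = {}"
    using assms by auto
  ultimately show ?thesis
    unfolding shuffle_sign_def by (simp add: card_Un_disjoint card_cartesian_product power_add)
qed

lemma shuffle_sign_insert_right:
  assumes "i \<notin> J"
  shows "shuffle_sign I (insert i J) = (-1) ^ card {a \<in> I. i < a} * shuffle_sign I J"
proof -
  have "{(a, j). a \<in> I \<and> j \<in> insert i J \<and> j < a}
      = {a \<in> I. i < a} \<times> {i} \<union> {(a, j). a \<in> I \<and> j \<in> J \<and> j < a}"
    by auto
  moreover have "({a \<in> I. i < a} \<times> {i}) \<inter> {(a, j). a \<in> I \<and> j \<in> J \<and> j < a} = {}"
    using assms by auto
  ultimately show ?thesis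
    unfolding shuffle_sign_def by (simp add: card_Un_disjoint card_cartesian_product power_add)
qed

lemma shuffle_sign_empty [simp]: "shuffle_sign {} J = 1" "shuffle_sign I {} = 1"
  by (simp_all add: shuffle_sign_def)

lemma shuffle_sign_mult_self [simp]: "shuffle_sign I J * shuffle_sign I J = 1"
  by (simp add: shuffle_sign_def flip: power_add mult_2)

lemma card_less_greater:
  fixes i :: 8
  assumes "i \<notin> I"
  shows "card I = card {j \<in> I. j < i} + card {a \<in> I. i < a}"
proof -
  have "x \<in> I \<longleftrightarrow> x \<in> {j \<in> I. j < i} \<union> {a \<in> I. i < a}" for x
    using assms less_linear[of x i] by auto
  hence "I = {j \<in> I. j < i} \<union> {a \<in> I. i < a}" by blast
  moreover have "{j \<in> I. j < i} \<inter> {a \<in> I. i < a} = {}" by auto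
  ultimately show ?thesis
    by (metis (no_types, lifting) card_Un_disjoint finite)
qed

section \<open>The exterior algebra, built on interior products\<close>

abbreviation E :: "8 \<Rightarrow> form" where "E i \<equiv> axis {i} 1"

abbreviation one_form :: form where "one_form \<equiv> axis {} 1"

text \<open>The parity automorphism of the exterior algebra. It carries the sign (-1)^k of the
  graded Leibniz and commutation rules, so that these can be stated for forms of mixed
  degree.\<close>

definition grade :: "form \<Rightarrow> form" where
  "grade \<alpha> = (\<chi> I. (-1) ^ card I * \<alpha> $ I)"

lemma linear_ip_basis: "linear (ip_basis i)"
  by (rule linearI) (auto simp: ip_basis_def vec_eq_iff algebra_simps)

lemma linear_hodge: "linear hodge"
  by (rule linearI) (auto simp: hodge_def vec_eq_iff algebra_simps)

lemma bilinear_wedge: "bilinear (\<and>\<^sub>f)"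
  unfolding bilinear_def wedge_def
  by (auto intro!: linearI simp: vec_eq_iff algebra_simps sum.distrib sum_distrib_left)

lemmas wedge_add_left = bilinear_ladd[OF bilinear_wedge]
  and wedge_add_right = bilinear_radd[OF bilinear_wedge]
  and wedge_diff_left = bilinear_lsub[OF bilinear_wedge]
  and wedge_diff_right = bilinear_rsub[OF bilinear_wedge]
  and wedge_minus_left = bilinear_lneg[OF bilinear_wedge]
  and wedge_minus_right = bilinear_rneg[OF bilinear_wedge]
  and wedge_scaleR_left = bilinear_lmul[OF bilinear_wedge]
  and wedge_scaleR_right = bilinear_rmul[OF bilinear_wedge]
  and wedge_zero_left [simp] = bilinear_lzero[OF bilinear_wedge]
  and wedge_zero_right [simp] = bilinear_rzero[OF bilinear_wedge]

lemma wedge_sum_left: "(\<Sum>i\<in>S. f i) \<and>\<^sub>f \<beta> = (\<Sum>i\<in>S. f i \<and>\<^sub>f \<beta>)"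
  by (induction S rule: infinite_finite_induct) (auto simp: wedge_add_left)

lemma wedge_sum_right: "\<beta> \<and>\<^sub>f (\<Sum>i\<in>S. f i) = (\<Sum>i\<in>S. \<beta> \<and>\<^sub>f f i)"
  by (induction S rule: infinite_finite_induct) (auto simp: wedge_add_right)

lemmas wedge_linear = wedge_add_left wedge_add_right wedge_diff_left wedge_diff_right
  wedge_minus_left wedge_minus_right wedge_scaleR_left wedge_scaleR_right

lemmas ip_basis_linear = linear_add[OF linear_ip_basis] linear_diff[OF linear_ip_basis]
  linear_neg[OF linear_ip_basis] linear_scale[OF linear_ip_basis]

lemmas ip_basis_zero [simp] = linear_0[OF linear_ip_basis]
lemmas ip_basis_sum = linear_sum[OF linear_ip_basis]

lemma wedge_nth_empty: "(\<alpha> \<and>\<^sub>f \<beta>) $ {} = \<alpha> $ {} * \<beta> $ {}"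
  by (simp add: wedge_def)

text \<open>A coefficient at a nonempty index set is, up to sign, a coefficient of an interior
  product at a smaller set. This is the induction step of \<open>wedge_assoc\<close>,
  \<open>wedge_commute_graded\<close> and \<open>one_wedge\<close>.\<close>

lemma nth_insert:
  assumes "i \<notin> J"
  shows "\<alpha> $ insert i J = (-1) ^ card {j \<in> J. j < i} * ip_basis i \<alpha> $ J"
  using assms by (simp add: ip_basis_def flip: power_add mult_2 mult.assoc)

lemma form_eq_iff_ip: "\<alpha> = \<beta> \<longleftrightarrow> \<alpha> $ {} = \<beta> $ {} \<and> (\<forall>i. ip_basis i \<alpha> = ip_basis i \<beta>)"
proof (intro iffI)
  assume *: "\<alpha> $ {} = \<beta> $ {} \<and> (\<forall>i. ip_basis i \<alpha> = ip_basis i \<beta>)"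
  have "\<alpha> $ K = \<beta> $ K" for K
  proof (cases "K = {}")
    case False
    then obtain i J where "K = insert i J" "i \<notin> J"
      by (metis Set.set_insert all_not_in_conv)
    thus ?thesis using * by (simp add: nth_insert)
  qed (use * in simp)
  thus "\<alpha> = \<beta>" by (simp add: vec_eq_iff)
qed simp

text \<open>For i outside J the subsets of \<open>insert i J\<close> split according to the factor
  that receives i, and this gives the two terms on the right. For i in J the left side vanishes, and
  on the right the terms for I and \<open>insert i I\<close> cancel.\<close>

lemma ip_basis_wedge:
  "ip_basis i (\<alpha> \<and>\<^sub>f \<beta>) = ip_basis i \<alpha> \<and>\<^sub>f \<beta> + grade \<alpha> \<and>\<^sub>f ip_basis i \<beta>"
proof -
  have "ip_basis i (\<alpha> \<and>\<^sub>f \<beta>) $ J = (ip_basis i \<alpha> \<and>\<^sub>f \<beta> + grade \<alpha> \<and>\<^sub>f ip_basis i \<beta>) $ J" for J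
  proof (cases "i \<in> J")
    case True
    then obtain L where J: "J = insert i L" and L: "i \<notin> L" by (meson Set.set_insert)
    have inj: "inj_on (insert i) (Pow L)"
      using L by (auto intro!: inj_onI dest: insert_ident[THEN iffD1, rotated 2])
    have disj: "Pow L \<inter> insert i ` Pow L = {}" using L by auto
    have "shuffle_sign I (insert i L - I) * ip_basis i \<alpha> $ I * \<beta> $ (insert i L - I)
        + shuffle_sign (insert i I) (L - I) * (grade \<alpha> $ insert i I * ip_basis i \<beta> $ (L - I)) = 0"
      if "I \<subseteq> L" for I
    proof -
      have eq: "insert i L - I = insert i (L - I)" using that L by auto
      have iI: "i \<notin> I" using that L by auto
      have "card I = card {j \<in> I. j < i} + card {a \<in> I. i < a}"
        using iI by (intro card_less_greater) auto
      hence c: "(-1::real) ^ card {a \<in> I. i < a} * (-1) ^ card {j \<in> I. j < i} = (-1) ^ card I"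
        by (simp add: power_add)
      have s: "(-1::real) ^ card {j \<in> L. j < i \<and> j \<notin> I} * (-1) ^ card {j \<in> L. j < i \<and> j \<notin> I} = 1"
        by (simp flip: power_add mult_2)
      have "shuffle_sign I (insert i L - I) * ip_basis i \<alpha> $ I * \<beta> $ (insert i L - I)
        = ((-1) ^ card {a \<in> I. i < a} * (-1) ^ card {j \<in> I. j < i}) * shuffle_sign I (L - I)
          * \<alpha> $ insert i I * \<beta> $ insert i (L - I)"
        using L iI by (simp add: eq shuffle_sign_insert_right ip_basis_def)
      moreover have "shuffle_sign (insert i I) (L - I) * (grade \<alpha> $ insert i I * ip_basis i \<beta> $ (L - I))
        = - ((-1) ^ card {j \<in> L. j < i \<and> j \<notin> I} * (-1) ^ card {j \<in> L. j < i \<and> j \<notin> I}) *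
          ((-1) ^ card I * shuffle_sign I (L - I) * \<alpha> $ insert i I * \<beta> $ insert i (L - I))"
        using L iI by (simp add: shuffle_sign_insert_left ip_basis_def grade_def conj_commute conj_left_commute)
      ultimately show ?thesis unfolding c s by simp
    qed
    moreover have "(ip_basis i \<alpha> \<and>\<^sub>f \<beta> + grade \<alpha> \<and>\<^sub>f ip_basis i \<beta>) $ J
      = (\<Sum>I\<in>Pow L. shuffle_sign I (insert i L - I) * ip_basis i \<alpha> $ I * \<beta> $ (insert i L - I)
        + shuffle_sign (insert i I) (L - I) * (grade \<alpha> $ insert i I * ip_basis i \<beta> $ (L - I)))"
    proof -
      have "insert i L - insert i I = L - I" if "I \<subseteq> L" for I using L that by auto
      moreover have "ip_basis i \<beta> $ (insert i L - I) = 0" if "I \<subseteq> L" for I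
        using L that by (auto simp: ip_basis_def)
      ultimately show ?thesis
        using L by (auto simp: wedge_def J Pow_insert sum.union_disjoint disj sum.reindex[OF inj]
            sum.distrib ip_basis_def intro!: sum.cong)
    qed
    ultimately have "(ip_basis i \<alpha> \<and>\<^sub>f \<beta> + grade \<alpha> \<and>\<^sub>f ip_basis i \<beta>) $ J = 0" by simp
    thus ?thesis using True by (simp add: ip_basis_def)
  next
    case False
    define s where "s = (\<lambda>L::8 set. (-1::real) ^ card {j \<in> L. j < i})"
    have Pow: "Pow (insert i J) = Pow J \<union> insert i ` Pow J" by (rule Pow_insert)
    have inj: "inj_on (insert i) (Pow J)"
      using False by (auto intro!: inj_onI dest: insert_ident[THEN iffD1, rotated 2])
    have split: "s J = s I * s (J - I)" if "I \<subseteq> J" for I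
    proof -
      have "{j \<in> J. j < i} = {j \<in> I. j < i} \<union> {j \<in> J - I. j < i}" using that by auto
      hence "card {j \<in> J. j < i} = card {j \<in> I. j < i} + card {j \<in> J - I. j < i}"
        by (simp add: card_Un_disjoint disjoint_iff)
      thus ?thesis by (simp add: s_def power_add)
    qed
    have ss: "s L * s L = 1" for L by (simp add: s_def flip: power_add mult_2)
    \<comment> \<open>Moving e_i to the front of e_I and moving it to the end cost together one
      transposition per element of I; this is where \<open>grade\<close> comes from.\<close>
    have gr: "s I * (-1) ^ card {a \<in> I. i < a} = (-1) ^ card I" if "I \<subseteq> J" for I
    proof -
      have "card I = card {j \<in> I. j < i} + card {a \<in> I. i < a}"
        using that False by (intro card_less_greater) auto
      thus ?thesis by (simp add: s_def power_add)
    qed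
    have "ip_basis i (\<alpha> \<and>\<^sub>f \<beta>) $ J = s J * (\<alpha> \<and>\<^sub>f \<beta>) $ (insert i J)"
      using False by (simp add: ip_basis_def s_def)
    also have "\<dots> = s J * ((\<Sum>I\<in>Pow J. shuffle_sign I (insert i J - I) * \<alpha> $ I * \<beta> $ (insert i J - I))
        + (\<Sum>I\<in>Pow J. shuffle_sign (insert i I) (J - I) * \<alpha> $ insert i I * \<beta> $ (J - I)))"
    proof -
      have "Pow J \<inter> insert i ` Pow J = {}" using False by auto
      moreover have "insert i J - insert i I = J - I" if "I \<subseteq> J" for I using False that by auto
      ultimately show ?thesis
        unfolding wedge_def
        by (simp add: Pow sum.union_disjoint sum.reindex[OF inj])
    qed
    also have "(\<Sum>I\<in>Pow J. shuffle_sign I (insert i J - I) * \<alpha> $ I * \<beta> $ (insert i J - I))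
        = (\<Sum>I\<in>Pow J. s J * (shuffle_sign I (J - I) * grade \<alpha> $ I * ip_basis i \<beta> $ (J - I)))"
    proof (rule sum.cong[OF refl])
      fix I assume "I \<in> Pow J"
      hence I: "I \<subseteq> J" by simp
      hence eq: "insert i J - I = insert i (J - I)" using False by auto
      have 1: "shuffle_sign I (insert i (J - I)) = (-1) ^ card {a \<in> I. i < a} * shuffle_sign I (J - I)"
        using False by (simp add: shuffle_sign_insert_right)
      have 2: "ip_basis i \<beta> $ (J - I) = s (J - I) * \<beta> $ (insert i (J - I))"
        using False by (simp add: ip_basis_def s_def)
      have 3: "(-1) ^ card {a \<in> I. i < a} = s I * (-1) ^ card I"
        using gr[OF I] ss[of I] by (metis mult.assoc mult_1)
      have 4: "s J * s (J - I) = s I" using split[OF I] ss[of "J - I"] by (simp add: mult.assoc)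
      have "s J * (shuffle_sign I (J - I) * grade \<alpha> $ I * ip_basis i \<beta> $ (J - I))
        = (s J * s (J - I)) * (-1) ^ card I * shuffle_sign I (J - I) * \<alpha> $ I * \<beta> $ (insert i (J - I))"
        unfolding 2 by (simp add: grade_def ac_simps)
      thus "shuffle_sign I (insert i J - I) * \<alpha> $ I * \<beta> $ (insert i J - I) =
          s J * (shuffle_sign I (J - I) * grade \<alpha> $ I * ip_basis i \<beta> $ (J - I))"
        unfolding eq 1 3 4 by (simp only: ac_simps)
    qed
    also have "(\<Sum>I\<in>Pow J. shuffle_sign (insert i I) (J - I) * \<alpha> $ insert i I * \<beta> $ (J - I))
      = (\<Sum>I\<in>Pow J. s J * (shuffle_sign I (J - I) * ip_basis i \<alpha> $ I * \<beta> $ (J - I)))"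
    proof (rule sum.cong[OF refl])
      fix I assume "I \<in> Pow J"
      hence I: "I \<subseteq> J" and iI: "i \<notin> I" using False by auto
      have 1: "shuffle_sign (insert i I) (J - I) = s (J - I) * shuffle_sign I (J - I)"
        using iI by (simp add: shuffle_sign_insert_left s_def)
      have 2: "ip_basis i \<alpha> $ I = s I * \<alpha> $ insert i I"
        using iI by (simp add: ip_basis_def s_def)
      have 4: "s J * s I = s (J - I)" using split[OF I] ss[of I] by (simp add: ac_simps)
      have "s J * (shuffle_sign I (J - I) * ip_basis i \<alpha> $ I * \<beta> $ (J - I))
        = (s J * s I) * shuffle_sign I (J - I) * \<alpha> $ insert i I * \<beta> $ (J - I)"
        unfolding 2 by (simp add: ac_simps)
      thus "shuffle_sign (insert i I) (J - I) * \<alpha> $ insert i I * \<beta> $ (J - I) =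
          s J * (shuffle_sign I (J - I) * ip_basis i \<alpha> $ I * \<beta> $ (J - I))"
        unfolding 1 4 by (rule sym)
    qed
    also have "s J * ((\<Sum>I\<in>Pow J. s J * f I) + (\<Sum>I\<in>Pow J. s J * f' I)) = sum f' (Pow J) + sum f (Pow J)"
      for f f' :: "8 set \<Rightarrow> real"
      using ss[of J] by (simp flip: sum_distrib_left distrib_left mult.assoc)
    finally show ?thesis
      by (simp add: wedge_def mult.assoc)
  qed
  thus ?thesis by (simp add: vec_eq_iff)
qed

lemma grade_grade [simp]: "grade (grade \<alpha>) = \<alpha>"
  by (simp add: grade_def vec_eq_iff flip: power_add mult_2 mult.assoc)

lemma grade_wedge: "grade (\<alpha> \<and>\<^sub>f \<beta>) = grade \<alpha> \<and>\<^sub>f grade \<beta>"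
proof -
  have "(-1::real) ^ card K = (-1) ^ card I * (-1) ^ card (K - I)" if "I \<subseteq> K" for I K :: "8 set"
  proof -
    have "card K = card I + card (K - I)"
      using that by (metis card_Un_disjoint Diff_disjoint Un_Diff_cancel finite sup.absorb2)
    thus ?thesis by (simp add: power_add)
  qed
  thus ?thesis
    by (auto simp: grade_def wedge_def vec_eq_iff sum_distrib_left intro!: sum.cong)
qed

lemma ip_basis_grade: "ip_basis i (grade \<alpha>) = - grade (ip_basis i \<alpha>)"
  by (auto simp: ip_basis_def grade_def vec_eq_iff)

text \<open>Induction on the index set: by the Leibniz rule, contracting both sides with e_i leads
  to the same identity for contracted factors on a smaller set. Hence the three forms are
  generalised.\<close>

lemma wedge_assoc: "(\<alpha> \<and>\<^sub>f \<beta>) \<and>\<^sub>f \<gamma> = \<alpha> \<and>\<^sub>f \<beta> \<and>\<^sub>f \<gamma>"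
proof -
  have "((\<alpha> \<and>\<^sub>f \<beta>) \<and>\<^sub>f \<gamma>) $ K = (\<alpha> \<and>\<^sub>f \<beta> \<and>\<^sub>f \<gamma>) $ K" for K
    using finite[of K]
  proof (induction K arbitrary: \<alpha> \<beta> \<gamma> rule: finite_induct)
    case empty
    show ?case by (simp add: wedge_nth_empty)
  next
    case (insert i J)
    thus ?case by (simp add: nth_insert ip_basis_wedge grade_wedge wedge_linear)
  qed
  thus ?thesis by (simp add: vec_eq_iff)
qed

text \<open>Both parities are treated in one induction, because a contraction of \<alpha> changes
  its parity and so exchanges the two cases.\<close>

lemma wedge_commute_graded:
  shows wedge_commute_even: "grade \<alpha> = \<alpha> \<Longrightarrow> \<alpha> \<and>\<^sub>f \<beta> = \<beta> \<and>\<^sub>f \<alpha>"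
    and wedge_commute_odd: "grade \<alpha> = - \<alpha> \<Longrightarrow> \<alpha> \<and>\<^sub>f \<beta> = grade \<beta> \<and>\<^sub>f \<alpha>"
proof -
  have "(grade \<alpha> = \<alpha> \<longrightarrow> (\<alpha> \<and>\<^sub>f \<beta>) $ K = (\<beta> \<and>\<^sub>f \<alpha>) $ K) \<and>
      (grade \<alpha> = - \<alpha> \<longrightarrow> (\<alpha> \<and>\<^sub>f \<beta>) $ K = (grade \<beta> \<and>\<^sub>f \<alpha>) $ K)" for K \<alpha> \<beta>
    using finite[of K]
  proof (induction K arbitrary: \<alpha> \<beta> rule: finite_induct)
    case empty
    show ?case by (simp add: wedge_nth_empty grade_def)
  next
    case (insert i J)
    note IH = insert.IH[of "ip_basis i \<alpha>" \<beta>] insert.IH[of \<alpha> "ip_basis i \<beta>"]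
    have e: "grade (ip_basis i \<alpha>) = - ip_basis i (grade \<alpha>)" by (simp add: ip_basis_grade)
    show ?case
    proof (intro conjI impI)
      assume a: "grade \<alpha> = \<alpha>"
      hence "grade (ip_basis i \<alpha>) = - ip_basis i \<alpha>" using e by simp
      with a IH insert.hyps show "(\<alpha> \<and>\<^sub>f \<beta>) $ insert i J = (\<beta> \<and>\<^sub>f \<alpha>) $ insert i J"
        by (simp add: nth_insert ip_basis_wedge)
    next
      assume a: "grade \<alpha> = - \<alpha>"
      hence "grade (ip_basis i \<alpha>) = ip_basis i \<alpha>" using e by (simp add: ip_basis_linear)
      with a IH insert.hyps show "(\<alpha> \<and>\<^sub>f \<beta>) $ insert i J = (grade \<beta> \<and>\<^sub>f \<alpha>) $ insert i J"
        by (simp add: nth_insert ip_basis_wedge ip_basis_grade wedge_linear)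
    qed
  qed
  thus "grade \<alpha> = \<alpha> \<Longrightarrow> \<alpha> \<and>\<^sub>f \<beta> = \<beta> \<and>\<^sub>f \<alpha>"
    and "grade \<alpha> = - \<alpha> \<Longrightarrow> \<alpha> \<and>\<^sub>f \<beta> = grade \<beta> \<and>\<^sub>f \<alpha>"
    by (auto simp: vec_eq_iff[of "\<alpha> \<and>\<^sub>f \<beta>"])
qed

lemma ip_basis_ip_basis: "ip_basis i (ip_basis j \<alpha>) = - ip_basis j (ip_basis i \<alpha>)"
proof (cases "i = j")
  case True
  thus ?thesis by (auto simp: ip_basis_def vec_eq_iff)
next
  case False
  \<comment> \<open>Inserting i shifts the position of j by one exactly if i < j. As just one of i <
    j and j < i holds, the two orders of contraction differ by a single sign.\<close>
  have *: "card {k \<in> insert i J. k < j} = (if i < j then 1 else 0) + card {k \<in> J. k < j}"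
    if "i \<notin> J" for i j :: 8 and J
  proof -
    have "{k \<in> insert i J. k < j} = (if i < j then insert i {k \<in> J. k < j} else {k \<in> J. k < j})"
      by auto
    thus ?thesis using that by simp
  qed
  have "ip_basis i (ip_basis j \<alpha>) $ J = - ip_basis j (ip_basis i \<alpha>) $ J" for J
  proof (cases "i \<in> J \<or> j \<in> J")
    case True
    thus ?thesis by (auto simp: ip_basis_def)
  next
    case nin: False
    have "i < j \<and> \<not> j < i \<or> j < i \<and> \<not> i < j" using False by auto
    thus ?thesis
      using nin False *[of i J j] *[of j J i]
      by (auto simp: ip_basis_def insert_commute power_add)
  qed
  thus ?thesis by (simp add: vec_eq_iff)
qed

lemma ip_basis_ip_basis_same [simp]: "ip_basis i (ip_basis i \<alpha>) = 0"
  by (simp add: ip_basis_def vec_eq_iff)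

lemma ip_basis_one [simp]: "ip_basis i one_form = 0"
  by (simp add: ip_basis_def vec_eq_iff axis_def)

lemma ip_basis_E: "ip_basis i (E j) = (if i = j then one_form else 0)"
  by (auto simp: ip_basis_def vec_eq_iff axis_def)

lemma grade_E [simp]: "grade (E i) = - E i"
  by (auto simp: grade_def vec_eq_iff axis_def)

lemma grade_one [simp]: "grade one_form = one_form"
  by (auto simp: grade_def vec_eq_iff axis_def)

lemma one_form_nth_empty [simp]: "one_form $ {} = 1"
  by (simp add: axis_def)

lemma one_wedge [simp]: "one_form \<and>\<^sub>f \<beta> = \<beta>"
proof -
  have "(one_form \<and>\<^sub>f \<beta>) $ K = \<beta> $ K" for K
    using finite[of K]
    by (induction K arbitrary: \<beta> rule: finite_induct)
      (simp_all add: wedge_nth_empty nth_insert ip_basis_wedge)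
  thus ?thesis by (simp add: vec_eq_iff)
qed

lemma wedge_one [simp]: "\<beta> \<and>\<^sub>f one_form = \<beta>"
  using wedge_commute_even[of one_form \<beta>] by simp

lemma E_wedge_nth:
  "(E i \<and>\<^sub>f \<beta>) $ K = (if i \<in> K then (-1) ^ card {j \<in> K. j < i} * \<beta> $ (K - {i}) else 0)"
proof -
  have "(E i \<and>\<^sub>f \<beta>) $ K = (\<Sum>I\<in>Pow K. if I = {i} then shuffle_sign I (K - I) * \<beta> $ (K - I) else 0)"
    unfolding wedge_def vec_lambda_beta by (rule sum.cong) (auto simp: axis_def)
  also have "\<dots> = (if i \<in> K then shuffle_sign {i} (K - {i}) * \<beta> $ (K - {i}) else 0)"
    by (subst sum.delta) auto
  also have "shuffle_sign {i} (K - {i}) = (-1) ^ card {j \<in> K. j < i}"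
  proof -
    have "{j \<in> K - {i}. j < i} = {j \<in> K. j < i}" by auto
    thus ?thesis by (simp add: shuffle_sign_insert_left)
  qed
  finally show ?thesis .
qed

section \<open>Adjoints: contraction and the Hodge operator\<close>

lemma inner_ip_basis: "ip_basis i \<alpha> \<bullet> \<beta> = \<alpha> \<bullet> (E i \<and>\<^sub>f \<beta>)"
proof -
  \<comment> \<open>Index sets without and with i correspond by J \<mapsto>
    \<open>insert i J\<close>, and both inner products become sums over these pairs.\<close>
  have UN: "(UNIV :: 8 set set) = {J. i \<notin> J} \<union> insert i ` {J. i \<notin> J}"
  proof -
    have "J \<in> insert i ` {J. i \<notin> J}" if "i \<in> J" for J
      using that by (intro image_eqI[of _ _ "J - {i}"]) auto
    thus ?thesis by blast
  qed
  have inj: "inj_on (insert i) {J. i \<notin> J}" by (auto simp: inj_on_def insert_ident)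
  have lt: "card {j. (j = i \<or> j \<in> J) \<and> j < i} = card {j \<in> J. j < i}" for J
    by (rule arg_cong[where f = card]) auto
  have "\<alpha> \<bullet> (E i \<and>\<^sub>f \<beta>) = (\<Sum>J\<in>{J. i \<notin> J} \<union> insert i ` {J. i \<notin> J}. \<alpha> $ J * (E i \<and>\<^sub>f \<beta>) $ J)"
    by (simp add: inner_vec_def flip: UN)
  also have "\<dots> = (\<Sum>J | i \<notin> J. \<alpha> $ insert i J * ((-1) ^ card {j \<in> J. j < i} * \<beta> $ J))"
    by (subst sum.union_disjoint) (auto simp: E_wedge_nth sum.reindex[OF inj] lt intro!: sum.cong)
  also have "\<dots> = (\<Sum>J\<in>{J. i \<notin> J} \<union> insert i ` {J. i \<notin> J}. ip_basis i \<alpha> $ J * \<beta> $ J)"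
    by (subst sum.union_disjoint) (auto simp: ip_basis_def sum.reindex[OF inj] intro!: sum.cong)
  also have "\<dots> = ip_basis i \<alpha> \<bullet> \<beta>"
    by (simp add: inner_vec_def flip: UN)
  finally show ?thesis by simp
qed

text \<open>The coefficient at \<open>UNIV\<close> is the multiple of the volume form. Through it
  the Hodge operator is linked to the wedge product in mixed degree, and together with
  \<open>sigma_plus_top\<close> it works like an integral over a closed manifold.\<close>

lemma inner_hodge: "\<alpha> \<bullet> hodge \<gamma> = (\<gamma> \<and>\<^sub>f \<alpha>) $ UNIV"
proof -
  have "(\<gamma> \<and>\<^sub>f \<alpha>) $ UNIV = (\<Sum>I\<in>uminus ` UNIV. shuffle_sign I (- I) * \<gamma> $ I * \<alpha> $ (- I))"
  proof -
    have "range (uminus :: 8 set \<Rightarrow> 8 set) = UNIV" by (metis double_complement surj_def)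
    thus ?thesis by (simp add: wedge_def flip: Compl_eq_Diff_UNIV)
  qed
  also have "\<dots> = (\<Sum>I\<in>UNIV. shuffle_sign (- I) I * \<gamma> $ (- I) * \<alpha> $ I)"
    by (subst sum.reindex) (auto intro: injI)
  finally show ?thesis by (simp add: inner_vec_def hodge_def ac_simps)
qed

lemma wedge_hodge_top: "(\<alpha> \<and>\<^sub>f hodge \<beta>) $ UNIV = \<alpha> \<bullet> \<beta>"
proof -
  have "shuffle_sign I (- I) * \<alpha> $ I * (shuffle_sign I (- I) * \<beta> $ I) = \<alpha> $ I * \<beta> $ I" for I
    using shuffle_sign_mult_self[of I "- I"] by algebra
  thus ?thesis
    unfolding wedge_def hodge_def inner_vec_def vec_lambda_beta Compl_eq_Diff_UNIV[symmetric]
      Pow_UNIV double_complement inner_real_def by (intro sum.cong refl)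
qed

lemma ip_basis_top [simp]: "ip_basis i \<alpha> $ UNIV = 0"
  by (simp add: ip_basis_def)

section \<open>Degrees, and the contraction by a 2-form\<close>

lemma LamD: "\<alpha> \<in> Lam k \<Longrightarrow> card I \<noteq> k \<Longrightarrow> \<alpha> $ I = 0"
  by (auto simp: Lam_def)

lemma subspace_Lam: "subspace (Lam k)"
  by (auto simp: subspace_def Lam_def) (metis add.right_neutral add_0)

lemma grade_Lam: "\<alpha> \<in> Lam k \<Longrightarrow> grade \<alpha> = (-1) ^ k *\<^sub>R \<alpha>"
  by (auto simp: grade_def vec_eq_iff Lam_def)

lemma E_Lam: "E i \<in> Lam 1"
  by (auto simp: Lam_def axis_def split: if_splits)

lemma ip_basis_Lam: "\<alpha> \<in> Lam (Suc k) \<Longrightarrow> ip_basis i \<alpha> \<in> Lam k"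
  by (auto simp: Lam_def ip_basis_def split: if_splits)

lemma wedge_Lam:
  assumes "\<alpha> \<in> Lam k" "\<beta> \<in> Lam l"
  shows "\<alpha> \<and>\<^sub>f \<beta> \<in> Lam (k + l)"
proof -
  have "card K = k + l" if "(\<alpha> \<and>\<^sub>f \<beta>) $ K \<noteq> 0" for K
  proof -
    obtain I where I: "I \<subseteq> K" "\<alpha> $ I \<noteq> 0" "\<beta> $ (K - I) \<noteq> 0"
      using \<open>(\<alpha> \<and>\<^sub>f \<beta>) $ K \<noteq> 0\<close> by (auto simp: wedge_def elim!: sum.not_neutral_contains_not_neutral)
    hence "card I = k" "card (K - I) = l" using assms by (auto simp: Lam_def)
    moreover have "card K = card I + card (K - I)"
      using I(1) by (metis card_Un_disjoint Diff_disjoint Un_Diff_cancel finite sup.absorb2)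
    ultimately show ?thesis by simp
  qed
  thus ?thesis by (simp add: Lam_def)
qed

lemma hodge_Lam:
  assumes "\<alpha> \<in> Lam k" "k \<le> 8"
  shows "hodge \<alpha> \<in> Lam (8 - k)"
proof -
  have "card J = 8 - k" if "\<alpha> $ (- J) \<noteq> 0" for J :: "8 set"
  proof -
    have "card (- J) = k" using assms that by (auto simp: Lam_def)
    moreover have "card (- J) = 8 - card J" by (simp add: Compl_eq_Diff_UNIV card_Diff_subset)
    moreover have "card J \<le> 8" using card_mono[of UNIV J] by simp
    ultimately show ?thesis by simp
  qed
  thus ?thesis by (auto simp: Lam_def hodge_def)
qed

lemma sigma_op_1: "sigma_op 1 \<alpha> \<beta> = (\<Sum>i\<in>UNIV. ip_basis i \<alpha> \<and>\<^sub>f ip_basis i \<beta>)"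
proof -
  have "{I :: 8 set. card I = 1} = (\<lambda>i. {i}) ` UNIV" by (auto simp: card_1_singleton_iff)
  moreover have "inj_on (\<lambda>i::8. {i}) UNIV" by (simp add: inj_on_def)
  ultimately show ?thesis by (simp add: sigma_op_def sum.reindex)
qed

lemma Lam_2_expand:
  assumes "\<omega> \<in> Lam 2"
  shows "\<omega> = (\<Sum>I | card I = 2. \<omega> $ I *\<^sub>R axis I 1)"
proof -
  have "(\<Sum>I | card I = 2. \<omega> $ I *\<^sub>R axis I 1) $ K = \<omega> $ K" for K
    using assms by (auto simp: axis_def sum.delta LamD if_distrib[of "\<lambda>x. _ * x"] cong: if_cong)
  thus ?thesis by (simp add: vec_eq_iff)
qed

lemma E_wedge_E:
  assumes "i < j"
  shows "E i \<and>\<^sub>f E j = axis {i, j} 1"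
proof -
  have "(E i \<and>\<^sub>f E j) $ K = axis {i, j} 1 $ K" for K
  proof (cases "K = {i, j}")
    case True
    have "{k \<in> {i, j}. k < i} = {}" and "{i, j} - {i} = {j}" using assms by auto
    thus ?thesis using True by (simp add: E_wedge_nth del: Collect_empty_eq)
  next
    case False
    hence "K - {i} \<noteq> {j}" if "i \<in> K" using that by auto
    hence "(E i \<and>\<^sub>f E j) $ K = 0" unfolding E_wedge_nth by (simp add: axis_def)
    thus ?thesis using False by (simp add: axis_def)
  qed
  thus ?thesis by (simp add: vec_eq_iff)
qed

lemma ip_basis_Lam_2:
  assumes "\<omega> \<in> Lam 2" "i < j"
  shows "ip_basis i (ip_basis j \<omega>) = - (\<omega> $ {i, j}) *\<^sub>R one_form"
proof -
  have L: "ip_basis i (ip_basis j \<omega>) \<in> Lam 0"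
    using assms by (intro ip_basis_Lam) (simp add: numeral_2_eq_2)
  have "{k \<in> {i}. k < j} = {i}" using assms by auto
  hence "ip_basis i (ip_basis j \<omega>) $ {} = - (\<omega> $ {i, j})"
    using assms(2) by (simp add: ip_basis_def insert_commute)
  moreover have "ip_basis i (ip_basis j \<omega>) $ K = 0" if "K \<noteq> {}" for K
    using LamD[OF L, of K] that by simp
  ultimately show ?thesis by (auto simp: vec_eq_iff axis_def)
qed

text \<open>For i < j the double contraction of \<omega> is minus its coefficient at {i, j}, and the
  adjoint of the double contraction is the product with e_j \<and> e_i, which is minus that with e_i
  \<and> e_j. The signs cancel, so contraction by \<omega> is adjoint to the wedge product with
  \<omega>.\<close>

lemma inner_contraction_2:
  assumes "\<omega> \<in> Lam 2"
  shows "\<eta> \<bullet> contraction 2 \<omega> F = (\<omega> \<and>\<^sub>f \<eta>) \<bullet> F"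
proof -
  have "\<eta> \<bullet> (foldr ip_basis (sorted_list_of_set I) \<omega> \<and>\<^sub>f foldr ip_basis (sorted_list_of_set I) F)
      = \<omega> $ I * ((axis I 1 \<and>\<^sub>f \<eta>) \<bullet> F)" if "card I = 2" for I
  proof -
    obtain i j where I: "I = {i, j}" and ij: "i < j"
    proof -
      obtain a b where ab: "I = {a, b}" "a \<noteq> b" using \<open>card I = 2\<close> by (metis card_2_iff)
      show ?thesis
      proof (cases "a < b")
        case True
        thus ?thesis using ab that[of a b] by simp
      next
        case False
        thus ?thesis using ab that[of b a] by (simp add: insert_commute)
      qed
    qed
    have s: "sorted_list_of_set I = [i, j]"
      using ij by (auto simp: I sorted_list_of_set_insert_remove)
    have "\<eta> \<bullet> ip_basis i (ip_basis j F) = (E j \<and>\<^sub>f E i \<and>\<^sub>f \<eta>) \<bullet> F"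
      by (simp add: inner_commute[of _ "ip_basis _ _"] inner_ip_basis inner_commute[of F])
    also have "E j \<and>\<^sub>f E i \<and>\<^sub>f \<eta> = - (axis I 1 \<and>\<^sub>f \<eta>)"
    proof -
      have "E j \<and>\<^sub>f E i = - (E i \<and>\<^sub>f E j)"
        using wedge_commute_odd[of "E j" "E i"] by (simp add: wedge_linear)
      thus ?thesis
        by (simp add: I wedge_linear flip: wedge_assoc E_wedge_E[OF ij])
    qed
    finally show ?thesis
      using ij assms by (simp add: s ip_basis_Lam_2 wedge_linear flip: I)
  qed
  hence "\<eta> \<bullet> contraction 2 \<omega> F = ((\<Sum>I | card I = 2. \<omega> $ I *\<^sub>R axis I 1) \<and>\<^sub>f \<eta>) \<bullet> F"
    by (simp add: sigma_op_def inner_sum_right inner_sum_left wedge_sum_left wedge_linear)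
  thus ?thesis using Lam_2_expand[OF assms] by simp
qed

section \<open>The differential of su(3)\<close>

lemma UNIV_8: "(UNIV :: 8 set) = {0, 1, 2, 3, 4, 5, 6, 7}"
proof (rule card_subset_eq[symmetric])
  show "card {0, 1, 2, 3, 4, 5, 6, 7 :: 8} = card (UNIV :: 8 set)" by simp
qed auto

lemma forall_8: "(\<forall>i::8. P i) \<longleftrightarrow> P 0 \<and> P 1 \<and> P 2 \<and> P 3 \<and> P 4 \<and> P 5 \<and> P 6 \<and> P 7"
proof -
  have "(\<forall>i::8. P i) \<longleftrightarrow> (\<forall>i\<in>{0, 1, 2, 3, 4, 5, 6, 7}. P i)" by (simp flip: UNIV_8)
  thus ?thesis by simp
qed

lemma sum_8: "(\<Sum>i\<in>(UNIV::8 set). f i) = f 0 + f 1 + f 2 + f 3 + f 4 + f 5 + f 6 + f 7"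
  unfolding UNIV_8 by (simp add: add.assoc)

lemma ebasis_eq_E: "ebasis n = E (of_nat (n - 1))"
  by (simp add: ebasis_def)

text \<open>Explicit calculations use the natural numbers 1, ..., 8 of \<open>ebasis\<close>, since
  numerals of type nat are ordered by rewriting. The indices of \<open>E\<close> are shifted by one
  against them.\<close>

lemma E_eq_ebasis:
  "E 0 = ebasis 1" "E 1 = ebasis 2" "E 2 = ebasis 3" "E 3 = ebasis 4"
  "E 4 = ebasis 5" "E 5 = ebasis 6" "E 6 = ebasis 7" "E 7 = ebasis 8"
  by (simp_all add: ebasis_eq_E)

lemma E_anticommute: "E i \<and>\<^sub>f E j = - (E j \<and>\<^sub>f E i)"
  using wedge_commute_odd[of "E i" "E j"] by (simp add: wedge_linear)

text \<open>The condition m < n orients anticommutation as a sorting rule. The second version acts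
  at the front of a longer product nested to the right.\<close>

lemma ebasis_anticommute:
  assumes "m < n"
  shows "ebasis n \<and>\<^sub>f ebasis m = - (ebasis m \<and>\<^sub>f ebasis n)"
    and "ebasis n \<and>\<^sub>f ebasis m \<and>\<^sub>f \<alpha> = - (ebasis m \<and>\<^sub>f ebasis n \<and>\<^sub>f \<alpha>)"
proof -
  show "ebasis n \<and>\<^sub>f ebasis m = - (ebasis m \<and>\<^sub>f ebasis n)"
    by (simp only: ebasis_eq_E E_anticommute[of "of_nat (n - 1)"])
  thus "ebasis n \<and>\<^sub>f ebasis m \<and>\<^sub>f \<alpha> = - (ebasis m \<and>\<^sub>f ebasis n \<and>\<^sub>f \<alpha>)"
    by (simp add: wedge_minus_left flip: wedge_assoc)
qed

lemma E_wedge_same [simp]: "E i \<and>\<^sub>f E i = 0" "E i \<and>\<^sub>f E i \<and>\<^sub>f \<alpha> = 0"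
proof -
  show "E i \<and>\<^sub>f E i = 0" using E_anticommute[of i i] by (simp add: eq_neg_iff_add_eq_0 flip: scaleR_2)
  thus "E i \<and>\<^sub>f E i \<and>\<^sub>f \<alpha> = 0" by (simp flip: wedge_assoc)
qed

lemma ebasis_wedge_same [simp]: "ebasis n \<and>\<^sub>f ebasis n = 0" "ebasis n \<and>\<^sub>f ebasis n \<and>\<^sub>f \<alpha> = 0"
  by (simp_all add: ebasis_eq_E)

lemma ip_basis_E_wedge: "ip_basis i (E j \<and>\<^sub>f \<alpha>) = (if i = j then \<alpha> else 0) - E j \<and>\<^sub>f ip_basis i \<alpha>"
  by (simp add: ip_basis_wedge ip_basis_E wedge_linear)

lemma ip_basis_ebasis:
  "ip_basis i (ebasis n) = (if i = of_nat (n - 1) then one_form else 0)"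
  "ip_basis i (ebasis n \<and>\<^sub>f \<alpha>) = (if i = of_nat (n - 1) then \<alpha> else 0) - ebasis n \<and>\<^sub>f ip_basis i \<alpha>"
  by (simp_all add: ebasis_eq_E ip_basis_E ip_basis_E_wedge)

section \<open>The 3-form in coordinates\<close>

lemma rho0_expand:
  "rho0 = ebasis 2 \<and>\<^sub>f ebasis 4 \<and>\<^sub>f ebasis 6 - ebasis 2 \<and>\<^sub>f ebasis 3 \<and>\<^sub>f ebasis 5
     - ebasis 1 \<and>\<^sub>f ebasis 4 \<and>\<^sub>f ebasis 5 - ebasis 1 \<and>\<^sub>f ebasis 3 \<and>\<^sub>f ebasis 6
     + ebasis 1 \<and>\<^sub>f ebasis 2 \<and>\<^sub>f ebasis 7 + ebasis 3 \<and>\<^sub>f ebasis 4 \<and>\<^sub>f ebasis 7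
     - 2 *\<^sub>R (ebasis 5 \<and>\<^sub>f ebasis 6 \<and>\<^sub>f ebasis 7)
     + sqrt 3 *\<^sub>R (ebasis 1 \<and>\<^sub>f ebasis 2 \<and>\<^sub>f ebasis 8) - sqrt 3 *\<^sub>R (ebasis 3 \<and>\<^sub>f ebasis 4 \<and>\<^sub>f ebasis 8)"
  by (simp add: rho0_def eform_def wedge_linear wedge_assoc scaleR_diff_right)

text \<open>These eight 2-forms span psu(3) = \<Lambda>^2_8. The rows involve disjoint sets of basis
  2-forms, except that rows 6 and 7 share e_12 and e_34. The choices of test forms further below
  rely on this pattern.\<close>

lemma ip_basis_rho0:
  "ip_basis 0 rho0 = - (ebasis 4 \<and>\<^sub>f ebasis 5) - ebasis 3 \<and>\<^sub>f ebasis 6 + ebasis 2 \<and>\<^sub>f ebasis 7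
     + sqrt 3 *\<^sub>R (ebasis 2 \<and>\<^sub>f ebasis 8)"
  "ip_basis 1 rho0 = ebasis 4 \<and>\<^sub>f ebasis 6 - ebasis 3 \<and>\<^sub>f ebasis 5 - ebasis 1 \<and>\<^sub>f ebasis 7
     - sqrt 3 *\<^sub>R (ebasis 1 \<and>\<^sub>f ebasis 8)"
  "ip_basis 2 rho0 = ebasis 2 \<and>\<^sub>f ebasis 5 + ebasis 1 \<and>\<^sub>f ebasis 6 + ebasis 4 \<and>\<^sub>f ebasis 7
     - sqrt 3 *\<^sub>R (ebasis 4 \<and>\<^sub>f ebasis 8)"
  "ip_basis 3 rho0 = - (ebasis 2 \<and>\<^sub>f ebasis 6) + ebasis 1 \<and>\<^sub>f ebasis 5 - ebasis 3 \<and>\<^sub>f ebasis 7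
     + sqrt 3 *\<^sub>R (ebasis 3 \<and>\<^sub>f ebasis 8)"
  "ip_basis 4 rho0 = - (ebasis 2 \<and>\<^sub>f ebasis 3) - ebasis 1 \<and>\<^sub>f ebasis 4 - 2 *\<^sub>R (ebasis 6 \<and>\<^sub>f ebasis 7)"
  "ip_basis 5 rho0 = ebasis 2 \<and>\<^sub>f ebasis 4 - ebasis 1 \<and>\<^sub>f ebasis 3 + 2 *\<^sub>R (ebasis 5 \<and>\<^sub>f ebasis 7)"
  "ip_basis 6 rho0 = ebasis 1 \<and>\<^sub>f ebasis 2 + ebasis 3 \<and>\<^sub>f ebasis 4 - 2 *\<^sub>R (ebasis 5 \<and>\<^sub>f ebasis 6)"
  "ip_basis 7 rho0 = sqrt 3 *\<^sub>R (ebasis 1 \<and>\<^sub>f ebasis 2) - sqrt 3 *\<^sub>R (ebasis 3 \<and>\<^sub>f ebasis 4)"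
  unfolding rho0_expand
  by (simp_all add: ip_basis_linear ip_basis_ebasis wedge_linear)

lemma ebasis_Lam: "ebasis n \<in> Lam 1"
  unfolding ebasis_eq_E by (rule E_Lam)

lemma ebasis_wedge_Lam: "\<alpha> \<in> Lam k \<Longrightarrow> ebasis n \<and>\<^sub>f \<alpha> \<in> Lam (Suc k)"
  using wedge_Lam[OF ebasis_Lam] by simp

lemma rho0_Lam: "rho0 \<in> Lam 3"
proof -
  have "ebasis i \<and>\<^sub>f ebasis j \<and>\<^sub>f ebasis k \<in> Lam 3" for i j k
    using ebasis_wedge_Lam[OF ebasis_wedge_Lam[OF ebasis_Lam]] by (simp add: eval_nat_numeral)
  thus ?thesis unfolding rho0_expand
    by (intro subspace_add subspace_diff subspace_mul subspace_Lam)
qed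

lemma ip_basis_rho0_Lam: "ip_basis i rho0 \<in> Lam 2"
  using rho0_Lam ip_basis_Lam[of rho0 2] by simp

lemma grade_rho0: "grade rho0 = - rho0" and grade_ip_basis_rho0: "grade (ip_basis i rho0) = ip_basis i rho0"
  using grade_Lam[OF rho0_Lam] grade_Lam[OF ip_basis_rho0_Lam] by simp_all

lemma sqrt_3_mult: "sqrt 3 * (sqrt 3 * x) = 3 * x"
  by (simp flip: mult.assoc)

text \<open>Expansion under an inner product with a fixed form, so that only real coefficients are
  collected. (The plain simplifier would turn sums of equal forms into componentwise products.)\<close>

lemmas ebasis_normalize = wedge_linear wedge_assoc ebasis_anticommute ebasis_wedge_same
  wedge_zero_right wedge_zero_left one_less_numeral_iff numeral_less_iff less_num_simps le_num_simps
  inner_add_right inner_diff_right inner_minus_right inner_scaleR_right inner_zero_right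

text \<open>The Jacobi identity of su(3), with the coefficients of \<open>rho0\<close> as structure
  constants. For instance, e_1234 occurs with coefficient 2 in each of the squares for i = 4, 5, 6
  and with coefficient -6 for i = 7, which explains the factor sqrt 3 in
  \<open>rho0\<close>.\<close>

lemma jacobi: "(\<Sum>i\<in>UNIV. ip_basis i rho0 \<and>\<^sub>f ip_basis i rho0) = 0"
proof -
  have "X \<bullet> (\<Sum>i\<in>UNIV. ip_basis i rho0 \<and>\<^sub>f ip_basis i rho0) = 0" for X
    unfolding sum_8 ip_basis_rho0
    by (simp only: ebasis_normalize,
        simp only: minus_minus minus_zero mult_zero_right add_0 add_0_right diff_0_right,
        simp only: distrib_left right_diff_distrib mult_minus_right sqrt_3_mult minus_minus)
  from this[of "\<Sum>i\<in>UNIV. ip_basis i rho0 \<and>\<^sub>f ip_basis i rho0"] show ?thesis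
    by (rule inner_eq_zero_iff[THEN iffD1])
qed

section \<open>Derivation rule, square zero and Stokes' theorem\<close>

lemma sigma_plus_eq: "sigma_plus \<alpha> = (\<Sum>i\<in>UNIV. ip_basis i rho0 \<and>\<^sub>f ip_basis i \<alpha>)"
  by (simp add: sigma_plus_def sigma_op_1[simplified])

lemma linear_sigma_plus: "linear sigma_plus"
  by (rule linearI)
    (simp_all add: sigma_plus_eq ip_basis_linear wedge_linear sum.distrib scaleR_sum_right)

text \<open>Each summand of \<open>sigma_plus\<close> is a contraction followed by the product with
  a 2-form. Since 2-forms commute with all forms, the Leibniz rule of the contraction is
  inherited.\<close>

lemma sigma_plus_wedge:
  "sigma_plus (\<alpha> \<and>\<^sub>f \<beta>) = sigma_plus \<alpha> \<and>\<^sub>f \<beta> + grade \<alpha> \<and>\<^sub>f sigma_plus \<beta>"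
proof -
  have "ip_basis i rho0 \<and>\<^sub>f grade \<alpha> \<and>\<^sub>f \<gamma> = grade \<alpha> \<and>\<^sub>f ip_basis i rho0 \<and>\<^sub>f \<gamma>" for i \<gamma>
    using wedge_commute_even[OF grade_ip_basis_rho0, of i "grade \<alpha>"] by (metis wedge_assoc)
  thus ?thesis
    by (simp add: sigma_plus_eq ip_basis_wedge wedge_linear wedge_sum_left wedge_sum_right
        wedge_assoc sum.distrib)
qed

lemma sigma_plus_rho0: "sigma_plus rho0 = 0"
  by (simp add: sigma_plus_eq jacobi)

lemma sigma_plus_E: "sigma_plus (E i) = ip_basis i rho0"
proof -
  have "sigma_plus (E i) = (\<Sum>j\<in>UNIV. if j = i then ip_basis j rho0 else 0)"
    unfolding sigma_plus_eq by (intro sum.cong) (auto simp: ip_basis_E)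
  thus ?thesis by (simp add: sum.delta)
qed

text \<open>Contract the Jacobi identity with e_j. As \<open>ip_basis j rho0\<close> is the
  differential of e_j, this is d^2 = 0 on the generators.\<close>

lemma sigma_plus_ip_basis_rho0: "sigma_plus (ip_basis j rho0) = 0"
proof -
  have "0 = ip_basis j (\<Sum>i\<in>UNIV. ip_basis i rho0 \<and>\<^sub>f ip_basis i rho0)"
    by (simp add: jacobi)
  also have "\<dots> = (\<Sum>i\<in>UNIV. 2 *\<^sub>R (ip_basis i rho0 \<and>\<^sub>f ip_basis j (ip_basis i rho0)))"
    by (simp add: wedge_commute_even[OF grade_ip_basis_rho0, where \<beta> = "ip_basis j (ip_basis i rho0)" for i]
        ip_basis_sum ip_basis_wedge grade_ip_basis_rho0 scaleR_2)
  also have "\<dots> = - (2 *\<^sub>R sigma_plus (ip_basis j rho0))"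
    by (simp add: sigma_plus_eq ip_basis_ip_basis[of j] wedge_linear sum_negf scaleR_sum_right)
  finally show ?thesis by simp
qed

lemma sigma_plus_sigma_plus: "sigma_plus (sigma_plus \<alpha>) = 0"
proof -
  let ?S = "\<Sum>j\<in>UNIV. \<Sum>i\<in>UNIV. ip_basis i rho0 \<and>\<^sub>f ip_basis j rho0 \<and>\<^sub>f ip_basis i (ip_basis j \<alpha>)"
  \<comment> \<open>In ?S the product of the two 2-forms is symmetric in i and j, and the double
    contraction is skew. Exchanging i and j therefore gives - ?S.\<close>
  have "?S = (\<Sum>i\<in>UNIV. \<Sum>j\<in>UNIV. ip_basis i rho0 \<and>\<^sub>f ip_basis j rho0 \<and>\<^sub>f ip_basis i (ip_basis j \<alpha>))"
    by (rule sum.swap)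
  also have "\<dots> = (\<Sum>i\<in>UNIV. \<Sum>j\<in>UNIV. - (ip_basis j rho0 \<and>\<^sub>f ip_basis i rho0 \<and>\<^sub>f ip_basis j (ip_basis i \<alpha>)))"
  proof (intro sum.cong refl)
    fix i j
    have "ip_basis i rho0 \<and>\<^sub>f ip_basis j rho0 = ip_basis j rho0 \<and>\<^sub>f ip_basis i rho0"
      by (rule wedge_commute_even[OF grade_ip_basis_rho0])
    thus "ip_basis i rho0 \<and>\<^sub>f ip_basis j rho0 \<and>\<^sub>f ip_basis i (ip_basis j \<alpha>)
        = - (ip_basis j rho0 \<and>\<^sub>f ip_basis i rho0 \<and>\<^sub>f ip_basis j (ip_basis i \<alpha>))"
      by (simp add: ip_basis_ip_basis[of i j] wedge_linear flip: wedge_assoc)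
  qed
  also have "\<dots> = - ?S" by (simp add: sum_negf)
  finally have "?S = 0" by (simp add: eq_neg_iff_add_eq_0 flip: scaleR_2)
  moreover have "sigma_plus (sigma_plus \<alpha>)
      = (\<Sum>j\<in>UNIV. sigma_plus (ip_basis j rho0) \<and>\<^sub>f ip_basis j \<alpha>) + ?S"
    unfolding sigma_plus_eq[of \<alpha>] linear_sum[OF linear_sigma_plus] sigma_plus_wedge
    by (simp add: sum.distrib grade_ip_basis_rho0 sigma_plus_eq wedge_sum_right)
      (intro sum.cong refl, metis wedge_assoc wedge_commute_even[OF grade_ip_basis_rho0])
  ultimately show ?thesis by (simp add: sigma_plus_ip_basis_rho0)
qed

text \<open>Contracting twice with e_i gives zero, so each summand is itself a contraction by e_i
  and lacks a top component. This is the unimodularity of su(3), or Stokes' theorem for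
  left-invariant forms.\<close>

lemma sigma_plus_top: "sigma_plus \<beta> $ UNIV = 0"
proof -
  have "ip_basis i rho0 \<and>\<^sub>f ip_basis i \<beta> = ip_basis i (ip_basis i rho0 \<and>\<^sub>f \<beta>)" for i
    by (simp add: ip_basis_wedge grade_ip_basis_rho0)
  thus ?thesis by (simp add: sigma_plus_eq)
qed

lemma sigma_plus_Lam:
  assumes "\<alpha> \<in> Lam (Suc k)"
  shows "sigma_plus \<alpha> \<in> Lam (k + 2)"
  unfolding sigma_plus_eq
  using wedge_Lam[OF ip_basis_rho0_Lam ip_basis_Lam[OF assms]]
  by (intro subspace_sum subspace_Lam) (simp add: add.commute)

text \<open>Partial integration: dT \<and> dS is the differential of T \<and> dS, and its top
  component is the inner product in question.\<close>

lemma inner_sigma_plus: "sigma_plus S \<bullet> hodge (sigma_plus T) = 0"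
proof -
  have "sigma_plus S \<bullet> hodge (sigma_plus T) = sigma_plus (T \<and>\<^sub>f sigma_plus S) $ UNIV"
    by (simp add: inner_hodge sigma_plus_wedge sigma_plus_sigma_plus)
  thus ?thesis by (simp add: sigma_plus_top)
qed

section \<open>Two linear systems\<close>

lemma Lam_Suc_eq_0:
  assumes "\<alpha> \<in> Lam (Suc k)" "\<And>i. ip_basis i \<alpha> = 0"
  shows "\<alpha> = 0"
  using assms LamD[OF assms(1), of "{}"] by (simp add: form_eq_iff_ip[of \<alpha>])

lemma Lam_0_eq_0:
  assumes "\<alpha> \<in> Lam 0" "\<alpha> \<bullet> one_form = 0"
  shows "\<alpha> = 0"
proof -
  have "\<alpha> $ {} = 0" using assms(2) by (simp add: inner_axis)
  thus ?thesis using LamD[OF assms(1)] by (metis card_eq_0_iff finite vec_eq_iff zero_index)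
qed

lemma E_ebasis_cases:
  obtains n where "1 \<le> n" "n < 9" "E i = ebasis n"
proof -
  have "\<forall>i. \<exists>n. 1 \<le> n \<and> n < 9 \<and> E i = ebasis n"
    unfolding forall_8 E_eq_ebasis
    by (intro conjI; rule exI, rule conjI[rotated], rule conjI[rotated], rule refl) simp_all
  thus ?thesis using that by blast
qed

section \<open>Reduction to increasing indices\<close>

lemma all_less_numeral:
  "(\<forall>a < numeral k. P a) \<longleftrightarrow> (\<forall>a < pred_numeral k. P a) \<and> P (pred_numeral k)"
  by (simp add: numeral_eq_Suc All_less_Suc2 less_Suc_eq) blast

lemma all_less_one: "(\<forall>a < 1 :: nat. P a) \<longleftrightarrow> P 0"
  by simp

lemmas bounded_all_simps = all_less_numeral all_less_one pred_numeral_simps BitM.simps numeral_One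

lemma alternating_3_eq_0:
  fixes t :: "'i::linorder \<Rightarrow> 'i \<Rightarrow> 'i \<Rightarrow> real"
  assumes alt: "\<And>a b c. t b a c = - t a b c" "\<And>a b c. t a c b = - t a b c"
    and sorted: "\<And>a b c. a \<in> R \<Longrightarrow> b \<in> R \<Longrightarrow> c \<in> R \<Longrightarrow> a < b \<Longrightarrow> b < c \<Longrightarrow> t a b c = 0"
    and R: "a \<in> R" "b \<in> R" "c \<in> R"
  shows "t a b c = 0"
proof -
  have eq: "t a a c = 0" "t a b b = 0" for a b c
    using alt(1)[of a a c] alt(2)[of a b b] by auto
  \<comment> \<open>The last two indices are in order; at most two transpositions bring the first
    one into place.\<close>
  have 1: "t a b c = 0" if "b < c" "a \<in> R" "b \<in> R" "c \<in> R" for a b c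
  proof -
    consider "a < b" | "a = b" | "b < a" "a < c" | "a = c" | "c < a" by (meson less_linear)
    thus ?thesis
    proof cases
      case 3
      thus ?thesis using sorted that alt(1)[of a b c] by simp
    next
      case 4
      thus ?thesis using alt(1)[of b a c] eq by simp
    next
      case 5
      thus ?thesis using sorted that alt(1)[of a b c] alt(2)[of b a c] by simp
    qed (use sorted that eq in auto)
  qed
  consider "b < c" | "b = c" | "c < b" by (meson less_linear)
  thus ?thesis
    by cases (use 1 eq R alt(2)[of a b c] in auto)
qed

lemma alternating_4_eq_0:
  fixes f :: "'i::linorder \<Rightarrow> 'i \<Rightarrow> 'i \<Rightarrow> 'i \<Rightarrow> real"
  assumes alt: "\<And>a b c d. f b a c d = - f a b c d" "\<And>a b c d. f a c b d = - f a b c d"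
      "\<And>a b c d. f a b d c = - f a b c d"
    and sorted: "\<And>a b c d. a \<in> R \<Longrightarrow> b \<in> R \<Longrightarrow> c \<in> R \<Longrightarrow> d \<in> R \<Longrightarrow> a < b \<Longrightarrow> b < c \<Longrightarrow> c < d
        \<Longrightarrow> f a b c d = 0"
    and R: "a \<in> R" "b \<in> R" "c \<in> R" "d \<in> R"
  shows "f a b c d = 0"
proof -
  have eq: "f a a c d = 0" "f a b b d = 0" "f a b c c = 0" for a b c d
    using alt(1)[of a a c d] alt(2)[of a b b d] alt(3)[of a b c c] by auto
  \<comment> \<open>Here a < b < c, and d is moved to the left into its place.\<close>
  have last: "f a b c d = 0" if "a \<in> R" "b \<in> R" "c \<in> R" "a < b" "b < c" for a b c
  proof -
    consider "d < a" | "d = a" | "a < d" "d < b" | "d = b" | "b < d" "d < c" | "d = c" | "c < d"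
      by (meson less_linear)
    thus ?thesis
    proof cases
      case 1
      thus ?thesis using sorted that R(4) alt(3)[of a b c d] alt(2)[of a b d c] alt(1)[of a d b c] by simp
    next
      case 2
      thus ?thesis using eq alt(3)[of a b c d] alt(2)[of a b d c] by simp
    next
      case 3
      thus ?thesis using sorted that R(4) alt(3)[of a b c d] alt(2)[of a b d c] by simp
    next
      case 4
      thus ?thesis using eq alt(3)[of a b c d] by simp
    next
      case 5
      thus ?thesis using sorted that R(4) alt(3)[of a b c d] by simp
    qed (use sorted that R(4) eq in auto)
  qed
  show ?thesis
    by (rule alternating_3_eq_0[where t = "\<lambda>a b c. f a b c d" and R = R])
      (fact alt(1) alt(2) last R)+
qed

lemma ebasis_swap:
  "T \<bullet> (ebasis b \<and>\<^sub>f ebasis a) = - (T \<bullet> (ebasis a \<and>\<^sub>f ebasis b))"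
  "T \<bullet> (ebasis b \<and>\<^sub>f ebasis a \<and>\<^sub>f \<alpha>) = - (T \<bullet> (ebasis a \<and>\<^sub>f ebasis b \<and>\<^sub>f \<alpha>))"
  "T \<bullet> (ebasis c \<and>\<^sub>f ebasis b \<and>\<^sub>f ebasis a) = - (T \<bullet> (ebasis c \<and>\<^sub>f ebasis a \<and>\<^sub>f ebasis b))"
  "T \<bullet> (ebasis c \<and>\<^sub>f ebasis b \<and>\<^sub>f ebasis a \<and>\<^sub>f \<alpha>) = - (T \<bullet> (ebasis c \<and>\<^sub>f ebasis a \<and>\<^sub>f ebasis b \<and>\<^sub>f \<alpha>))"
  "T \<bullet> (ebasis d \<and>\<^sub>f ebasis c \<and>\<^sub>f ebasis b \<and>\<^sub>f ebasis a)
     = - (T \<bullet> (ebasis d \<and>\<^sub>f ebasis c \<and>\<^sub>f ebasis a \<and>\<^sub>f ebasis b))"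
proof -
  have "ebasis b \<and>\<^sub>f ebasis a = - (ebasis a \<and>\<^sub>f ebasis b)"
    unfolding ebasis_eq_E by (rule E_anticommute)
  moreover from this have "ebasis b \<and>\<^sub>f ebasis a \<and>\<^sub>f \<alpha> = - (ebasis a \<and>\<^sub>f ebasis b \<and>\<^sub>f \<alpha>)"
    by (simp add: wedge_minus_left flip: wedge_assoc)
  ultimately show
    "T \<bullet> (ebasis b \<and>\<^sub>f ebasis a) = - (T \<bullet> (ebasis a \<and>\<^sub>f ebasis b))"
    "T \<bullet> (ebasis b \<and>\<^sub>f ebasis a \<and>\<^sub>f \<alpha>) = - (T \<bullet> (ebasis a \<and>\<^sub>f ebasis b \<and>\<^sub>f \<alpha>))"
    "T \<bullet> (ebasis c \<and>\<^sub>f ebasis b \<and>\<^sub>f ebasis a) = - (T \<bullet> (ebasis c \<and>\<^sub>f ebasis a \<and>\<^sub>f ebasis b))"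
    "T \<bullet> (ebasis c \<and>\<^sub>f ebasis b \<and>\<^sub>f ebasis a \<and>\<^sub>f \<alpha>) = - (T \<bullet> (ebasis c \<and>\<^sub>f ebasis a \<and>\<^sub>f ebasis b \<and>\<^sub>f \<alpha>))"
    "T \<bullet> (ebasis d \<and>\<^sub>f ebasis c \<and>\<^sub>f ebasis b \<and>\<^sub>f ebasis a)
     = - (T \<bullet> (ebasis d \<and>\<^sub>f ebasis c \<and>\<^sub>f ebasis a \<and>\<^sub>f ebasis b))"
    by (simp_all only: wedge_minus_right inner_minus_right)
qed

lemma ebasis_wedge_ebasis_Lam: "ebasis a \<and>\<^sub>f ebasis b \<in> Lam 2"
  using ebasis_wedge_Lam[OF ebasis_Lam] by (simp add: eval_nat_numeral)

lemma inner_ebasis_wedge: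
  "(ebasis a \<and>\<^sub>f ebasis b) \<bullet> (ebasis c \<and>\<^sub>f ebasis d)
    = (if (of_nat (a - 1) :: 8) = of_nat (c - 1) \<and> (of_nat (b - 1) :: 8) = of_nat (d - 1) then 1 else 0)
    - (if (of_nat (a - 1) :: 8) = of_nat (d - 1) \<and> (of_nat (b - 1) :: 8) = of_nat (c - 1) then 1 else 0)"
proof -
  have "(E i \<and>\<^sub>f E j) \<bullet> (E k \<and>\<^sub>f E l)
      = (if i = k \<and> j = l then 1 else 0) - (if i = l \<and> j = k then 1 else 0)" for i j k l
  proof -
    have "(E i \<and>\<^sub>f E j) \<bullet> (E k \<and>\<^sub>f E l) = ip_basis i (E k \<and>\<^sub>f E l) \<bullet> E j"
      by (simp only: inner_ip_basis) (rule inner_commute)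
    also have "\<dots> = (if i = k then E l \<bullet> E j else 0) - (if i = l then E k \<bullet> E j else 0)"
      by (simp only: ip_basis_E_wedge ip_basis_E inner_diff_left
          if_distrib[of "\<lambda>x. x \<bullet> E j"] if_distrib[of "(\<and>\<^sub>f) (E k)"]
          inner_zero_left wedge_one wedge_zero_right)
    also have "\<dots> = (if i = k \<and> j = l then 1 else 0) - (if i = l \<and> j = k then 1 else 0)"
      using eq_commute[of l j] eq_commute[of k j]
      by (cases "l = j"; cases "k = j"; cases "i = k"; cases "i = l") (simp_all add: inner_axis_axis)
    finally show ?thesis .
  qed
  thus ?thesis by (simp only: ebasis_eq_E)
qed

text \<open>The condition on \<omega> is membership in \<open>mm\<close> in the form of
  \<open>mm_iff\<close>, so every contraction of T by e_i lies in the span of the rows of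
  \<open>ip_basis_rho0\<close>. The elimination shows that T is then a multiple of
  \<open>rho0\<close>, to which it is also orthogonal.\<close>

lemma form_3_orthogonal_rho0_eq_0:
  assumes T: "T \<in> Lam 3" and rho: "T \<bullet> rho0 = 0"
    and mm: "\<And>i \<omega>. \<omega> \<in> Lam 2 \<Longrightarrow> (\<And>k. \<omega> \<bullet> ip_basis k rho0 = 0) \<Longrightarrow> ip_basis i T \<bullet> \<omega> = 0"
  shows "T = 0"
proof -
  define t where "t a b c = T \<bullet> (ebasis a \<and>\<^sub>f ebasis b \<and>\<^sub>f ebasis c)" for a b c
  have alt0: "t b a c = - t a b c" "t a c b = - t a b c" for a b c
    unfolding t_def by (rule ebasis_swap)+
  have alt: "b < a \<Longrightarrow> t a b c = - t b a c" "c < b \<Longrightarrow> t a b c = - t a c b" "t a a c = 0" "t a b b = 0" for a b c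
    using alt0[of a b c] alt0(1)[of a a c] alt0(2)[of a b b] by auto
  have W: "T \<bullet> (ebasis n \<and>\<^sub>f \<omega>) = 0"
    if "\<omega> \<in> Lam 2" "\<forall>k. \<omega> \<bullet> ip_basis k rho0 = 0" for n \<omega>
    using mm[of \<omega>] that by (simp add: inner_ip_basis ebasis_eq_E)
  note mm_simps = ebasis_wedge_ebasis_Lam subspace_add[OF subspace_Lam] subspace_diff[OF subspace_Lam]
    subspace_mul[OF subspace_Lam] forall_8 ip_basis_rho0 inner_simps inner_ebasis_wedge
    wedge_linear wedge_assoc t_def
  \<comment> \<open>Each \<omega> from here on is orthogonal to all rows of
    \<open>ip_basis_rho0\<close>: e_58, e_68 and e_78 occur in no row, and the others combine
    entries of one row, or e_12, e_34 and e_56 from rows 6 and 7, so that the inner products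
    cancel.\<close>
  have W1: "t n 5 8 = 0" for n
    using W[where n = n and \<omega> = "ebasis 5 \<and>\<^sub>f ebasis 8"]
    by (simp add: mm_simps)
  have W2: "t n 6 8 = 0" for n
    using W[where n = n and \<omega> = "ebasis 6 \<and>\<^sub>f ebasis 8"]
    by (simp add: mm_simps)
  have W3: "t n 7 8 = 0" for n
    using W[where n = n and \<omega> = "ebasis 7 \<and>\<^sub>f ebasis 8"]
    by (simp add: mm_simps)
  have W4: "t n 4 5 - t n 3 6 = 0" for n
    using W[where n = n and \<omega> = "ebasis 4 \<and>\<^sub>f ebasis 5 - ebasis 3 \<and>\<^sub>f ebasis 6"]
    by (simp add: mm_simps)
  have W5: "t n 4 5 + t n 2 7 = 0" for n
    using W[where n = n and \<omega> = "ebasis 4 \<and>\<^sub>f ebasis 5 + ebasis 2 \<and>\<^sub>f ebasis 7"]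
    by (simp add: mm_simps)
  have W6: "t n 4 6 + t n 3 5 = 0" for n
    using W[where n = n and \<omega> = "ebasis 4 \<and>\<^sub>f ebasis 6 + ebasis 3 \<and>\<^sub>f ebasis 5"]
    by (simp add: mm_simps)
  have W7: "t n 4 6 + t n 1 7 = 0" for n
    using W[where n = n and \<omega> = "ebasis 4 \<and>\<^sub>f ebasis 6 + ebasis 1 \<and>\<^sub>f ebasis 7"]
    by (simp add: mm_simps)
  have W8: "t n 2 5 - t n 1 6 = 0" for n
    using W[where n = n and \<omega> = "ebasis 2 \<and>\<^sub>f ebasis 5 - ebasis 1 \<and>\<^sub>f ebasis 6"]
    by (simp add: mm_simps)
  have W9: "t n 2 5 - t n 4 7 = 0" for n
    using W[where n = n and \<omega> = "ebasis 2 \<and>\<^sub>f ebasis 5 - ebasis 4 \<and>\<^sub>f ebasis 7"]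
    by (simp add: mm_simps)
  have W10: "t n 2 6 + t n 1 5 = 0" for n
    using W[where n = n and \<omega> = "ebasis 2 \<and>\<^sub>f ebasis 6 + ebasis 1 \<and>\<^sub>f ebasis 5"]
    by (simp add: mm_simps)
  have W11: "t n 2 6 - t n 3 7 = 0" for n
    using W[where n = n and \<omega> = "ebasis 2 \<and>\<^sub>f ebasis 6 - ebasis 3 \<and>\<^sub>f ebasis 7"]
    by (simp add: mm_simps)
  have W12: "t n 2 3 - t n 1 4 = 0" for n
    using W[where n = n and \<omega> = "ebasis 2 \<and>\<^sub>f ebasis 3 - ebasis 1 \<and>\<^sub>f ebasis 4"]
    by (simp add: mm_simps)
  have W13: "2 * t n 2 3 - t n 6 7 = 0" for n
    using W[where n = n and \<omega> = "2 *\<^sub>R (ebasis 2 \<and>\<^sub>f ebasis 3) - ebasis 6 \<and>\<^sub>f ebasis 7"]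
    by (simp add: mm_simps)
  have W14: "t n 2 4 + t n 1 3 = 0" for n
    using W[where n = n and \<omega> = "ebasis 2 \<and>\<^sub>f ebasis 4 + ebasis 1 \<and>\<^sub>f ebasis 3"]
    by (simp add: mm_simps)
  have W15: "2 * t n 2 4 - t n 5 7 = 0" for n
    using W[where n = n and \<omega> = "2 *\<^sub>R (ebasis 2 \<and>\<^sub>f ebasis 4) - ebasis 5 \<and>\<^sub>f ebasis 7"]
    by (simp add: mm_simps)
  have W16: "t n 1 2 + t n 3 4 + t n 5 6 = 0" for n
    using W[where n = n and \<omega> = "ebasis 1 \<and>\<^sub>f ebasis 2 + ebasis 3 \<and>\<^sub>f ebasis 4 + ebasis 5 \<and>\<^sub>f ebasis 6"]
    by (simp add: mm_simps)
  have z0_1: "t 1 5 8 = 0" "t 2 5 8 = 0" "t 3 5 8 = 0" "t 4 5 8 = 0" "t 5 6 8 = 0" "t 5 7 8 = 0"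
    using W1[of 1] W1[of 2] W1[of 3] W1[of 4] W1[of 6] W1[of 7]
    by (simp_all add: alt del: One_nat_def)
  have z0_2: "t 1 6 8 = 0" "t 2 6 8 = 0" "t 3 6 8 = 0" "t 4 6 8 = 0" "t 6 7 8 = 0"
    using W2[of 1] W2[of 2] W2[of 3] W2[of 4] W2[of 7]
    by (simp_all add: alt del: One_nat_def)
  have z0_3: "t 1 7 8 = 0" "t 2 7 8 = 0" "t 3 7 8 = 0" "t 4 7 8 = 0"
    using W3[of 1] W3[of 2] W3[of 3] W3[of 4]
    by (simp_all add: alt del: One_nat_def)
  \<comment> \<open>In a relation with two terms, taking n among the indices of one term makes this
    term vanish and isolates the other. The later stages insert the zeros already found.\<close>
  have z0_4: "t 3 4 5 = 0" "t 3 4 6 = 0" "t 3 5 6 = 0" "t 4 5 6 = 0"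
    using W4[of 3] W4[of 4] W4[of 5] W4[of 6]
    by (simp_all add: alt del: One_nat_def)
  have z0_5: "t 2 4 5 = 0" "t 2 4 7 = 0" "t 2 5 7 = 0" "t 4 5 7 = 0"
    using W5[of 2] W5[of 4] W5[of 5] W5[of 7]
    by (simp_all add: alt del: One_nat_def)
  have z0_7: "t 1 4 6 = 0" "t 1 4 7 = 0" "t 1 6 7 = 0" "t 4 6 7 = 0"
    using W7[of 1] W7[of 4] W7[of 6] W7[of 7]
    by (simp_all add: alt del: One_nat_def)
  have z0_8: "t 1 2 5 = 0" "t 1 2 6 = 0" "t 1 5 6 = 0" "t 2 5 6 = 0"
    using W8[of 1] W8[of 2] W8[of 5] W8[of 6]
    by (simp_all add: alt del: One_nat_def)
  have z0_11: "t 2 3 7 = 0" "t 2 3 6 = 0" "t 3 6 7 = 0" "t 2 6 7 = 0"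
    using W11[of 2] W11[of 3] W11[of 6] W11[of 7]
    by (simp_all add: alt del: One_nat_def)
  have z0_12: "t 1 2 3 = 0" "t 1 2 4 = 0" "t 1 3 4 = 0" "t 2 3 4 = 0"
    using W12[of 1] W12[of 2] W12[of 3] W12[of 4]
    by (simp_all add: alt del: One_nat_def)
  note z0 = z0_1 z0_2 z0_3 z0_4 z0_5 z0_7 z0_8 z0_11 z0_12
  have z1_6: "t 1 3 5 = 0" "t 3 5 7 = 0"
    using W6[of 1] W6[of 7]
    by (simp_all add: alt z0 del: One_nat_def)
  have z1_7: "t 1 3 7 = 0" "t 1 5 7 = 0"
    using W7[of 3] W7[of 5]
    by (simp_all add: alt z0 del: One_nat_def)
  have z1_13: "t 2 3 8 = 0"
    using W13[of 8]
    by (simp_all add: alt z0 del: One_nat_def)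
  have z1_15: "t 2 4 8 = 0"
    using W15[of 8]
    by (simp_all add: alt z0 del: One_nat_def)
  note z1 = z1_6 z1_7 z1_13 z1_15
  have z2_12: "t 1 4 8 = 0"
    using W12[of 8]
    by (simp_all add: alt z0 z1 del: One_nat_def)
  have z2_14: "t 1 3 8 = 0"
    using W14[of 8]
    by (simp_all add: alt z0 z1 del: One_nat_def)
  note z2 = z2_12 z2_14
  have W17: "sqrt 3 * t n 2 7 - t n 2 8 = 0" for n
    using W[where n = n and \<omega> = "sqrt 3 *\<^sub>R (ebasis 2 \<and>\<^sub>f ebasis 7) - ebasis 2 \<and>\<^sub>f ebasis 8"] by (simp add: mm_simps)
  \<comment> \<open>What remains is proportional to the coefficients of \<open>rho0\<close>, with
    \<open>t 1 2 7\<close> as the common factor.\<close>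
  have x: "t 1 4 5 = - t 1 2 7" "t 1 3 6 = - t 1 2 7" "t 2 4 6 = t 1 2 7" "t 2 3 5 = - t 1 2 7"
      "t 3 4 7 = t 1 2 7" "t 5 6 7 = - 2 * t 1 2 7" "t 1 2 8 = sqrt 3 * t 1 2 7" "t 3 4 8 = - t 1 2 8"
    using W5[of 1] W4[of 1] W7[of 2] W6[of 2] W11[of 4] W15[of 6] W17[of 1] W16[of 8]
    by (simp_all add: alt z0 z1 z2 del: One_nat_def)
  \<comment> \<open>16 is the squared norm of \<open>rho0\<close>, namely 4 + (1 + 1 + 4) + (3 +
    3).\<close>
  have "T \<bullet> rho0 = 16 * t 1 2 7"
    unfolding rho0_expand t_def[symmetric] inner_simps
    by (simp add: x(1-6) del: One_nat_def) (simp add: x(7,8) sqrt_3_mult del: One_nat_def)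
  hence x0: "t 1 2 7 = 0" using rho by simp
  have sorted: "\<forall>c < 9. \<forall>b < c. \<forall>a < b. 1 \<le> a \<longrightarrow> t a b c = 0"
    by (simp only: bounded_all_simps)
      (simp add: z0 z1 z2 x x0 del: One_nat_def)
  have all: "t a b c = 0" if "1 \<le> a" "1 \<le> b" "1 \<le> c" "a < 9" "b < 9" "c < 9" for a b c
    by (rule alternating_3_eq_0[where t = t and R = "{1..<9}", OF alt0])
      (use that in \<open>auto intro: sorted[rule_format]\<close>)
  have "ip_basis k (ip_basis j (ip_basis i T)) \<bullet> one_form = 0" for i j k
  proof -
    obtain a b c where "1 \<le> a" "a < 9" "E i = ebasis a" "1 \<le> b" "b < 9" "E j = ebasis b"
        "1 \<le> c" "c < 9" "E k = ebasis c"
      by (metis E_ebasis_cases)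
    with all[of a b c] have "T \<bullet> (E i \<and>\<^sub>f E j \<and>\<^sub>f E k) = 0" by (simp add: t_def)
    thus ?thesis by (simp add: inner_ip_basis)
  qed
  moreover have T2: "ip_basis i T \<in> Lam (Suc 1)" for i
    using ip_basis_Lam[of T 2 i] T by (simp add: eval_nat_numeral)
  moreover have T1: "ip_basis j (ip_basis i T) \<in> Lam (Suc 0)" for i j
    using ip_basis_Lam[OF T2] by simp
  ultimately have "ip_basis k (ip_basis j (ip_basis i T)) = 0" for i j k
    using Lam_0_eq_0 ip_basis_Lam by blast
  hence "ip_basis j (ip_basis i T) = 0" for i j using Lam_Suc_eq_0[OF T1] by blast
  hence "ip_basis i T = 0" for i using Lam_Suc_eq_0[OF T2] by blast
  thus ?thesis using Lam_Suc_eq_0[of T 2] T by simp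
qed

text \<open>In other words, the products of the 2-forms \<open>ip_basis i rho0\<close> with
  arbitrary 2-forms span \<Lambda>^4. The system for the coefficients of F is overdetermined, and
  suitable second factors isolate the unknowns one by one.\<close>

lemma form_4_eq_0:
  assumes F: "F \<in> Lam 4" and H0: "\<And>i \<eta>. F \<bullet> (ip_basis i rho0 \<and>\<^sub>f \<eta>) = 0"
  shows "F = 0"
proof -
  define f where "f a b c d = F \<bullet> (ebasis a \<and>\<^sub>f ebasis b \<and>\<^sub>f ebasis c \<and>\<^sub>f ebasis d)" for a b c d
  have alt0: "f b a c d = - f a b c d" "f a c b d = - f a b c d" "f a b d c = - f a b c d" for a b c d
    unfolding f_def by (rule ebasis_swap)+
  have alt: "b < a \<Longrightarrow> f a b c d = - f b a c d" "c < b \<Longrightarrow> f a b c d = - f a c b d"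
      "d < c \<Longrightarrow> f a b c d = - f a b d c" "f a a c d = 0" "f a b b d = 0" "f a b c c = 0" for a b c d
    using alt0[of a b c d] alt0(1)[of a a c d] alt0(2)[of a b b d] alt0(3)[of a b c c] by auto
  have H: "F \<bullet> (ip_basis i rho0 \<and>\<^sub>f ebasis a \<and>\<^sub>f ebasis b) = 0" for i a b
    by (rule H0)
  have H1: "- f 4 5 a b - f 3 6 a b + f 2 7 a b + sqrt 3 * f 2 8 a b = 0" for a b
    using H[where i = 0 and a = a and b = b] unfolding f_def
    by (simp add: ip_basis_rho0 wedge_linear wedge_assoc inner_simps)
  have H2: "f 4 6 a b - f 3 5 a b - f 1 7 a b - sqrt 3 * f 1 8 a b = 0" for a b
    using H[where i = 1 and a = a and b = b] unfolding f_def
    by (simp add: ip_basis_rho0 wedge_linear wedge_assoc inner_simps)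
  have H3: "f 2 5 a b + f 1 6 a b + f 4 7 a b - sqrt 3 * f 4 8 a b = 0" for a b
    using H[where i = 2 and a = a and b = b] unfolding f_def
    by (simp add: ip_basis_rho0 wedge_linear wedge_assoc inner_simps)
  have H4: "- f 2 6 a b + f 1 5 a b - f 3 7 a b + sqrt 3 * f 3 8 a b = 0" for a b
    using H[where i = 3 and a = a and b = b] unfolding f_def
    by (simp add: ip_basis_rho0 wedge_linear wedge_assoc inner_simps)
  have H5: "- f 2 3 a b - f 1 4 a b - 2 * f 6 7 a b = 0" for a b
    using H[where i = 4 and a = a and b = b] unfolding f_def
    by (simp add: ip_basis_rho0 wedge_linear wedge_assoc inner_simps)
  have H6: "f 2 4 a b - f 1 3 a b + 2 * f 5 7 a b = 0" for a b
    using H[where i = 5 and a = a and b = b] unfolding f_def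
    by (simp add: ip_basis_rho0 wedge_linear wedge_assoc inner_simps)
  have H7: "f 1 2 a b + f 3 4 a b - 2 * f 5 6 a b = 0" for a b
    using H[where i = 6 and a = a and b = b] unfolding f_def
    by (simp add: ip_basis_rho0 wedge_linear wedge_assoc inner_simps)
  have H8: "sqrt 3 * f 1 2 a b - sqrt 3 * f 3 4 a b = 0" for a b
    using H[where i = 7 and a = a and b = b] unfolding f_def
    by (simp add: ip_basis_rho0 wedge_linear wedge_assoc inner_simps)
  \<comment> \<open>The choice of a and b repeats an index in all terms but one. The stages
    \<open>z1\<close> and \<open>z2\<close> also drop terms that are already known to be
    zero.\<close>
  have z0_7: "f 1 3 5 6 = 0" "f 1 4 5 6 = 0" "f 1 3 4 5 = 0" "f 1 3 4 6 = 0" "f 2 3 5 6 = 0"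
    "f 2 4 5 6 = 0" "f 2 3 4 5 = 0" "f 2 3 4 6 = 0" "f 1 2 3 5 = 0" "f 1 2 3 6 = 0"
    "f 1 2 4 5 = 0" "f 1 2 4 6 = 0"
    using H7[of 1 3] H7[of 1 4] H7[of 1 5] H7[of 1 6] H7[of 2 3] H7[of 2 4] H7[of 2 5]
      H7[of 2 6] H7[of 3 5] H7[of 3 6] H7[of 4 5] H7[of 4 6]
    by (simp_all add: alt del: One_nat_def)
  have z0_8: "f 1 2 3 4 = 0" "f 1 3 4 7 = 0" "f 1 3 4 8 = 0" "f 2 3 4 7 = 0" "f 2 3 4 8 = 0"
    "f 1 2 3 7 = 0" "f 1 2 3 8 = 0" "f 1 2 4 7 = 0" "f 1 2 4 8 = 0"
    using H8[of 1 2] H8[of 1 7] H8[of 1 8] H8[of 2 7] H8[of 2 8] H8[of 3 7] H8[of 3 8]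
      H8[of 4 7] H8[of 4 8]
    by (simp_all add: alt del: One_nat_def)
  have z0_5: "f 1 2 6 7 = 0" "f 1 3 6 7 = 0" "f 2 4 6 7 = 0" "f 3 4 6 7 = 0"
    using H5[of 1 2] H5[of 1 3] H5[of 2 4] H5[of 3 4]
    by (simp_all add: alt del: One_nat_def)
  have z0_6: "f 1 2 5 7 = 0" "f 1 4 5 7 = 0" "f 2 3 5 7 = 0" "f 3 4 5 7 = 0"
    using H6[of 1 2] H6[of 1 4] H6[of 2 3] H6[of 3 4]
    by (simp_all add: alt del: One_nat_def)
  note z0 = z0_7 z0_8 z0_5 z0_6
  have z1_7: "f 1 2 5 6 = 0" "f 1 5 6 7 = 0" "f 1 5 6 8 = 0" "f 2 5 6 7 = 0" "f 2 5 6 8 = 0"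
    "f 3 4 5 6 = 0" "f 3 5 6 7 = 0" "f 3 5 6 8 = 0" "f 4 5 6 7 = 0" "f 4 5 6 8 = 0"
    using H7[of 1 2] H7[of 1 7] H7[of 1 8] H7[of 2 7] H7[of 2 8] H7[of 3 4] H7[of 3 7]
      H7[of 3 8] H7[of 4 7] H7[of 4 8]
    by (simp_all add: alt z0 del: One_nat_def)
  have z1_1: "f 1 2 5 8 = 0" "f 1 2 6 8 = 0" "f 1 2 7 8 = 0" "f 2 3 5 8 = 0" "f 2 3 7 8 = 0"
    "f 2 4 6 8 = 0" "f 2 4 7 8 = 0"
    using H1[of 1 5] H1[of 1 6] H1[of 1 7] H1[of 3 5] H1[of 3 7] H1[of 4 6] H1[of 4 7]
    by (simp_all add: alt z0 del: One_nat_def)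
  have z1_2: "f 1 3 6 8 = 0" "f 1 3 7 8 = 0" "f 1 4 5 8 = 0" "f 1 4 7 8 = 0"
    using H2[of 3 6] H2[of 3 7] H2[of 4 5] H2[of 4 7]
    by (simp_all add: alt z0 del: One_nat_def)
  have z1_3: "f 3 4 5 8 = 0" "f 3 4 6 8 = 0" "f 3 4 7 8 = 0"
    using H3[of 3 5] H3[of 3 6] H3[of 3 7]
    by (simp_all add: alt z0 del: One_nat_def)
  have z1_5: "f 1 4 6 7 = 0" "f 1 6 7 8 = 0" "f 2 3 6 7 = 0" "f 2 6 7 8 = 0" "f 3 6 7 8 = 0"
    "f 4 6 7 8 = 0"
    using H5[of 1 4] H5[of 1 8] H5[of 2 3] H5[of 2 8] H5[of 3 8] H5[of 4 8]
    by (simp_all add: alt z0 del: One_nat_def)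
  have z1_6: "f 1 3 5 7 = 0" "f 1 5 7 8 = 0" "f 2 4 5 7 = 0" "f 2 5 7 8 = 0" "f 3 5 7 8 = 0"
    "f 4 5 7 8 = 0"
    using H6[of 1 3] H6[of 1 8] H6[of 2 4] H6[of 2 8] H6[of 3 8] H6[of 4 8]
    by (simp_all add: alt z0 del: One_nat_def)
  note z1 = z1_7 z1_1 z1_2 z1_3 z1_5 z1_6
  have z2_7: "f 5 6 7 8 = 0"
    using H7[of 7 8]
    by (simp_all add: alt z0 z1 del: One_nat_def)
  have z2_1: "f 2 3 6 8 = 0" "f 2 4 5 8 = 0"
    using H1[of 3 6] H1[of 4 5]
    by (simp_all add: alt z0 z1 del: One_nat_def)
  have z2_2: "f 1 3 5 8 = 0" "f 1 4 6 8 = 0"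
    using H2[of 3 5] H2[of 4 6]
    by (simp_all add: alt z0 z1 del: One_nat_def)
  note z2 = z2_7 z2_1 z2_2
  have sorted: "\<forall>d < 9. \<forall>c < d. \<forall>b < c. \<forall>a < b. 1 \<le> a \<longrightarrow> f a b c d = 0"
    by (simp only: bounded_all_simps)
      (simp add: z0 z1 z2 del: One_nat_def)
  have all: "f a b c d = 0"
    if "1 \<le> a" "1 \<le> b" "1 \<le> c" "1 \<le> d" "a < 9" "b < 9" "c < 9" "d < 9" for a b c d
    by (rule alternating_4_eq_0[where f = f and R = "{1..<9}", OF alt0])
      (use that in \<open>auto intro: sorted[rule_format]\<close>)
  have "ip_basis l (ip_basis k (ip_basis j (ip_basis i F))) \<bullet> one_form = 0" for i j k l
  proof -
    obtain a b c d where "1 \<le> a" "a < 9" "E i = ebasis a" "1 \<le> b" "b < 9" "E j = ebasis b"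
        "1 \<le> c" "c < 9" "E k = ebasis c" "1 \<le> d" "d < 9" "E l = ebasis d"
      by (metis E_ebasis_cases)
    with all[of a b c d] have "F \<bullet> (E i \<and>\<^sub>f E j \<and>\<^sub>f E k \<and>\<^sub>f E l) = 0" by (simp add: f_def)
    thus ?thesis by (simp add: inner_ip_basis)
  qed
  moreover have F3: "ip_basis i F \<in> Lam (Suc 2)" for i
    using ip_basis_Lam[of F 3 i] F by (simp add: eval_nat_numeral)
  moreover have F2: "ip_basis j (ip_basis i F) \<in> Lam (Suc 1)" for i j
    using ip_basis_Lam[OF F3] by (simp add: eval_nat_numeral)
  moreover have F1: "ip_basis k (ip_basis j (ip_basis i F)) \<in> Lam (Suc 0)" for i j k
    using ip_basis_Lam[OF F2] by simp
  ultimately have "ip_basis l (ip_basis k (ip_basis j (ip_basis i F))) = 0" for i j k l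
    using Lam_0_eq_0 ip_basis_Lam by blast
  hence "ip_basis k (ip_basis j (ip_basis i F)) = 0" for i j k using Lam_Suc_eq_0[OF F1] by blast
  hence "ip_basis j (ip_basis i F) = 0" for i j using Lam_Suc_eq_0[OF F2] by blast
  hence "ip_basis i F = 0" for i using Lam_Suc_eq_0[OF F3] by blast
  thus ?thesis using Lam_Suc_eq_0[of F 3] F by simp
qed

section \<open>Projections and modules\<close>

lemma covector_axis: "covector (axis i 1) = E i"
proof -
  have "covector (axis i 1) = (\<Sum>j\<in>UNIV. if j = i then E j else 0)"
    unfolding covector_def by (intro sum.cong) (auto simp: axis_def[of i])
  thus ?thesis by simp
qed

lemma ip_axis: "ip (axis i 1) \<alpha> = ip_basis i \<alpha>"
proof -
  have "ip (axis i 1) \<alpha> = (\<Sum>j\<in>UNIV. if j = i then ip_basis j \<alpha> else 0)"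
    unfolding ip_def by (intro sum.cong) (auto simp: axis_def[of i])
  thus ?thesis by simp
qed

lemma linear_covector: "linear covector"
  by (rule linearI) (simp_all add: covector_def algebra_simps sum.distrib scaleR_sum_right)

lemma linear_ip_vec: "linear (\<lambda>X. ip X \<alpha>)"
  by (rule linearI) (simp_all add: ip_def algebra_simps sum.distrib scaleR_sum_right)

lemma covector_Lam: "covector X \<in> Lam 1"
  unfolding covector_def by (intro subspace_sum subspace_mul subspace_Lam E_Lam)

lemma grade_covector: "grade (covector X) = - covector X"
  using grade_Lam[OF covector_Lam] by simp

lemma covector_anticommute: "covector X \<and>\<^sub>f covector Y = - (covector Y \<and>\<^sub>f covector X)"
  unfolding wedge_commute_odd[OF grade_covector, of X "covector Y"]
  by (simp add: grade_covector wedge_linear)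

lemma Lam_1_covector:
  assumes "\<alpha> \<in> Lam 1"
  obtains X where "\<alpha> = covector X"
proof
  have "covector (\<chi> i. \<alpha> $ {i}) $ K = \<alpha> $ K" for K
  proof (cases "card K = 1")
    case True
    then obtain k where "K = {k}" by (auto simp: card_1_singleton_iff)
    moreover have "(\<Sum>i\<in>UNIV. \<alpha> $ {i} * axis {i} 1 $ {k}) = (\<Sum>i\<in>UNIV. if i = k then \<alpha> $ {i} else 0)"
      by (intro sum.cong) (auto simp: axis_def)
    ultimately show ?thesis by (simp add: covector_def)
  next
    case False
    thus ?thesis using LamD[OF covector_Lam] LamD[OF assms] by metis
  qed
  thus "\<alpha> = covector (\<chi> i. \<alpha> $ {i})" by (simp add: vec_eq_iff)
qed

lemma inner_ip: "ip X \<alpha> \<bullet> \<beta> = \<alpha> \<bullet> (covector X \<and>\<^sub>f \<beta>)"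
  by (simp add: ip_def covector_def inner_sum_left inner_sum_right wedge_sum_left wedge_linear
      inner_ip_basis)

lemma ip_rho0_Lam: "ip X rho0 \<in> Lam 2"
  unfolding ip_def by (intro subspace_sum subspace_mul subspace_Lam ip_basis_rho0_Lam)

lemma grade_ip_rho0: "grade (ip X rho0) = ip X rho0"
  using grade_Lam[OF ip_rho0_Lam] by simp

lemma sigma_plus_covector: "sigma_plus (covector X) = ip X rho0"
  by (simp add: covector_def ip_def linear_sum[OF linear_sigma_plus]
      linear_scale[OF linear_sigma_plus] sigma_plus_E)

lemma eval2_eq_inner: "eval2 \<eta> Y Z = \<eta> \<bullet> (covector Y \<and>\<^sub>f covector Z)"
proof -
  have "\<alpha> $ {} = \<alpha> \<bullet> one_form" for \<alpha> :: form
    by (simp add: inner_axis)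
  thus ?thesis by (simp add: eval2_def inner_ip)
qed

lemma inner_Lam_distinct:
  assumes "\<alpha> \<in> Lam k" "\<beta> \<in> Lam l" "k \<noteq> l"
  shows "\<alpha> \<bullet> \<beta> = 0"
proof -
  have "\<alpha> $ I * \<beta> $ I = 0" for I
    using assms by (cases "card I = k") (auto simp: Lam_def)
  thus ?thesis unfolding inner_vec_def inner_real_def by (intro sum.neutral) blast
qed

text \<open>The degree is read off from the adjoint: the coefficient at J is the inner product of F
  with a form of degree 2 + card J.\<close>

lemma contraction_2_Lam:
  assumes "\<omega> \<in> Lam 2" "F \<in> Lam 4"
  shows "contraction 2 \<omega> F \<in> Lam 2"
proof -
  have "contraction 2 \<omega> F $ J = 0" if "card J \<noteq> 2" for J
  proof -
    have "axis J 1 \<in> Lam (card J)" by (auto simp: Lam_def axis_def split: if_splits)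
    hence "\<omega> \<and>\<^sub>f axis J 1 \<in> Lam (2 + card J)" by (rule wedge_Lam[OF assms(1)])
    moreover have "contraction 2 \<omega> F $ J = (\<omega> \<and>\<^sub>f axis J 1) \<bullet> F"
      using inner_contraction_2[OF assms(1), of "axis J 1" F] by (simp add: inner_axis')
    ultimately show ?thesis using inner_Lam_distinct assms(2) that by fastforce
  qed
  thus ?thesis by (auto simp: Lam_def)
qed

lemma inner_Lam_2_cong:
  assumes "\<omega> \<in> Lam 2" "\<And>i j. \<alpha> \<bullet> (E i \<and>\<^sub>f E j) = \<beta> \<bullet> (E i \<and>\<^sub>f E j)"
  shows "\<alpha> \<bullet> \<omega> = \<beta> \<bullet> \<omega>"
proof -
  have "\<alpha> \<bullet> axis I 1 = \<beta> \<bullet> axis I 1" if I: "card I = 2" for I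
  proof -
    obtain i j where "I = {i, j}" "i \<noteq> j" using I by (metis card_2_iff)
    thus ?thesis
      using assms(2)[of i j] assms(2)[of j i] E_wedge_E[of i j] E_wedge_E[of j i]
      by (cases "i < j") (auto simp: insert_commute not_less order.order_iff_strict)
  qed
  thus ?thesis
    by (subst (1 2) Lam_2_expand[OF assms(1)]) (simp add: inner_sum_right)
qed

text \<open>Contraction by e_i followed by the product with e_i is the projection onto the basis
  forms containing i, so every index set is counted once per element. For \<open>rho0\<close> this
  is the source of the 3 in the trace formula.\<close>

lemma euler_Lam:
  assumes "\<alpha> \<in> Lam k"
  shows "(\<Sum>i\<in>UNIV. E i \<and>\<^sub>f ip_basis i \<alpha>) = real k *\<^sub>R \<alpha>"
proof -
  have "(E i \<and>\<^sub>f ip_basis i \<alpha>) $ K = (if i \<in> K then \<alpha> $ K else 0)" for i K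
  proof (cases "i \<in> K")
    case True
    have "{j \<in> K - {i}. j < i} = {j \<in> K. j < i}" by auto
    thus ?thesis
      using True nth_insert[of i "K - {i}" \<alpha>] by (simp add: E_wedge_nth insert_absorb)
  qed (simp add: E_wedge_nth)
  hence "(\<Sum>i\<in>UNIV. E i \<and>\<^sub>f ip_basis i \<alpha>) $ K = (\<Sum>i\<in>K. \<alpha> $ K)" for K
    by (simp add: sum.If_cases)
  thus ?thesis using assms by (auto simp: vec_eq_iff Lam_def)
qed

lemma Lam_7_eq_0:
  assumes "\<beta> \<in> Lam 7" "\<And>k. (E k \<and>\<^sub>f \<beta>) $ UNIV = 0"
  shows "\<beta> = 0"
proof -
  have "\<beta> $ K = 0" for K
  proof (cases "card K = 7")
    case True
    hence "card (- K) = 1" by (simp add: Compl_eq_Diff_UNIV card_Diff_subset)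
    then obtain k where "- K = {k}" by (auto simp: card_1_singleton_iff)
    hence "K = UNIV - {k}" by auto
    thus ?thesis using assms(2)[of k] by (simp add: E_wedge_nth)
  qed (use LamD[OF assms(1)] in blast)
  thus ?thesis by (simp add: vec_eq_iff)
qed

text \<open>Tested with e_k, the 7-form \<omega> \<and> \<open>hodge rho0\<close> yields the inner
  product of e_k \<and> \<omega> with \<open>rho0\<close>, hence that of \<omega> with
  \<open>ip_basis k rho0\<close>. A 7-form is determined by these tests.\<close>

lemma mm_iff: "\<omega> \<in> mm \<longleftrightarrow> \<omega> \<in> Lam 2 \<and> (\<forall>k. \<omega> \<bullet> ip_basis k rho0 = 0)"
proof -
  have *: "(E k \<and>\<^sub>f \<omega> \<and>\<^sub>f hodge rho0) $ UNIV = \<omega> \<bullet> ip_basis k rho0" for k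
    using wedge_hodge_top[of "E k \<and>\<^sub>f \<omega>" rho0]
    by (simp add: wedge_assoc inner_commute[of \<omega>] inner_ip_basis inner_commute[of rho0])
  have "\<omega> \<and>\<^sub>f hodge rho0 \<in> Lam 7" if "\<omega> \<in> Lam 2"
    using wedge_Lam[OF that hodge_Lam[OF rho0_Lam]] by simp
  hence "\<omega> \<and>\<^sub>f hodge rho0 = 0" if "\<omega> \<in> Lam 2" "\<forall>k. \<omega> \<bullet> ip_basis k rho0 = 0"
    using that by (intro Lam_7_eq_0) (simp_all add: *)
  moreover have "\<omega> \<bullet> ip_basis k rho0 = 0" if "\<omega> \<and>\<^sub>f hodge rho0 = 0" for k
    using *[of k] that by simp
  ultimately show ?thesis unfolding Lam2_20_def by blast
qed

lemma subspace_mm: "subspace mm"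
  using subspace_Lam[of 2] by (auto simp: subspace_def mm_iff inner_add_left)

section \<open>Orthogonal projection onto \<open>mm\<close>\<close>

lemma pr_m_unique:
  assumes "\<eta> \<in> mm" "\<And>\<zeta>. \<zeta> \<in> mm \<Longrightarrow> orthogonal (\<omega> - \<eta>) \<zeta>"
  shows "pr_m \<omega> = \<eta>"
  unfolding pr_m_def
proof (rule the_equality)
  fix \<eta>' assume *: "\<eta>' \<in> mm \<and> (\<forall>\<zeta>\<in>mm. orthogonal (\<omega> - \<eta>') \<zeta>)"
  hence "\<eta>' - \<eta> \<in> mm" using subspace_diff[OF subspace_mm] assms(1) by blast
  hence "(\<omega> - \<eta>) \<bullet> (\<eta>' - \<eta>) = 0" "(\<omega> - \<eta>') \<bullet> (\<eta>' - \<eta>) = 0"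
    using * assms(2) by (auto simp: orthogonal_def)
  hence "(\<eta>' - \<eta>) \<bullet> (\<eta>' - \<eta>) = 0" by (simp add: inner_diff_left)
  thus "\<eta>' = \<eta>" by simp
qed (use assms in blast)

text \<open>The existence part of the definite description in \<open>pr_m\<close>, from the
  orthogonal decomposition with respect to a subspace of a Euclidean space.\<close>

lemma pr_m_mem: "pr_m \<omega> \<in> mm"
  and pr_m_orthogonal: "\<zeta> \<in> mm \<Longrightarrow> (\<omega> - pr_m \<omega>) \<bullet> \<zeta> = 0"
proof -
  obtain \<eta> z where "\<eta> \<in> span mm" "\<And>w. w \<in> span mm \<Longrightarrow> orthogonal z w" "\<omega> = \<eta> + z"
    using orthogonal_subspace_decomp_exists[of mm \<omega>] by blast
  hence *: "\<eta> \<in> mm" "\<And>\<zeta>. \<zeta> \<in> mm \<Longrightarrow> orthogonal (\<omega> - \<eta>) \<zeta>"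
    using subspace_mm by (simp_all add: span_eq_iff[THEN iffD2])
  hence "pr_m \<omega> = \<eta>" by (rule pr_m_unique)
  thus "pr_m \<omega> \<in> mm" "\<zeta> \<in> mm \<Longrightarrow> (\<omega> - pr_m \<omega>) \<bullet> \<zeta> = 0"
    using * by (auto simp: orthogonal_def)
qed

lemma pr_m_eq_self: "\<omega> \<in> mm \<Longrightarrow> pr_m \<omega> = \<omega>"
  by (rule pr_m_unique) (auto simp: orthogonal_def)

lemma linear_pr_m: "linear pr_m"
proof (rule linearI)
  fix \<omega> \<omega>' c
  show "pr_m (\<omega> + \<omega>') = pr_m \<omega> + pr_m \<omega>'"
  proof (rule pr_m_unique)
    fix \<zeta> assume "\<zeta> \<in> mm"
    thus "orthogonal (\<omega> + \<omega>' - (pr_m \<omega> + pr_m \<omega>')) \<zeta>"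
      using pr_m_orthogonal[of \<zeta> \<omega>] pr_m_orthogonal[of \<zeta> \<omega>']
      by (simp add: orthogonal_def inner_simps)
  qed (intro subspace_add subspace_mm pr_m_mem)
  show "pr_m (c *\<^sub>R \<omega>) = c *\<^sub>R pr_m \<omega>"
  proof (rule pr_m_unique)
    fix \<zeta> assume "\<zeta> \<in> mm"
    thus "orthogonal (c *\<^sub>R \<omega> - c *\<^sub>R pr_m \<omega>) \<zeta>"
      using pr_m_orthogonal[of \<zeta> \<omega>] by (simp add: orthogonal_def flip: scaleR_diff_right)
  qed (intro subspace_mul subspace_mm pr_m_mem)
qed

lemma inner_pr_m_self: "pr_m \<omega> \<bullet> \<omega> = pr_m \<omega> \<bullet> pr_m \<omega>"
  using pr_m_orthogonal[OF pr_m_mem, of \<omega> \<omega>] by (simp add: inner_diff_left inner_diff_right inner_commute)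

section \<open>The modules, and the ranges of T and F\<close>

lemma subspace_set_plus: "subspace A \<Longrightarrow> subspace B \<Longrightarrow> subspace (A + B)"
  using subspace_sums[of A B]
  by (rule back_subst[where P = subspace]) (auto simp: set_plus_def)

text \<open>The range prescribed for T^c. Its decisive feature is the orthogonality to
  \<open>rho0\<close>, see \<open>Lam3_0_inner_rho0\<close>.\<close>

definition Lam3_0 :: "form set" where "Lam3_0 = Lam3_8 + Lam3_20 + Lam3_27"

definition Lam4_0 :: "form set" where "Lam4_0 = hodge ` Lam4_8 + hodge ` Lam4_27"

lemma Lam2_8_subset: "Lam2_8 \<subseteq> Lam 2"
  unfolding Lam2_8_def using sigma_plus_Lam[of _ 0] by (auto simp: eval_nat_numeral)

lemma Lam3_8_subset: "Lam3_8 \<subseteq> Lam 3"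
proof -
  have "hodge (\<omega> \<and>\<^sub>f rho0) \<in> Lam 3" if "\<omega> \<in> Lam 2" for \<omega>
    using hodge_Lam[OF wedge_Lam[OF that rho0_Lam]] by simp
  thus ?thesis unfolding Lam3_8_def using Lam2_8_subset by blast
qed

lemma Lam3_20_subset: "Lam3_20 \<subseteq> Lam 3"
  unfolding Lam3_20_def using sigma_plus_Lam[of _ 1] by (auto simp: Lam2_20_def eval_nat_numeral)

lemma Lam3_27_subset: "Lam3_27 \<subseteq> Lam 3"
  by (auto simp: Lam3_27_def)

lemma subspace_Lam2_8: "subspace Lam2_8"
  unfolding Lam2_8_def by (intro linear_subspace_image linear_sigma_plus subspace_Lam)

lemma subspace_Lam3_8: "subspace Lam3_8"
proof -
  have "linear (\<lambda>\<omega>. hodge (\<omega> \<and>\<^sub>f rho0))"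
    by (rule linearI) (simp_all add: wedge_linear linear_add[OF linear_hodge] linear_scale[OF linear_hodge])
  thus ?thesis unfolding Lam3_8_def by (intro linear_subspace_image subspace_Lam2_8)
qed

lemma subspace_Lam3_20: "subspace Lam3_20"
  unfolding Lam3_20_def by (intro linear_subspace_image linear_sigma_plus subspace_mm)

lemma subspace_Lam3_27: "subspace Lam3_27"
  using subspace_Lam[of 3] by (auto simp: subspace_def Lam3_27_def wedge_linear)

lemma subspace_Lam4_8: "subspace Lam4_8" and subspace_Lam4_27: "subspace Lam4_27"
  unfolding Lam4_8_def Lam4_27_def
  by (intro linear_subspace_image linear_sigma_plus subspace_Lam3_8 subspace_Lam3_27)+

lemma subspace_Lam3_0: "subspace Lam3_0"
  unfolding Lam3_0_def by (intro subspace_set_plus subspace_Lam3_8 subspace_Lam3_20 subspace_Lam3_27)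

lemma subspace_Lam4_0: "subspace Lam4_0"
  unfolding Lam4_0_def
  by (intro subspace_set_plus linear_subspace_image linear_hodge subspace_Lam4_8 subspace_Lam4_27)

lemma Lam4_0_cases:
  assumes "F \<in> Lam4_0"
  obtains S where "S \<in> Lam 3" "F = hodge (sigma_plus S)"
proof -
  obtain S S' where "S \<in> Lam3_8" "S' \<in> Lam3_27" "F = hodge (sigma_plus S) + hodge (sigma_plus S')"
    using assms by (auto simp: Lam4_0_def Lam4_8_def Lam4_27_def elim!: set_plus_elim)
  hence "S + S' \<in> Lam 3 \<and> F = hodge (sigma_plus (S + S'))"
    using Lam3_8_subset Lam3_27_subset subspace_add[OF subspace_Lam, of S 3 S']
    by (simp add: subset_iff linear_add[OF linear_hodge] linear_add[OF linear_sigma_plus])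
  thus ?thesis using that by blast
qed

lemma Lam4_0_subset: "Lam4_0 \<subseteq> Lam 4"
proof
  fix F assume "F \<in> Lam4_0"
  then obtain S where S: "S \<in> Lam 3" "F = hodge (sigma_plus S)" by (rule Lam4_0_cases)
  have "sigma_plus S \<in> Lam 4" using sigma_plus_Lam[of S 2] S by simp
  thus "F \<in> Lam 4" using hodge_Lam[of _ 4] S by simp
qed

lemma Lam4_0_coclosed: "F \<in> Lam4_0 \<Longrightarrow> sigma_plus \<alpha> \<bullet> F = 0"
  using inner_sigma_plus by (auto elim: Lam4_0_cases)

text \<open>That is, \<open>rho0\<close> is coclosed. On e_i \<and> e_j the value is the difference
  of the inner products of \<open>ip_basis i rho0\<close> and \<open>ip_basis j rho0\<close> taken
  in the two orders.\<close>

lemma inner_sigma_plus_rho0: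
  assumes "\<omega> \<in> Lam 2"
  shows "sigma_plus \<omega> \<bullet> rho0 = 0"
proof -
  have E: "sigma_plus (E i \<and>\<^sub>f E j) \<bullet> rho0 = 0" for i j
  proof -
    have "ip_basis i rho0 \<and>\<^sub>f E j = E j \<and>\<^sub>f ip_basis i rho0"
      by (rule wedge_commute_even[OF grade_ip_basis_rho0])
    hence "sigma_plus (E i \<and>\<^sub>f E j) = E j \<and>\<^sub>f ip_basis i rho0 - E i \<and>\<^sub>f ip_basis j rho0"
      by (simp add: sigma_plus_wedge sigma_plus_E wedge_linear)
    hence "sigma_plus (E i \<and>\<^sub>f E j) \<bullet> rho0
        = rho0 \<bullet> (E j \<and>\<^sub>f ip_basis i rho0) - rho0 \<bullet> (E i \<and>\<^sub>f ip_basis j rho0)"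
      by (simp only: inner_diff_left inner_commute[of rho0])
    also have "\<dots> = ip_basis j rho0 \<bullet> ip_basis i rho0 - ip_basis i rho0 \<bullet> ip_basis j rho0"
      by (simp only: inner_ip_basis)
    finally show ?thesis by (simp add: inner_commute)
  qed
  \<comment> \<open>The adjoint writes the left side as an inner product with \<omega>, for which
    the test on all e_i \<and> e_j suffices.\<close>
  define \<delta> where "\<delta> = adjoint sigma_plus rho0"
  have \<delta>: "sigma_plus \<alpha> \<bullet> rho0 = \<delta> \<bullet> \<alpha>" for \<alpha>
    by (metis \<delta>_def adjoint_works inner_commute linear_sigma_plus)
  have "\<delta> \<bullet> \<omega> = 0 \<bullet> \<omega>"
    by (rule inner_Lam_2_cong[OF assms]) (simp only: \<delta>[symmetric] E inner_zero_left)
  thus ?thesis by (simp only: \<delta> inner_zero_left)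
qed

lemma rho0_wedge_rho0: "rho0 \<and>\<^sub>f rho0 = 0"
  using wedge_commute_odd[OF grade_rho0, of rho0]
  by (simp only: grade_rho0 wedge_minus_left eq_neg_iff_add_eq_0 scaleR_2[symmetric]) simp

text \<open>The three reasons: \<open>rho0\<close> has odd degree and hence square zero;
  \<open>rho0\<close> is coclosed; the wedge product of a 3-form with \<open>hodge rho0\<close>
  computes its inner product with \<open>rho0\<close>.\<close>

lemma Lam3_0_inner_rho0:
  assumes "T \<in> Lam3_0"
  shows "T \<bullet> rho0 = 0"
proof -
  have "T \<bullet> rho0 = 0" if T: "T \<in> Lam3_8" for T
  proof -
    obtain \<omega> where "T = hodge (\<omega> \<and>\<^sub>f rho0)" using T unfolding Lam3_8_def by blast
    hence "rho0 \<bullet> T = 0" by (simp add: inner_hodge wedge_assoc rho0_wedge_rho0)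
    thus ?thesis by (simp add: inner_commute)
  qed
  moreover have "T \<bullet> rho0 = 0" if "T \<in> Lam3_20" for T
    using that inner_sigma_plus_rho0 by (auto simp: Lam3_20_def Lam2_20_def)
  moreover have "T \<bullet> rho0 = 0" if "T \<in> Lam3_27" for T
    using that wedge_hodge_top[of T rho0] by (simp add: Lam3_27_def)
  ultimately show ?thesis
    using assms by (auto simp: Lam3_0_def inner_add_left elim!: set_plus_elim)
qed

lemma set_plus_subset:
  assumes "subspace S" "A \<subseteq> S" "B \<subseteq> S"
  shows "A + B \<subseteq> S"
  using assms(2,3) subspace_add[OF assms(1)] by (auto elim!: set_plus_elim simp: subset_iff)

lemma Lam3_0_subset: "Lam3_0 \<subseteq> Lam 3"
  unfolding Lam3_0_def
  by (intro set_plus_subset subspace_Lam Lam3_8_subset Lam3_20_subset Lam3_27_subset)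

section \<open>Recovering T and F from the images of \<open>Theta1\<close> and
  \<open>Theta2\<close>\<close>

lemma linear_contraction_2:
  assumes "\<omega> \<in> Lam 2"
  shows "linear (contraction 2 \<omega>)"
proof -
  have "x = y" if "\<And>\<eta>. \<eta> \<bullet> x = \<eta> \<bullet> y" for x y :: form
    using that vector_eq_ldot by blast
  thus ?thesis
    by (intro linearI) (simp_all add: inner_contraction_2[OF assms] inner_add_right)
qed

lemma linear_Theta1: "linear Theta1"
  by (rule linearI)
    (simp_all add: Theta1_def vec_eq_iff ip_axis ip_basis_linear linear_add[OF linear_pr_m]
      linear_scale[OF linear_pr_m] algebra_simps)

lemma linear_Theta2: "linear Theta2"
  by (rule linearI)
    (simp_all add: Theta2_def vec_eq_iff ip_axis linear_add[OF linear_pr_m] linear_scale[OF linear_pr_m]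
      linear_add[OF linear_contraction_2] linear_scale[OF linear_contraction_2] ip_basis_rho0_Lam)

lemma linear_Phi1: "linear Phi1" and linear_Phi2: "linear Phi2"
  by (rule linearI; simp add: Phi1_def Phi2_def wedge_linear sum.distrib scaleR_sum_right)+

lemma contraction_Lam4_0_mm:
  assumes "F \<in> Lam4_0"
  shows "contraction 2 (ip X rho0) F \<in> mm"
  unfolding mm_iff
proof (intro conjI allI)
  show "contraction 2 (ip X rho0) F \<in> Lam 2"
    using assms Lam4_0_subset by (intro contraction_2_Lam ip_rho0_Lam) auto
  fix k
  have "sigma_plus (covector X \<and>\<^sub>f ip_basis k rho0) = ip X rho0 \<and>\<^sub>f ip_basis k rho0"
    by (simp add: sigma_plus_wedge sigma_plus_covector sigma_plus_ip_basis_rho0)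
  hence "(ip X rho0 \<and>\<^sub>f ip_basis k rho0) \<bullet> F = 0"
    using Lam4_0_coclosed[OF assms] by metis
  thus "contraction 2 (ip X rho0) F \<bullet> ip_basis k rho0 = 0"
    using inner_contraction_2[OF ip_rho0_Lam] by (simp add: inner_commute)
qed

lemma Theta2_Lam4_0:
  assumes "F \<in> Lam4_0"
  shows "Theta2 F = (\<chi> i. - contraction 2 (ip (axis i 1) rho0) F)"
  using contraction_Lam4_0_mm[OF assms] by (simp add: Theta2_def pr_m_eq_self)

lemma Phi1_Theta2:
  assumes "F \<in> Lam4_0"
  shows "Phi1 (Theta2 F) = 0"
proof -
  let ?b = "\<lambda>i. contraction 2 (ip_basis i rho0) F"
  \<comment> \<open>The sum of the products of e_i with ?b i is the adjoint of d applied to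
    F.\<close>
  have "S \<bullet> (\<Sum>i\<in>UNIV. E i \<and>\<^sub>f ?b i) = sigma_plus S \<bullet> F" for S
    by (simp add: inner_sum_right sigma_plus_eq inner_sum_left inner_contraction_2 ip_basis_rho0_Lam
        flip: inner_ip_basis)
  hence "S \<bullet> (\<Sum>i\<in>UNIV. E i \<and>\<^sub>f ?b i) = 0" for S
    using Lam4_0_coclosed[OF assms] by simp
  hence "(\<Sum>i\<in>UNIV. E i \<and>\<^sub>f ?b i) = 0" using inner_eq_zero_iff by blast
  thus ?thesis
    by (simp add: Theta2_Lam4_0[OF assms] Phi1_def covector_axis ip_axis wedge_minus_right sum_negf)
qed

lemma Phi1_Theta1_eq_0:
  assumes "T \<in> Lam3_0" "Phi1 (Theta1 T) = 0"
  shows "T = 0"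
proof -
  have "(\<Sum>i\<in>UNIV. E i \<and>\<^sub>f pr_m (ip_basis i T)) = 0"
    using assms(2)
    by (simp add: Phi1_def Theta1_def covector_axis ip_axis wedge_linear sum_negf flip: scaleR_sum_right)
  hence "T \<bullet> (\<Sum>i\<in>UNIV. E i \<and>\<^sub>f pr_m (ip_basis i T)) = 0" by simp
  \<comment> \<open>Moving e_i across the inner product pairs the contraction of T with its own
    projection, which gives the squared norm of the projection.\<close>
  hence "(\<Sum>i\<in>UNIV. pr_m (ip_basis i T) \<bullet> pr_m (ip_basis i T)) = 0"
    by (simp add: inner_sum_right inner_commute[of "ip_basis _ T"] inner_pr_m_self flip: inner_ip_basis)
  hence "pr_m (ip_basis i T) = 0" for i
    by (simp add: sum_nonneg_eq_0_iff)
  hence "ip_basis i T \<bullet> \<omega> = 0" if "\<omega> \<in> mm" for i \<omega>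
    using pr_m_orthogonal[OF that, of "ip_basis i T"] by simp
  thus ?thesis
    using assms(1) Lam3_0_subset Lam3_0_inner_rho0
    by (intro form_3_orthogonal_rho0_eq_0) (auto simp: mm_iff)
qed

lemma contraction_eq_0:
  assumes "F \<in> Lam 4" "\<And>i. contraction 2 (ip_basis i rho0) F = 0"
  shows "F = 0"
  using assms inner_contraction_2[OF ip_basis_rho0_Lam, of _ _ F]
  by (intro form_4_eq_0) (simp_all add: inner_commute[of F])

lemma Phi2_Theta2_eq_0:
  assumes "F \<in> Lam4_0" "Phi2 (Theta2 F) = 0"
  shows "F = 0"
proof -
  let ?b = "\<lambda>i. contraction 2 (ip_basis i rho0) F"
  have "(\<Sum>i\<in>UNIV. ip_basis i rho0 \<and>\<^sub>f ?b i) = - Phi2 (Theta2 F)"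
    unfolding Phi2_def Theta2_Lam4_0[OF assms(1)] ip_axis vec_lambda_beta wedge_minus_right sum_negf
    by simp
  also have "\<dots> \<bullet> F = 0" by (simp only: assms(2) minus_zero inner_zero_left)
  finally have 1: "(\<Sum>i\<in>UNIV. ?b i \<bullet> ?b i) = 0"
    by (simp only: inner_sum_left inner_contraction_2[OF ip_basis_rho0_Lam])
  have "?b i \<bullet> ?b i = 0" for i
    by (rule sum_nonneg_0[OF finite inner_ge_zero 1 UNIV_I])
  hence "?b i = 0" for i by (simp only: inner_eq_zero_iff)
  with assms(1) Lam4_0_subset show ?thesis by (blast intro: contraction_eq_0)
qed

text \<open>Triangularity: \<open>Phi1\<close> kills \<gamma> and the \<open>Theta2\<close> part of
  the difference of the two sides, which isolates T' - T. Once this is zero, \<open>Phi2\<close>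
  kills \<gamma> and isolates F' - F. The right side has no part in W_6, so that \<gamma> is zero as
  well.\<close>

lemma Theta_unique:
  assumes "T \<in> Lam3_0" "T' \<in> Lam3_0" "F \<in> Lam4_0" "F' \<in> Lam4_0" "\<gamma> \<in> WW 6"
    and eq: "Theta1 T + Theta2 F + \<gamma> = Theta1 T' + Theta2 F'"
  shows "T = T'" "F = F'" "\<gamma> = 0"
proof -
  have T: "T' - T \<in> Lam3_0" and F: "F' - F \<in> Lam4_0"
    using assms subspace_diff[OF subspace_Lam3_0] subspace_diff[OF subspace_Lam4_0] by auto
  have \<gamma>: "\<gamma> = Theta1 (T' - T) + Theta2 (F' - F)"
    using eq by (simp add: linear_diff[OF linear_Theta1] linear_diff[OF linear_Theta2] algebra_simps)
  moreover have "Phi1 \<gamma> = 0" "Phi2 \<gamma> = 0" using assms(5) by (simp_all add: WW_def)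
  ultimately have "Phi1 (Theta1 (T' - T)) = 0"
    using Phi1_Theta2[OF F] by (simp add: linear_add[OF linear_Phi1])
  hence 1: "T' - T = 0" using Phi1_Theta1_eq_0[OF T] by blast
  with \<gamma> have "Phi2 (Theta2 (F' - F)) = 0"
    using \<open>Phi2 \<gamma> = 0\<close> by (simp add: linear_0[OF linear_Theta1])
  hence 2: "F' - F = 0" using Phi2_Theta2_eq_0[OF F] by blast
  show "T = T'" "F = F'" using 1 2 by auto
  show "\<gamma> = 0" using \<gamma> unfolding 1 2 by (simp add: linear_0[OF linear_Theta1] linear_0[OF linear_Theta2])
qed

section \<open>The tensor of the characteristic 4-form\<close>

text \<open>The 2-forms b_x as a function of three vectors: the part that F^c contributes to the
  difference between the characteristic and the Levi-Civita connection.\<close>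

definition contraction_tensor :: "form \<Rightarrow> tensor3" where
  "contraction_tensor F x y z = eval2 (contraction 2 (ip x rho0) F) y z"

lemma contraction_tensor_eq:
  "contraction_tensor F x y z = (ip x rho0 \<and>\<^sub>f covector y \<and>\<^sub>f covector z) \<bullet> F"
proof -
  have "contraction_tensor F x y z = (covector y \<and>\<^sub>f covector z) \<bullet> contraction 2 (ip x rho0) F"
    unfolding contraction_tensor_def eval2_eq_inner by (rule inner_commute)
  thus ?thesis by (simp only: inner_contraction_2[OF ip_rho0_Lam])
qed

lemma trilinear_contraction_tensor: "trilinear (contraction_tensor F)"
  unfolding trilinear_def contraction_tensor_eq
  by (intro conjI allI linearI)
    (simp_all add: linear_add[OF linear_ip_vec] linear_scale[OF linear_ip_vec]
      linear_add[OF linear_covector] linear_scale[OF linear_covector] wedge_linear inner_add_left)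

lemma contraction_tensor_skew: "contraction_tensor F x z y = - contraction_tensor F x y z"
  unfolding contraction_tensor_eq covector_anticommute[of z y]
  by (simp only: wedge_minus_right inner_minus_left)

text \<open>The cyclic sum is the inner product of d(x \<and> y \<and> z) with F; the reorderings
  bring the three Leibniz terms into the shape of \<open>contraction_tensor_eq\<close>.\<close>

lemma contraction_tensor_cyclic:
  assumes "F \<in> Lam4_0"
  shows "contraction_tensor F x y z + contraction_tensor F y z x + contraction_tensor F z x y = 0"
proof -
  let ?e = covector and ?A = "\<lambda>x. ip x rho0"
  have comm: "\<alpha> \<and>\<^sub>f ?A y = ?A y \<and>\<^sub>f \<alpha>" for \<alpha> y
    by (rule wedge_commute_even[OF grade_ip_rho0, symmetric])
  have "?e x \<and>\<^sub>f ?A y \<and>\<^sub>f ?e z = ?A y \<and>\<^sub>f ?e x \<and>\<^sub>f ?e z"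
    by (simp only: wedge_assoc[symmetric] comm)
  also have "\<dots> = - (?A y \<and>\<^sub>f ?e z \<and>\<^sub>f ?e x)"
    by (simp only: covector_anticommute[of x z] wedge_minus_right)
  finally have 1: "?e x \<and>\<^sub>f ?A y \<and>\<^sub>f ?e z = - (?A y \<and>\<^sub>f ?e z \<and>\<^sub>f ?e x)" .
  have 2: "?e x \<and>\<^sub>f ?e y \<and>\<^sub>f ?A z = ?A z \<and>\<^sub>f ?e x \<and>\<^sub>f ?e y"
    by (simp only: wedge_assoc[symmetric] comm)
  have "sigma_plus (?e x \<and>\<^sub>f ?e y \<and>\<^sub>f ?e z)
      = ?A x \<and>\<^sub>f ?e y \<and>\<^sub>f ?e z + ?A y \<and>\<^sub>f ?e z \<and>\<^sub>f ?e x + ?A z \<and>\<^sub>f ?e x \<and>\<^sub>f ?e y"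
    using 1 2 by (simp add: sigma_plus_wedge sigma_plus_covector grade_covector wedge_linear)
  thus ?thesis
    using Lam4_0_coclosed[OF assms, of "?e x \<and>\<^sub>f ?e y \<and>\<^sub>f ?e z"]
    by (simp add: contraction_tensor_eq inner_add_left)
qed

lemma contraction_tensor_eq_0:
  assumes "F \<in> Lam 4" "\<And>x y z. contraction_tensor F x y z = 0"
  shows "F = 0"
proof (rule contraction_eq_0[OF assms(1)])
  fix i
  let ?b = "contraction 2 (ip_basis i rho0) F"
  have b: "?b \<in> Lam 2" using assms(1) by (intro contraction_2_Lam ip_basis_rho0_Lam)
  have "?b \<bullet> (E j \<and>\<^sub>f E k) = 0 \<bullet> (E j \<and>\<^sub>f E k)" for j k
    using assms(2)[of "axis i 1" "axis j 1" "axis k 1"]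
    unfolding contraction_tensor_def eval2_eq_inner covector_axis ip_axis by (simp only: inner_zero_left)
  hence "?b \<bullet> ?b = 0 \<bullet> ?b" by (rule inner_Lam_2_cong[OF b])
  thus "?b = 0" by (simp only: inner_zero_left inner_eq_zero_iff)
qed

text \<open>The centre of su(3) is trivial. The components of v are read off at basis 2-forms that,
  up to the last one, occur in a single row of \<open>ip_basis_rho0\<close>.\<close>

lemma ip_rho0_eq_0:
  assumes "\<And>i j. ip v rho0 \<bullet> (E i \<and>\<^sub>f E j) = 0"
  shows "v = 0"
proof -
  have *: "(\<Sum>i\<in>UNIV. v $ i *\<^sub>R ip_basis i rho0) \<bullet> (ebasis a \<and>\<^sub>f ebasis b) = 0" for a b
    using assms unfolding ip_def ebasis_eq_E by blast
  note simps = sum_8 ip_basis_rho0 inner_simps inner_ebasis_wedge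
  have "v $ 0 = 0"
    using *[of 4 5] by (simp add: simps)
  moreover have "v $ 1 = 0"
    using *[of 4 6] by (simp add: simps)
  moreover have "v $ 2 = 0"
    using *[of 2 5] by (simp add: simps)
  moreover have "v $ 3 = 0"
    using *[of 2 6] by (simp add: simps)
  moreover have "v $ 4 = 0"
    using *[of 2 3] by (simp add: simps)
  moreover have "v $ 5 = 0"
    using *[of 2 4] by (simp add: simps)
  moreover have "v $ 6 = 0"
    using *[of 5 6] by (simp add: simps)
  \<comment> \<open>e_12 occurs in rows 6 and 7, so \<open>v $ 6 = 0\<close> has to be known
    first.\<close>
  moreover from this have "v $ 7 = 0"
    using *[of 1 2] by (simp add: simps)
  ultimately have "\<forall>i. v $ i = 0" unfolding forall_8 by blast
  thus ?thesis by (simp add: vec_eq_iff)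
qed

lemma inner_covector_wedge:
  "(covector x \<and>\<^sub>f covector y) \<bullet> (covector z \<and>\<^sub>f covector w) = (x \<bullet> z) * (y \<bullet> w) - (x \<bullet> w) * (y \<bullet> z)"
proof -
  have 1: "E i \<bullet> covector z = z $ i" for i z
    by (simp add: covector_def inner_sum_right inner_axis_axis if_distrib[of "\<lambda>c. _ * c"] cong: if_cong)
  have ipE: "ip_basis i (covector z) = z $ i *\<^sub>R one_form" for i z
    by (simp add: covector_def ip_basis_sum ip_basis_linear ip_basis_E if_distrib[of "\<lambda>c. _ *\<^sub>R c"] cong: if_cong)
  have ipc: "ip x (covector z) = (x \<bullet> z) *\<^sub>R one_form" for x z
    by (simp add: ip_def ipE inner_vec_def flip: scaleR_sum_left)
  have cov: "covector y \<bullet> covector w = y \<bullet> w" for y w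
    by (simp add: covector_def[of y] inner_sum_left 1) (simp add: inner_vec_def)
  have ipw: "ip x (covector z \<and>\<^sub>f covector w) = (x \<bullet> z) *\<^sub>R covector w - (x \<bullet> w) *\<^sub>R covector z"
  proof -
    have "ip_basis i (covector z \<and>\<^sub>f covector w) = z $ i *\<^sub>R covector w - w $ i *\<^sub>R covector z" for i
      by (simp add: ip_basis_wedge ipE grade_covector wedge_linear)
    thus ?thesis
      by (simp add: ip_def inner_vec_def scaleR_diff_right sum_subtractf scaleR_sum_left)
  qed
  have "(covector x \<and>\<^sub>f covector y) \<bullet> (covector z \<and>\<^sub>f covector w) = ip x (covector z \<and>\<^sub>f covector w) \<bullet> covector y"
    by (simp only: inner_ip) (rule inner_commute)
  thus ?thesis
    by (simp add: ipw inner_diff_left cov inner_commute[of _ y])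
qed

lemma contraction_tensor_vectorial:
  assumes F: "F \<in> Lam4_0"
    and v: "\<And>x y z. contraction_tensor F x y z = (v \<bullet> z) * (x \<bullet> y) - (v \<bullet> y) * (x \<bullet> z)"
  shows "v = 0"
proof -
  let ?b = "\<lambda>i. contraction 2 (ip_basis i rho0) F"
  have b: "?b i \<bullet> (E j \<and>\<^sub>f E k) = (E i \<and>\<^sub>f covector v) \<bullet> (E j \<and>\<^sub>f E k)" for i j k
    using v[of "axis i 1" "axis j 1" "axis k 1"]
      inner_covector_wedge[of "axis i 1" v "axis j 1" "axis k 1"]
    unfolding contraction_tensor_def eval2_eq_inner covector_axis ip_axis
    by (simp only: mult.commute)
  have "rho0 \<bullet> (E k \<and>\<^sub>f E i \<and>\<^sub>f covector v) = 0" for i k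
  proof -
    have "?b i \<bullet> ip_basis k rho0 = (E i \<and>\<^sub>f covector v) \<bullet> ip_basis k rho0"
      by (rule inner_Lam_2_cong[OF ip_basis_rho0_Lam b])
    moreover have "?b i \<bullet> ip_basis k rho0 = 0"
      using contraction_Lam4_0_mm[OF F, of "axis i 1"] by (simp only: mm_iff ip_axis)
    ultimately have "(E i \<and>\<^sub>f covector v) \<bullet> ip_basis k rho0 = 0" by (simp only:)
    hence "ip_basis k rho0 \<bullet> (E i \<and>\<^sub>f covector v) = 0" by (simp only: inner_commute)
    thus ?thesis by (simp only: inner_ip_basis)
  qed
  \<comment> \<open>A 2-form commutes with the covector. With v in front, the vanishing inner
    products say that the contraction of \<open>rho0\<close> by v is zero.\<close>
  moreover have "E k \<and>\<^sub>f E i \<and>\<^sub>f covector v = covector v \<and>\<^sub>f E k \<and>\<^sub>f E i" for i k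
    using wedge_commute_even[of "E k \<and>\<^sub>f E i" "covector v"]
    by (simp add: grade_wedge wedge_linear wedge_assoc)
  ultimately show ?thesis
    by (intro ip_rho0_eq_0) (simp only: inner_ip)
qed

section \<open>The trace, and the two summands of F\<close>

lemma trace_contraction_tensor:
  "(\<Sum>i\<in>UNIV. contraction_tensor (hodge (sigma_plus S)) (axis i 1) (axis i 1) y)
    = 3 * (sigma_plus S \<and>\<^sub>f rho0 \<and>\<^sub>f covector y) $ UNIV"
proof -
  have "ip_basis i rho0 \<and>\<^sub>f E i \<and>\<^sub>f covector y = (E i \<and>\<^sub>f ip_basis i rho0) \<and>\<^sub>f covector y" for i
    using wedge_commute_even[OF grade_ip_basis_rho0, of i "E i"] by (simp only: wedge_assoc[symmetric])
  hence "(\<Sum>i\<in>UNIV. contraction_tensor (hodge (sigma_plus S)) (axis i 1) (axis i 1) y)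
      = ((\<Sum>i\<in>UNIV. E i \<and>\<^sub>f ip_basis i rho0) \<and>\<^sub>f covector y) \<bullet> hodge (sigma_plus S)"
    by (simp only: contraction_tensor_eq covector_axis ip_axis inner_sum_left wedge_sum_left)
  \<comment> \<open>Euler's formula for the 3-form \<open>rho0\<close>.\<close>
  also have "\<dots> = 3 * ((rho0 \<and>\<^sub>f covector y) \<bullet> hodge (sigma_plus S))"
    by (simp add: euler_Lam[OF rho0_Lam] wedge_scaleR_left)
  finally show ?thesis by (simp only: inner_hodge)
qed

lemma sigma_plus_wedge_rho0: "sigma_plus (S \<and>\<^sub>f rho0) = sigma_plus S \<and>\<^sub>f rho0"
  by (simp add: sigma_plus_wedge sigma_plus_rho0)

lemma trace_contraction_tensor_Lam3_27:
  assumes "S \<in> Lam3_27"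
  shows "(\<Sum>i\<in>UNIV. contraction_tensor (hodge (sigma_plus S)) (axis i 1) (axis i 1) y) = 0"
proof -
  have "sigma_plus S \<and>\<^sub>f rho0 = 0"
    using sigma_plus_wedge_rho0[of S] assms by (simp add: Lam3_27_def linear_0[OF linear_sigma_plus])
  thus ?thesis by (simp only: trace_contraction_tensor wedge_assoc[symmetric]) simp
qed

lemma trace_contraction_tensor_Lam3_8:
  assumes S: "S \<in> Lam3_8"
    and tr: "\<And>y. (\<Sum>i\<in>UNIV. contraction_tensor (hodge (sigma_plus S)) (axis i 1) (axis i 1) y) = 0"
  shows "S = 0"
proof -
  obtain \<beta> where \<beta>: "\<beta> \<in> Lam 1" and S_eq: "S = hodge (sigma_plus \<beta> \<and>\<^sub>f rho0)"
    using S unfolding Lam3_8_def Lam2_8_def by blast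
  obtain y where y: "\<beta> = covector y" using Lam_1_covector[OF \<beta>] by blast
  let ?\<omega> = "sigma_plus \<beta>"
  have \<omega>: "?\<omega> = ip y rho0" by (simp add: y sigma_plus_covector)
  have comm: "?\<omega> \<and>\<^sub>f rho0 = rho0 \<and>\<^sub>f ?\<omega>"
    unfolding \<omega> by (rule wedge_commute_even[OF grade_ip_rho0])
  have gS: "grade S = - S"
    using grade_Lam[of S 3] S Lam3_8_subset by auto
  \<comment> \<open>Partial integration: \<open>rho0\<close> is closed and S \<and>
    \<open>rho0\<close> is even, so the derivative moves from S to \<beta>. As S is the Hodge dual
    of d\<beta> \<and> \<open>rho0\<close>, the remaining term is, up to sign, the squared norm of
    that form.\<close>
  have "sigma_plus (S \<and>\<^sub>f rho0 \<and>\<^sub>f \<beta>) = sigma_plus S \<and>\<^sub>f rho0 \<and>\<^sub>f \<beta> + S \<and>\<^sub>f rho0 \<and>\<^sub>f ?\<omega>"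
    by (simp add: sigma_plus_wedge sigma_plus_rho0 gS grade_rho0 wedge_linear)
  hence "(sigma_plus S \<and>\<^sub>f rho0 \<and>\<^sub>f \<beta>) $ UNIV = - (S \<and>\<^sub>f rho0 \<and>\<^sub>f ?\<omega>) $ UNIV"
    using sigma_plus_top[of "S \<and>\<^sub>f rho0 \<and>\<^sub>f \<beta>"] by simp
  moreover have "S \<and>\<^sub>f rho0 \<and>\<^sub>f ?\<omega> = - ((rho0 \<and>\<^sub>f ?\<omega>) \<and>\<^sub>f S)"
  proof -
    have "grade (rho0 \<and>\<^sub>f ?\<omega>) = - (rho0 \<and>\<^sub>f ?\<omega>)"
      by (simp add: grade_wedge grade_rho0 \<omega> grade_ip_rho0 wedge_linear)
    thus ?thesis
      using wedge_commute_odd[OF gS, of "rho0 \<and>\<^sub>f ?\<omega>"] by (simp only: wedge_minus_left)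
  qed
  moreover have "((rho0 \<and>\<^sub>f ?\<omega>) \<and>\<^sub>f S) $ UNIV = (rho0 \<and>\<^sub>f ?\<omega>) \<bullet> (rho0 \<and>\<^sub>f ?\<omega>)"
    unfolding S_eq comm by (rule wedge_hodge_top)
  moreover have "(sigma_plus S \<and>\<^sub>f rho0 \<and>\<^sub>f \<beta>) $ UNIV = 0"
    using tr[of y] unfolding trace_contraction_tensor y by simp
  ultimately have "(rho0 \<and>\<^sub>f ?\<omega>) \<bullet> (rho0 \<and>\<^sub>f ?\<omega>) = 0" by simp
  hence "rho0 \<and>\<^sub>f ?\<omega> = 0" by (simp only: inner_eq_zero_iff)
  \<comment> \<open>S is the Hodge dual of the form that has just been shown to vanish.\<close>
  thus ?thesis by (simp only: S_eq comm linear_0[OF linear_hodge])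
qed

lemma trace_contraction_tensor_eq_0_iff:
  assumes F: "F \<in> Lam4_0"
  shows "(\<forall>y. (\<Sum>i\<in>UNIV. contraction_tensor F (axis i 1) (axis i 1) y) = 0) \<longleftrightarrow> F \<in> hodge ` Lam4_27"
proof
  assume "F \<in> hodge ` Lam4_27"
  thus "\<forall>y. (\<Sum>i\<in>UNIV. contraction_tensor F (axis i 1) (axis i 1) y) = 0"
    unfolding Lam4_27_def using trace_contraction_tensor_Lam3_27 by blast
next
  assume tr: "\<forall>y. (\<Sum>i\<in>UNIV. contraction_tensor F (axis i 1) (axis i 1) y) = 0"
  obtain S S' where S: "S \<in> Lam3_8" "S' \<in> Lam3_27" "F = hodge (sigma_plus S) + hodge (sigma_plus S')"
    using F by (auto simp: Lam4_0_def Lam4_8_def Lam4_27_def elim!: set_plus_elim)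
  have "contraction_tensor F x y z = contraction_tensor (hodge (sigma_plus S)) x y z
      + contraction_tensor (hodge (sigma_plus S')) x y z" for x y z
    by (simp add: S(3) contraction_tensor_eq inner_add_right)
  \<comment> \<open>The part of F from S' is trace-free, so the trace condition passes to the part
    from S.\<close>
  hence "(\<Sum>i\<in>UNIV. contraction_tensor (hodge (sigma_plus S)) (axis i 1) (axis i 1) y) = 0" for y
    using tr trace_contraction_tensor_Lam3_27[OF S(2)] by (simp add: sum.distrib)
  hence "S = 0" using trace_contraction_tensor_Lam3_8[OF S(1)] by blast
  thus "F \<in> hodge ` Lam4_27"
    using S by (simp add: linear_0[OF linear_sigma_plus] linear_0[OF linear_hodge] Lam4_27_def)
qed

section \<open>Types in terms of T and F\<close>

lemma WW_sums:
  "(\<Sum>i\<in>{1, 2, 3}. WW i) = Theta1 ` Lam3_0"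
  "(\<Sum>i\<in>{4, 5}. WW i) = Theta2 ` Lam4_0"
  "(\<Sum>i\<in>{5}. WW i) = Theta2 ` hodge ` Lam4_27"
  "(\<Sum>i\<in>{1, 2, 3, 4, 5}. WW i) = Theta1 ` Lam3_0 + Theta2 ` Lam4_0"
proof -
  have image_plus: "f ` (A + B) = f ` A + f ` B" if f: "linear f" for f :: "form \<Rightarrow> vform" and A B
  proof (intro equalityI subsetI)
    fix y assume "y \<in> f ` (A + B)"
    then obtain a b where "a \<in> A" "b \<in> B" "y = f (a + b)" by (auto elim!: set_plus_elim)
    thus "y \<in> f ` A + f ` B" by (simp add: linear_add[OF f] set_plus_intro)
  next
    fix y assume "y \<in> f ` A + f ` B"
    then obtain a b where "a \<in> A" "b \<in> B" "y = f (a + b)"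
      by (auto elim!: set_plus_elim simp: linear_add[OF f, symmetric])
    thus "y \<in> f ` (A + B)" by (simp add: set_plus_intro)
  qed
  show 1: "(\<Sum>i\<in>{1, 2, 3}. WW i) = Theta1 ` Lam3_0"
    by (simp add: WW_def Lam3_0_def image_plus[OF linear_Theta1] add.assoc)
  show 2: "(\<Sum>i\<in>{4, 5}. WW i) = Theta2 ` Lam4_0"
    by (simp add: WW_def Lam4_0_def image_plus[OF linear_Theta2])
  show "(\<Sum>i\<in>{5}. WW i) = Theta2 ` hodge ` Lam4_27"
    by (simp add: WW_def)
  have "(\<Sum>i\<in>{1, 2, 3, 4, 5}. WW i) = (\<Sum>i\<in>{1, 2, 3}. WW i) + (\<Sum>i\<in>{4, 5}. WW i)"
    by (simp add: add.assoc)
  thus "(\<Sum>i\<in>{1, 2, 3, 4, 5}. WW i) = Theta1 ` Lam3_0 + Theta2 ` Lam4_0"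
    by (simp only: 1 2)
qed

lemma zero_mem_WW: "0 \<in> WW 6"
  by (simp add: WW_def R8_tensor_m_def subspace_0[OF subspace_mm] linear_0[OF linear_Phi1]
      linear_0[OF linear_Phi2])

lemma zero_mem_Lam3_0: "0 \<in> Lam3_0" and zero_mem_Lam4_0: "0 \<in> Lam4_0"
  by (intro subspace_0 subspace_Lam3_0 subspace_Lam4_0)+

lemma type_iff:
  assumes "T \<in> Lam3_0" "F \<in> Lam4_0"
  defines "\<Gamma> \<equiv> Theta1 T + Theta2 F"
  shows "\<Gamma> = 0 \<longleftrightarrow> T = 0 \<and> F = 0"
    and "\<Gamma> \<in> (\<Sum>i\<in>{1, 2, 3}. WW i) \<longleftrightarrow> F = 0"
    and "\<Gamma> \<in> (\<Sum>i\<in>{4, 5}. WW i) \<longleftrightarrow> T = 0"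
    and "\<Gamma> \<in> (\<Sum>i\<in>{5}. WW i) \<longleftrightarrow> T = 0 \<and> F \<in> hodge ` Lam4_27"
proof -
  have unique: "T = T' \<and> F = F'" if "\<Gamma> = Theta1 T' + Theta2 F'" "T' \<in> Lam3_0" "F' \<in> Lam4_0" for T' F'
    using Theta_unique[OF assms(1) that(2) assms(2) that(3) zero_mem_WW] that(1) by (simp add: \<Gamma>_def)
  have \<Theta>0: "Theta1 0 = 0" "Theta2 0 = 0"
    by (simp_all add: linear_0[OF linear_Theta1] linear_0[OF linear_Theta2])
  have sub: "hodge ` Lam4_27 \<subseteq> Lam4_0"
    unfolding Lam4_0_def
    by (intro set_zero_plus2 subspace_0 linear_subspace_image linear_hodge subspace_Lam4_8)
  show "\<Gamma> = 0 \<longleftrightarrow> T = 0 \<and> F = 0"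
    using unique[of 0 0] zero_mem_Lam3_0 zero_mem_Lam4_0 by (auto simp: \<Theta>0 \<Gamma>_def)
  show "\<Gamma> \<in> (\<Sum>i\<in>{1, 2, 3}. WW i) \<longleftrightarrow> F = 0"
    unfolding WW_sums using unique[of _ 0] zero_mem_Lam4_0 assms by (auto simp: \<Theta>0)
  show "\<Gamma> \<in> (\<Sum>i\<in>{4, 5}. WW i) \<longleftrightarrow> T = 0"
    unfolding WW_sums using unique[of 0] zero_mem_Lam3_0 assms by (auto simp: \<Theta>0)
  show "\<Gamma> \<in> (\<Sum>i\<in>{5}. WW i) \<longleftrightarrow> T = 0 \<and> F \<in> hodge ` Lam4_27"
    unfolding WW_sums using unique[of 0] zero_mem_Lam3_0 sub by (auto simp: \<Theta>0 \<Gamma>_def)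
qed

text \<open>The summands \<Gamma>' include a part in W_6, whereas membership in the sum of the first
  five spaces supplies another pair of forms without such a part. Comparing the two by
  \<open>Theta_unique\<close> makes the part in W_6 vanish.\<close>

lemma characteristic_decomposition:
  assumes "T \<in> Lam3_0" "F \<in> Lam4_0" "\<And>i. i \<in> {1..6} \<Longrightarrow> \<Gamma>' i \<in> WW i"
    and "\<Gamma> = (\<Sum>i\<in>{1..6}. \<Gamma>' i)" "Theta1 T = \<Gamma>' 1 + \<Gamma>' 2 + \<Gamma>' 3" "Theta2 F = \<Gamma>' 4 + \<Gamma>' 5"
    and "\<Gamma> \<in> (\<Sum>i\<in>{1, 2, 3, 4, 5}. WW i)"
  shows "\<Gamma> = Theta1 T + Theta2 F"
proof -
  have "{1..6} = {1, 2, 3, 4, 5, 6 :: nat}" by auto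
  hence eq: "\<Gamma> = Theta1 T + Theta2 F + \<Gamma>' 6" by (simp add: assms(4-6) add.assoc)
  obtain T' F' where "T' \<in> Lam3_0" "F' \<in> Lam4_0" "\<Gamma> = Theta1 T' + Theta2 F'"
    using assms(7) unfolding WW_sums by (auto elim!: set_plus_elim)
  hence "\<Gamma>' 6 = 0"
    using Theta_unique(3)[OF assms(1) _ assms(2)] assms(3)[of 6] eq by auto
  thus ?thesis using eq by simp
qed

section \<open>Torsion types in an orthonormal frame\<close>

locale orthonormal_frame =
  fixes h :: "real ^ 8 \<Rightarrow> real ^ 8 \<Rightarrow> real" and b :: "8 \<Rightarrow> real ^ 8"
  assumes bilinear: "bilinear h" and sym: "h X Y = h Y X" and orthonormal: "orthonormal_basis h b"
begin

lemmas h_add_left = bilinear_ladd[OF bilinear]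
  and h_add_right = bilinear_radd[OF bilinear]
  and h_diff_left = bilinear_lsub[OF bilinear]
  and h_scaleR_left = bilinear_lmul[OF bilinear]
  and h_scaleR_right = bilinear_rmul[OF bilinear]

lemma h_sum_left: "h (\<Sum>i\<in>I. f i) Y = (\<Sum>i\<in>I. h (f i) Y)"
  by (induction I rule: infinite_finite_induct) (auto simp: h_add_left bilinear_lzero[OF bilinear])

lemma h_basis: "h (b i) (b j) = (if i = j then 1 else 0)"
  using orthonormal by (simp add: orthonormal_basis_def)

definition coords :: "real ^ 8 \<Rightarrow> real ^ 8" where "coords X = (\<chi> i. h X (b i))"

definition of_coords :: "real ^ 8 \<Rightarrow> real ^ 8" where "of_coords x = (\<Sum>i\<in>UNIV. x $ i *\<^sub>R b i)"

lemma linear_coords: "linear coords"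
  by (rule linearI) (simp_all add: coords_def vec_eq_iff h_add_left h_scaleR_left)

lemma linear_of_coords: "linear of_coords"
  by (rule linearI) (simp_all add: of_coords_def algebra_simps sum.distrib scaleR_sum_right)

lemma coords_of_coords [simp]: "coords (of_coords x) = x"
proof -
  have "h (of_coords x) (b j) = (\<Sum>i\<in>UNIV. if i = j then x $ i else 0)" for j
    unfolding of_coords_def h_sum_left h_scaleR_left h_basis by (intro sum.cong) auto
  thus ?thesis by (simp add: coords_def vec_eq_iff)
qed

text \<open>Orthonormality makes \<open>of_coords\<close> injective; by dimension it is onto, that
  is, b is a basis.\<close>

lemma of_coords_coords [simp]: "of_coords (coords X) = X"
proof -
  have "inj of_coords" by (metis coords_of_coords injI)
  hence "surj of_coords" using linear_inj_imp_surj[OF linear_of_coords] by blast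
  thus ?thesis by (metis coords_of_coords surjD)
qed

lemma expand: "(\<Sum>i\<in>UNIV. h X (b i) *\<^sub>R b i) = X"
  using of_coords_coords[of X] by (simp add: of_coords_def coords_def)

lemma coords_basis: "coords (b i) = axis i 1"
  by (auto simp: coords_def vec_eq_iff h_basis axis_def)

lemma inner_coords: "coords X \<bullet> coords Y = h X Y"
proof -
  have "h X Y = h (\<Sum>i\<in>UNIV. h X (b i) *\<^sub>R b i) Y" by (simp only: expand)
  also have "\<dots> = coords X \<bullet> coords Y"
    unfolding h_sum_left h_scaleR_left inner_vec_def coords_def by (simp add: sym)
  finally show ?thesis by simp
qed

text \<open>\<open>TT_160\<close> involves the traces in all orthonormal bases, whereas F is known
  in one frame. Expand the first argument in b, exchange the sums and reassemble the second argument
  from its coefficients in b'.\<close>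

lemma trace_independent:
  assumes N: "\<And>Y. linear (\<lambda>X. N X Y)" "\<And>X. linear (\<lambda>Y. N X Y)" and b': "orthonormal_basis h b'"
  shows "(\<Sum>i\<in>UNIV. N (b' i) (b' i)) = (\<Sum>i\<in>UNIV. N (b i) (b i) :: real)"
proof -
  interpret b': orthonormal_frame h b' by standard (fact bilinear sym b')+
  have "(\<Sum>i\<in>UNIV. N (b' i) (b' i)) = (\<Sum>i\<in>UNIV. N (\<Sum>j\<in>UNIV. h (b' i) (b j) *\<^sub>R b j) (b' i))"
    by (simp only: expand)
  also have "\<dots> = (\<Sum>i\<in>UNIV. \<Sum>j\<in>UNIV. h (b' i) (b j) * N (b j) (b' i))"
    by (simp add: linear_sum[OF N(1)] linear_scale[OF N(1)])
  also have "\<dots> = (\<Sum>j\<in>UNIV. \<Sum>i\<in>UNIV. h (b j) (b' i) * N (b j) (b' i))"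
    by (subst sum.swap) (simp only: sym)
  also have "\<dots> = (\<Sum>j\<in>UNIV. N (b j) (\<Sum>i\<in>UNIV. h (b j) (b' i) *\<^sub>R b' i))"
    by (simp add: linear_sum[OF N(2)] linear_scale[OF N(2)])
  finally show ?thesis by (simp only: b'.expand)
qed

end

section \<open>Tensors of the shape of the characteristic torsion\<close>

lemma TT_56_cyclic: "t \<in> TT_56 \<Longrightarrow> t Y Z X = t X Y Z"
  unfolding TT_56_def mem_Collect_eq by metis

lemma trilinear_diff: "trilinear s \<Longrightarrow> trilinear t \<Longrightarrow> trilinear (\<lambda>X Y Z. s X Y Z - t X Y Z)"
  by (auto simp: trilinear_def intro: linear_compose_sub)

text \<open>The algebra of the characteristic torsion at one point: S stands for T^c, and the other
  two terms are the skew part of the contraction tensor, carried to the tangent space by the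
  frame.\<close>

locale frame_torsion = orthonormal_frame +
  fixes S \<tau> :: tensor3 and F :: form
  assumes S: "S \<in> TT_56" and F: "F \<in> Lam4_0"
    and \<tau>: "\<tau> X Y Z = S X Y Z + contraction_tensor F (coords X) (coords Y) (coords Z)
        - contraction_tensor F (coords Y) (coords X) (coords Z)"
begin

definition Q :: tensor3 where "Q X Y Z = contraction_tensor F (coords X) (coords Y) (coords Z)"

lemma \<tau>_eq: "\<tau> X Y Z = S X Y Z + Q X Y Z - Q Y X Z"
  by (simp add: \<tau> Q_def)

lemma trilinear_Q: "trilinear Q"
  using trilinear_contraction_tensor[of F]
  unfolding trilinear_def Q_def by (auto intro!: linear_compose[OF linear_coords, unfolded o_def])

lemma Q_skew: "Q X Z Y = - Q X Y Z"
  unfolding Q_def by (rule contraction_tensor_skew)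

lemma Q_cyclic: "Q X Y Z + Q Y Z X + Q Z X Y = 0"
  unfolding Q_def by (rule contraction_tensor_cyclic[OF F])

lemma Q_eq_0: "(\<forall>X Y Z. Q X Y Z = 0) \<longleftrightarrow> F = 0"
proof
  assume *: "\<forall>X Y Z. Q X Y Z = 0"
  have "contraction_tensor F x y z = 0" for x y z
    using *[rule_format, of "of_coords x" "of_coords y" "of_coords z"] by (simp add: Q_def)
  thus "F = 0" using F Lam4_0_subset contraction_tensor_eq_0 by blast
next
  assume "F = 0"
  thus "\<forall>X Y Z. Q X Y Z = 0" unfolding Q_def contraction_tensor_eq by simp
qed

lemma S_TT: "trilinear S" "S Y X Z = - S X Y Z" "S X Z Y = - S X Y Z"
  using S unfolding TT_56_def by (simp, (metis (mono_tags, lifting) mem_Collect_eq minus_minus)+)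

lemma \<tau>_cyclic: "\<tau> X Y Z + \<tau> Y Z X + \<tau> Z X Y = 3 * S X Y Z"
  using Q_cyclic[of X Y Z] Q_skew[of X Y Z] Q_skew[of Y Z X] Q_skew[of Z X Y]
    TT_56_cyclic[OF S, of X Y Z] TT_56_cyclic[OF S, of Y Z X]
  by (simp add: \<tau>_eq)

lemma trilinear_\<tau>: "trilinear \<tau>"
proof -
  have "trilinear (\<lambda>X Y Z. Q Y X Z)" using trilinear_Q by (auto simp: trilinear_def)
  from trilinear_diff[OF S_TT(1) trilinear_diff[OF this trilinear_Q]]
  show ?thesis by (rule back_subst[where P = trilinear]) (simp add: fun_eq_iff \<tau>_eq)
qed

lemma \<tau>_TT: "\<tau> \<in> TT"
proof -
  have "\<tau> X Y Z + \<tau> Y X Z = 0" for X Y Z using S_TT(2)[of X Y Z] by (simp add: \<tau>_eq)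
  thus ?thesis using trilinear_\<tau> by (simp add: TT_def)
qed

text \<open>Koszul's argument: a tensor that is skew in its last two arguments is determined by its
  skew part in the first two.\<close>

lemma Q_from_\<tau>:
  assumes "\<And>X Y Z. S X Y Z = 0"
  shows "2 * Q X Y Z = \<tau> X Y Z + \<tau> Z X Y - \<tau> Y Z X"
  using assms Q_skew[of X Y Z] Q_skew[of Y Z X] Q_skew[of Z X Y] by (simp add: \<tau>_eq)

lemma vanishes_iff: "(\<forall>X Y Z. \<tau> X Y Z = 0) \<longleftrightarrow> (\<forall>X Y Z. S X Y Z = 0) \<and> F = 0"
proof
  assume 0: "\<forall>X Y Z. \<tau> X Y Z = 0"
  hence "S X Y Z = 0" for X Y Z using \<tau>_cyclic[of X Y Z] by simp
  moreover from this have "Q X Y Z = 0" for X Y Z using 0 Q_from_\<tau>[of X Y Z] by simp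
  ultimately show "(\<forall>X Y Z. S X Y Z = 0) \<and> F = 0" using Q_eq_0 by blast
next
  assume "(\<forall>X Y Z. S X Y Z = 0) \<and> F = 0"
  thus "\<forall>X Y Z. \<tau> X Y Z = 0" using Q_eq_0 by (simp add: \<tau>_eq)
qed

lemma skew_iff: "\<tau> \<in> TT_56 \<longleftrightarrow> F = 0"
proof
  assume \<tau>56: "\<tau> \<in> TT_56"
  \<comment> \<open>A totally skew-symmetric tensor is one third of its cyclic sum, and the cyclic
    sum of \<tau> is 3 S.\<close>
  have \<tau>S: "\<tau> X Y Z = S X Y Z" for X Y Z
    using \<tau>_cyclic[of X Y Z] TT_56_cyclic[OF \<tau>56, of X Y Z] TT_56_cyclic[OF \<tau>56, of Y Z X] by simp
  hence sym: "Q X Y Z = Q Y X Z" for X Y Z using \<tau>_eq[of X Y Z] by simp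
  \<comment> \<open>Q is now symmetric in the first two and skew in the last two arguments;
    alternating these exchanges leads back to Q with the opposite sign.\<close>
  have "Q X Y Z = 0" for X Y Z
    using sym[of X Y Z] sym[of Y Z X] sym[of Z X Y] Q_skew[of X Y Z] Q_skew[of Y Z X] Q_skew[of Z X Y]
    by simp
  thus "F = 0" using Q_eq_0 by blast
next
  assume "F = 0"
  hence "\<tau> = S" using Q_eq_0 by (simp add: fun_eq_iff \<tau>_eq)
  thus "\<tau> \<in> TT_56" using S by simp
qed

lemma TT_8_cyclic:
  assumes "t \<in> TT_8 h"
  shows "t X Y Z + t Y Z X + t Z X Y = 0"
proof -
  obtain V where t: "\<And>X Y Z. t X Y Z = h (h V X *\<^sub>R Y - h V Y *\<^sub>R X) Z"
    using assms by (auto simp: TT_8_def)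
  show ?thesis
    using sym[of X Y] sym[of Y Z] sym[of X Z] by (simp add: t h_diff_left h_scaleR_left)
qed

lemma S_eq_0_of_cyclic: "(\<And>X Y Z. \<tau> X Y Z + \<tau> Y Z X + \<tau> Z X Y = 0) \<Longrightarrow> S X Y Z = 0"
  using \<tau>_cyclic[of X Y Z] by simp

text \<open>S X Y Y and Q X Y Y vanish by skew-symmetry, which leaves - Q Y X Y = Q Y Y X.\<close>

lemma trace_\<tau>:
  assumes "orthonormal_basis h b'"
  shows "(\<Sum>i\<in>UNIV. \<tau> X (b' i) (b' i)) = (\<Sum>i\<in>UNIV. contraction_tensor F (axis i 1) (axis i 1) (coords X))"
proof -
  have "\<tau> X Y Y = Q Y Y X" for Y
    using Q_skew[of X Y Y] Q_skew[of Y X Y] S_TT(3)[of X Y Y] by (simp add: \<tau>_eq)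
  hence "(\<Sum>i\<in>UNIV. \<tau> X (b' i) (b' i)) = (\<Sum>i\<in>UNIV. Q (b' i) (b' i) X)" by simp
  also have "\<dots> = (\<Sum>i\<in>UNIV. Q (b i) (b i) X)"
    using trilinear_Q assms unfolding trilinear_def by (intro trace_independent) auto
  finally show ?thesis by (simp add: Q_def coords_basis)
qed

lemma cyclic_iff: "\<tau> \<in> TT_cyclic h \<longleftrightarrow> (\<forall>X Y Z. S X Y Z = 0)"
proof
  assume "\<tau> \<in> TT_cyclic h"
  then obtain s t where st: "\<tau> = (\<lambda>X Y Z. s X Y Z + t X Y Z)" "s \<in> TT_8 h" "t \<in> TT_160 h"
    by (auto simp: TT_cyclic_def)
  have "t X Y Z + t Y Z X + t Z X Y = 0" for X Y Z using st(3) by (simp add: TT_160_def)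
  hence "\<tau> X Y Z + \<tau> Y Z X + \<tau> Z X Y = 0" for X Y Z
    using TT_8_cyclic[OF st(2), of X Y Z] by (simp add: st(1) algebra_simps)
  thus "\<forall>X Y Z. S X Y Z = 0" using S_eq_0_of_cyclic by blast
next
  assume S0: "\<forall>X Y Z. S X Y Z = 0"
  \<comment> \<open>With S = 0 the trace of \<tau> determines a vectorial part, and the difference
    is trace-free and still has cyclic sum zero.\<close>
  define tr where "tr X = (\<Sum>i\<in>UNIV. \<tau> X (b i) (b i))" for X
  have lin: "linear tr"
    unfolding tr_def using trilinear_\<tau> by (intro linear_compose_sum) (auto simp: trilinear_def)
  \<comment> \<open>The vectorial tensor of V has the trace 8 h V X - h V X = 7 h V X, hence the
    division by 7.\<close>
  define V where "V = (\<Sum>j\<in>UNIV. (tr (b j) / 7) *\<^sub>R b j)"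
  have V: "7 * h V X = tr X" for X
  proof -
    have "tr X = tr (\<Sum>i\<in>UNIV. h X (b i) *\<^sub>R b i)" by (simp only: expand)
    also have "\<dots> = (\<Sum>i\<in>UNIV. h X (b i) * tr (b i))"
      by (simp add: linear_sum[OF lin] linear_scale[OF lin])
    finally show ?thesis
      by (simp add: V_def h_sum_left h_scaleR_left sym[of X] sum_distrib_left mult.commute)
  qed
  define s where "s X Y Z = h (h V X *\<^sub>R Y - h V Y *\<^sub>R X) Z" for X Y Z
  define t where "t X Y Z = \<tau> X Y Z - s X Y Z" for X Y Z
  have s_eq: "s X Y Z = h V X * h Y Z - h V Y * h X Z" for X Y Z
    by (simp add: s_def h_diff_left h_scaleR_left)
  have tri: "trilinear s"
    unfolding trilinear_def s_eq
    by (intro conjI allI linearI)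
      (simp_all add: h_add_left h_add_right h_scaleR_left h_scaleR_right algebra_simps)
  have s: "s \<in> TT_8 h"
    using tri by (auto simp: TT_8_def TT_def s_eq) (auto simp: s_def[abs_def] s_eq[symmetric])
  have "t \<in> TT_160 h"
    unfolding TT_160_def
  proof (intro CollectI conjI allI impI)
    show "t \<in> TT"
      using trilinear_diff[OF trilinear_\<tau> tri] \<tau>_TT by (auto simp: TT_def t_def[abs_def] s_eq)
    fix X Y Z
    show "t X Y Z + t Y Z X + t Z X Y = 0"
      using TT_8_cyclic[OF s, of X Y Z] \<tau>_cyclic[of X Y Z] S0 by (simp add: t_def)
  next
    fix b' X
    assume b': "orthonormal_basis h b'"
    then interpret b': orthonormal_frame h b' by (intro orthonormal_frame.intro bilinear sym)
    have "(\<Sum>i\<in>UNIV. \<tau> X (b' i) (b' i)) = tr X"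
      unfolding tr_def by (simp only: trace_\<tau>[OF b'] trace_\<tau>[OF orthonormal])
    moreover have "(\<Sum>i\<in>UNIV. s X (b' i) (b' i)) = 7 * h V X"
    proof -
      have "(\<Sum>i\<in>UNIV. s X (b' i) (b' i)) = 8 * h V X - b'.coords V \<bullet> b'.coords X"
        by (simp add: s_eq b'.h_basis sum_subtractf inner_vec_def b'.coords_def)
      thus ?thesis by (simp add: b'.inner_coords)
    qed
    ultimately show "(\<Sum>i\<in>UNIV. t X (b' i) (b' i)) = 0"
      by (simp add: t_def sum_subtractf V)
  qed
  moreover have "\<tau> = (\<lambda>X Y Z. s X Y Z + t X Y Z)" by (simp add: fun_eq_iff t_def)
  ultimately show "\<tau> \<in> TT_cyclic h"
    using s unfolding TT_cyclic_def by blast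
qed

lemma vectorial_imp:
  assumes "\<tau> \<in> TT_8 h"
  shows "(\<forall>X Y Z. S X Y Z = 0) \<and> F = 0"
proof -
  obtain V where V: "\<And>X Y Z. \<tau> X Y Z = h (h V X *\<^sub>R Y - h V Y *\<^sub>R X) Z"
    using assms by (auto simp: TT_8_def)
  have S0: "S X Y Z = 0" for X Y Z using S_eq_0_of_cyclic TT_8_cyclic[OF assms] by blast
  \<comment> \<open>Koszul's formula turns the vectorial \<tau> into the 2-forms X \<and> V.\<close>
  have Q: "Q X Y Z = h V Z * h X Y - h V Y * h X Z" for X Y Z
    using Q_from_\<tau>[OF S0, of X Y Z] sym[of Y X] sym[of Z X] sym[of Z Y]
    by (simp add: V h_diff_left h_scaleR_left)
  have "contraction_tensor F x y z
      = (coords V \<bullet> z) * (x \<bullet> y) - (coords V \<bullet> y) * (x \<bullet> z)" for x y z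
    using Q[of "of_coords x" "of_coords y" "of_coords z"] by (simp add: Q_def flip: inner_coords)
  hence "coords V = 0" by (rule contraction_tensor_vectorial[OF F])
  hence "h V X = 0" for X using inner_coords[of V X] by simp
  hence "\<forall>X Y Z. Q X Y Z = 0" by (simp only: Q mult_zero_left diff_zero simp_thms)
  thus ?thesis using S0 Q_eq_0 by blast
qed

lemma TT_160_iff: "\<tau> \<in> TT_160 h \<longleftrightarrow> (\<forall>X Y Z. S X Y Z = 0) \<and> F \<in> hodge ` Lam4_27"
proof -
  let ?tr = "\<lambda>x. \<Sum>i\<in>UNIV. contraction_tensor F (axis i 1) (axis i 1) x"
  have "(\<forall>b' X. orthonormal_basis h b' \<longrightarrow> (\<Sum>i\<in>UNIV. \<tau> X (b' i) (b' i)) = 0) \<longleftrightarrow> (\<forall>x. ?tr x = 0)"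
  proof
    assume *: "\<forall>b' X. orthonormal_basis h b' \<longrightarrow> (\<Sum>i\<in>UNIV. \<tau> X (b' i) (b' i)) = 0"
    show "\<forall>x. ?tr x = 0"
    proof
      fix x
      show "?tr x = 0"
        using *[rule_format, OF orthonormal, of "of_coords x"]
        by (simp only: trace_\<tau>[OF orthonormal] coords_of_coords)
    qed
  qed (simp add: trace_\<tau>)
  moreover have "(\<forall>X Y Z. \<tau> X Y Z + \<tau> Y Z X + \<tau> Z X Y = 0) \<longleftrightarrow> (\<forall>X Y Z. S X Y Z = 0)"
    unfolding \<tau>_cyclic by simp
  ultimately show ?thesis
    unfolding TT_160_def mem_Collect_eq trace_contraction_tensor_eq_0_iff[OF F, symmetric]
    using \<tau>_TT by (simp only: simp_thms)
qed

end

section \<open>Manifolds\<close>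

lemma Ck_on_subset: "Ck_on k S f \<Longrightarrow> T \<subseteq> S \<Longrightarrow> Ck_on k T f"
proof (induction k arbitrary: f)
  case 0
  thus ?case by (auto intro: continuous_on_subset)
next
  case (Suc k)
  thus ?case by (auto intro: differentiable_on_subset)
qed

text \<open>On an open set the derivatives at a point depend on the values in the set alone. Both
  functions admit the same derivatives, so the choice in \<open>frechet_derivative\<close> is the
  same.\<close>

lemma Ck_on_cong:
  assumes "open S"
  shows "Ck_on k S f \<Longrightarrow> (\<And>x. x \<in> S \<Longrightarrow> f x = g x) \<Longrightarrow> Ck_on k S g"
proof (induction k arbitrary: f g)
  case 0
  thus ?case by (simp cong: continuous_on_cong)
next
  case (Suc k)
  have iff: "(f has_derivative f') (at x) \<longleftrightarrow> (g has_derivative f') (at x)" if "x \<in> S" for x f'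
    using has_derivative_transform_within_open[OF _ assms that, of f f' UNIV g]
      has_derivative_transform_within_open[OF _ assms that, of g f' UNIV f] Suc.prems(2) by auto
  hence "frechet_derivative f (at x) = frechet_derivative g (at x)" if "x \<in> S" for x
    using that by (simp add: frechet_derivative_def)
  moreover have "g differentiable_on S"
    using Suc.prems(1) iff assms by (auto simp: differentiable_on_eq_differentiable_at differentiable_def)
  ultimately show ?case
    using Suc.prems(1) Suc.IH by fastforce
qed

lemma Ck_on_zero: "Ck_on k S (\<lambda>x. 0)"
  by (induction k) auto

text \<open>Multiple and sum in one step, as the induction for finite combinations consumes them.
  The scalar is constant, so differentiation preserves the shape.\<close>

lemma Ck_on_add_scaleR:
  assumes "open S"
  shows "Ck_on k S f \<Longrightarrow> Ck_on k S g \<Longrightarrow> Ck_on k S (\<lambda>x. c *\<^sub>R f x + g x)"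
proof (induction k arbitrary: f g)
  case 0
  thus ?case by (auto intro!: continuous_intros)
next
  case (Suc k)
  have diff: "f differentiable (at x)" "g differentiable (at x)" if "x \<in> S" for x
    using Suc.prems that assms by (auto simp: differentiable_on_eq_differentiable_at)
  have "(\<lambda>x. c *\<^sub>R f x + g x) differentiable_on S"
    using diff assms by (auto simp: differentiable_on_eq_differentiable_at intro!: derivative_intros)
  moreover have "Ck_on k S (\<lambda>x. frechet_derivative (\<lambda>x. c *\<^sub>R f x + g x) (at x) b)" if "b \<in> Basis" for b
  proof (rule Ck_on_cong[OF assms])
    show "Ck_on k S (\<lambda>x. c *\<^sub>R frechet_derivative f (at x) b + frechet_derivative g (at x) b)"
      using Suc that by simp
    fix x assume "x \<in> S"
    hence "((\<lambda>x. c *\<^sub>R f x + g x) has_derivative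
        (\<lambda>v. c *\<^sub>R frechet_derivative f (at x) v + frechet_derivative g (at x) v)) (at x)"
      using diff by (auto intro!: derivative_intros simp: frechet_derivative_works[symmetric])
    thus "c *\<^sub>R frechet_derivative f (at x) b + frechet_derivative g (at x) b
        = frechet_derivative (\<lambda>x. c *\<^sub>R f x + g x) (at x) b"
      by (simp add: frechet_derivative_at[symmetric])
  qed
  ultimately show ?case by simp
qed

lemma Ck_on_sum_scaleR:
  assumes "open S" "finite I" "\<And>i. i \<in> I \<Longrightarrow> Ck_on k S (f i)"
  shows "Ck_on k S (\<lambda>x. \<Sum>i\<in>I. c i *\<^sub>R f i x)"
  using assms(2,3)
  by (induction I rule: finite_induct) (auto intro!: Ck_on_zero Ck_on_add_scaleR[OF assms(1)])

section \<open>Vector fields in charts\<close>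

lemma smooth_vfield_subset:
  assumes "smooth_vfield A U X" "V \<subseteq> U"
  shows "smooth_vfield A V X"
  unfolding smooth_vfield_def smooth_on_def
proof (intro ballI allI)
  fix c k assume "c \<in> A"
  hence "Ck_on k (coord c ` (U \<inter> dom_ch c)) (\<lambda>y. components A c (coord_inv c y) (X (coord_inv c y)))"
    using assms(1) by (auto simp: smooth_vfield_def smooth_on_def)
  thus "Ck_on k (coord c ` (V \<inter> dom_ch c)) (\<lambda>y. components A c (coord_inv c y) (X (coord_inv c y)))"
    by (rule Ck_on_subset) (use assms(2) in auto)
qed

lemma open_coord_image:
  fixes A :: "('m::{t2_space, second_countable_topology}) chart set"
  assumes "oriented_smooth_atlas A" "c \<in> A" "open U"
  shows "open (coord c ` (U \<inter> dom_ch c))"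
proof -
  have c: "open (dom_ch c)" "open (coord c ` dom_ch c)"
      "homeomorphism (dom_ch c) (coord c ` dom_ch c) (coord c) (coord_inv c)"
    using assms by (auto simp: oriented_smooth_atlas_def)
  have "openin (top_of_set (dom_ch c)) (U \<inter> dom_ch c)"
    using assms(3) c(1) by (simp add: openin_open_eq open_Int)
  hence "openin (top_of_set (coord c ` dom_ch c)) (coord c ` (U \<inter> dom_ch c))"
    using c(3) homeomorphism_imp_open_map by blast
  thus ?thesis using c(2) openin_open_eq by blast
qed

lemma coord_inv_coord:
  fixes A :: "('m::{t2_space, second_countable_topology}) chart set"
  assumes "oriented_smooth_atlas A" "c \<in> A" "q \<in> dom_ch c"
  shows "coord_inv c (coord c q) = q"
  using assms by (auto simp: oriented_smooth_atlas_def homeomorphism_def)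

text \<open>The transition map is smooth on an open set around the point, so that its
  \<open>frechet_derivative\<close> is a genuine derivative and hence linear.\<close>

lemma linear_components:
  fixes A :: "('m::{t2_space, second_countable_topology}) chart set"
  assumes A: "oriented_smooth_atlas A" and c: "c \<in> A" and q: "q \<in> dom_ch c"
  shows "linear (components A c q)"
proof -
  let ?d = "chart_at A q"
  have "q \<in> (\<Union>d\<in>A. dom_ch d)" using A by (simp add: oriented_smooth_atlas_def)
  hence "\<exists>d. d \<in> A \<and> q \<in> dom_ch d" by blast
  hence d: "?d \<in> A \<and> q \<in> dom_ch ?d" unfolding chart_at_def by (rule someI_ex)
  let ?S = "coord ?d ` (dom_ch ?d \<inter> dom_ch c)"
  have "open (dom_ch c)" using A c by (auto simp: oriented_smooth_atlas_def)
  hence S: "open ?S" using open_coord_image[OF A, of ?d "dom_ch c"] d by (simp add: Int_commute)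
  have "smooth_on ?S (\<lambda>y. coord c (coord_inv ?d y))"
    using A c d by (auto simp: oriented_smooth_atlas_def)
  hence "Ck_on (Suc 0) ?S (\<lambda>y. coord c (coord_inv ?d y))"
    unfolding smooth_on_def by blast
  hence "(\<lambda>y. coord c (coord_inv ?d y)) differentiable_on ?S" by simp
  hence "(\<lambda>y. coord c (coord_inv ?d y)) differentiable (at (coord ?d q))"
    using S d q by (simp add: differentiable_on_eq_differentiable_at)
  thus ?thesis
    unfolding components_def[abs_def] chart_change_def by (rule linear_frechet_derivative)
qed

text \<open>Constant combinations of a frame are smooth fields with any prescribed value at a given
  point; \<open>torsion_tensor_eq\<close> extends tangent vectors in this way.\<close>

lemma smooth_vfield_combination:
  fixes A :: "('m::{t2_space, second_countable_topology}) chart set" and x :: "real ^ 8"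
  assumes A: "oriented_smooth_atlas A" and U: "open U" and e: "\<And>i. smooth_vfield A U (e i)"
  shows "smooth_vfield A U (\<lambda>q. \<Sum>i\<in>UNIV. x $ i *\<^sub>R e i q)"
  unfolding smooth_vfield_def smooth_on_def
proof (intro ballI allI)
  fix c k assume c: "c \<in> A"
  let ?S = "coord c ` (U \<inter> dom_ch c)"
  have S: "open ?S" by (rule open_coord_image[OF A c U])
  show "Ck_on k ?S (\<lambda>y. components A c (coord_inv c y) (\<Sum>i\<in>UNIV. x $ i *\<^sub>R e i (coord_inv c y)))"
  proof (rule Ck_on_cong[OF S])
    show "Ck_on k ?S (\<lambda>y. \<Sum>i\<in>UNIV. x $ i *\<^sub>R components A c (coord_inv c y) (e i (coord_inv c y)))"
      using e c by (intro Ck_on_sum_scaleR[OF S]) (auto simp: smooth_vfield_def smooth_on_def)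
    fix y assume "y \<in> ?S"
    then obtain q where q: "q \<in> dom_ch c" "y = coord c q" by auto
    hence lin: "linear (components A c (coord_inv c y))"
      using linear_components[OF A c] coord_inv_coord[OF A c] by simp
    show "(\<Sum>i\<in>UNIV. x $ i *\<^sub>R components A c (coord_inv c y) (e i (coord_inv c y)))
        = components A c (coord_inv c y) (\<Sum>i\<in>UNIV. x $ i *\<^sub>R e i (coord_inv c y))"
      by (simp add: linear_sum[OF lin] linear_scale[OF lin])
  qed
qed

lemma adapted_frame_subset:
  assumes "adapted_frame A g \<rho> U e" "open V" "V \<subseteq> U"
  shows "adapted_frame A g \<rho> V e"
  using assms smooth_vfield_subset unfolding adapted_frame_def by blast

section \<open>Metric and forms at a point\<close>

lemma bilinear_inner_at:
  assumes "riemannian_metric A g"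
  shows "bilinear (inner_at g p)"
proof -
  have "linear (\<lambda>v. g p (xs[i := v]))" if "length xs = 2" "i < 2" for xs i
    using assms that by (auto simp: riemannian_metric_def smooth_tensor_def multilinear_def)
  from this[of "[_, _]" 0] this[of "[_, _]" 1] show ?thesis by (simp add: bilinear_def)
qed

lemma differential_form_3_TT_56:
  assumes "differential_form A 3 T"
  shows "(\<lambda>X Y Z. T p [X, Y, Z]) \<in> TT_56"
proof -
  have lin: "linear (\<lambda>v. T p (xs[i := v]))" if "length xs = 3" "i < 3" for xs i
    using assms that by (auto simp: differential_form_def smooth_tensor_def multilinear_def)
  \<comment> \<open>The entry 0 is a placeholder that the list update overwrites.\<close>
  have 1: "linear (\<lambda>X. T p [X, Y, Z])" for Y Z using lin[of "[0, Y, Z]" 0] by simp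
  have 2: "linear (\<lambda>Y. T p [X, Y, Z])" for X Z using lin[of "[X, 0, Z]" 1] by simp
  have 3: "linear (\<lambda>Z. T p [X, Y, Z])" for X Y using lin[of "[X, Y, 0]" 2] by (simp add: eval_nat_numeral)
  have "T p xs = 0" if "length xs = 3" "\<not> distinct xs" for xs
    using assms that by (auto simp: differential_form_def)
  hence z: "T p [X, X, Z] = 0" "T p [Z, X, X] = 0" for X Z by simp_all
  \<comment> \<open>Polarisation: the form vanishes on repeated arguments, in particular on X + Y
    twice.\<close>
  have "T p [X, Y, Z] = - T p [Y, X, Z]" for X Y Z
    using z(1)[of "X + Y" Z] z(1)[of X Z] z(1)[of Y Z] by (simp add: linear_add[OF 1] linear_add[OF 2])
  moreover have "T p [X, Y, Z] = - T p [X, Z, Y]" for X Y Z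
    using z(2)[of X "Y + Z"] z(2)[of X Y] z(2)[of X Z] by (simp add: linear_add[OF 2] linear_add[OF 3])
  ultimately show ?thesis using 1 2 3 unfolding TT_56_def trilinear_def by blast
qed

lemma sorted_list_of_set_3:
  fixes i j k :: "'a::linorder"
  assumes "i < j" "j < k"
  shows "sorted_list_of_set {i, j, k} = [i, j, k]"
proof -
  have "sorted_list_of_set (set [i, j, k]) = [i, j, k]"
    using assms by (subst sorted_list_of_set_sort_remdups) auto
  thus ?thesis by simp
qed

lemma card_3_sorted:
  fixes I :: "'a::linorder set"
  assumes "card I = 3"
  obtains i j k where "i < j" "j < k" "I = {i, j, k}"
proof -
  define l where "l = sorted_list_of_set I"
  have "finite I" using assms card.infinite by fastforce
  hence l: "sorted_wrt (<) l" "length l = 3" "set l = I"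
    using assms by (simp_all add: l_def)
  then obtain i j k where "l = [i, j, k]"
    by (auto simp: length_Suc_conv eval_nat_numeral)
  thus ?thesis using that l by auto
qed

text \<open>The frame components record increasing triples of frame vectors. Alternation extends
  their vanishing to all triples, and expansion in the frame, one argument at a time, to all tangent
  vectors.\<close>

lemma (in orthonormal_frame) form_in_frame_3_eq_0_iff:
  assumes S: "(\<lambda>X Y Z. T p [X, Y, Z]) \<in> TT_56" and e: "\<And>i. e i p = b i"
  shows "form_in_frame 3 e T p = 0 \<longleftrightarrow> (\<forall>X Y Z. T p [X, Y, Z] = 0)"
proof
  assume *: "form_in_frame 3 e T p = 0"
  define t where "t i j k = T p [b i, b j, b k]" for i j k
  have lin: "linear (\<lambda>X. T p [X, Y, Z])" "linear (\<lambda>Y. T p [X, Y, Z])" "linear (\<lambda>Z. T p [X, Y, Z])" for X Y Z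
    using S unfolding TT_56_def mem_Collect_eq trilinear_def by blast+
  have alt: "t j i k = - t i j k" "t i k j = - t i j k" for i j k
    using S unfolding t_def TT_56_def mem_Collect_eq by blast+
  have sorted: "t i j k = 0" if "i < j" "j < k" for i j k
  proof -
    have "form_in_frame 3 e T p $ {i, j, k} = 0" using * by simp
    moreover have "i \<noteq> j" "i \<noteq> k" "j \<noteq> k"
      using that less_trans[OF that] less_imp_neq by blast+
    hence "card {i, j, k} = 3" by simp
    ultimately show ?thesis
      unfolding form_in_frame_def vec_lambda_beta sorted_list_of_set_3[OF that] by (simp add: e t_def)
  qed
  have t: "t i j k = 0" for i j k
    by (rule alternating_3_eq_0[of t UNIV, OF alt]) (use sorted in auto)
  show "\<forall>X Y Z. T p [X, Y, Z] = 0"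
  proof (intro allI)
    fix X Y Z
    have "T p [b i, b j, Z] = T p [b i, b j, \<Sum>k\<in>UNIV. h Z (b k) *\<^sub>R b k]" for i j
      by (simp only: expand)
    hence 1: "T p [b i, b j, Z] = 0" for i j
      using t by (simp add: linear_sum[OF lin(3)] linear_scale[OF lin(3)] t_def)
    have "T p [b i, Y, Z] = T p [b i, \<Sum>k\<in>UNIV. h Y (b k) *\<^sub>R b k, Z]" for i
      by (simp only: expand)
    hence 2: "T p [b i, Y, Z] = 0" for i
      using 1 by (simp add: linear_sum[OF lin(2)] linear_scale[OF lin(2)])
    have "T p [X, Y, Z] = T p [\<Sum>k\<in>UNIV. h X (b k) *\<^sub>R b k, Y, Z]"
      by (simp only: expand)
    thus "T p [X, Y, Z] = 0"
      using 2 by (simp add: linear_sum[OF lin(1)] linear_scale[OF lin(1)])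
  qed
next
  assume *: "\<forall>X Y Z. T p [X, Y, Z] = 0"
  have "form_in_frame 3 e T p $ I = 0" for I
  proof (cases "card I = 3")
    case True
    then obtain i j k where ijk: "i < j" "j < k" and I: "I = {i, j, k}" by (rule card_3_sorted)
    show ?thesis
      unfolding form_in_frame_def vec_lambda_beta I sorted_list_of_set_3[OF ijk] using * by simp
  qed (simp add: form_in_frame_def)
  thus "form_in_frame 3 e T p = 0" by (simp add: vec_eq_iff)
qed

text \<open>The Levi-Civita connection is torsion-free, so the torsion is the skew part of the
  difference of the two connections. The halves of T from both orders add up to T.\<close>

lemma torsion_tensor_eq:
  fixes A :: "('m::{t2_space, second_countable_topology}) chart set"
  assumes A: "oriented_smooth_atlas A" and g: "riemannian_metric A g"
    and nabla_g: "levi_civita A g nabla_g" and T: "differential_form A 3 T"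
    and nabla_c: "characteristic_connection A g \<rho> nabla_g T F nabla_c"
    and e: "adapted_frame A g \<rho> U e" and p: "p \<in> U"
  shows "torsion_tensor A g nabla_c p u v w = T p [u, v, w]
      + contraction_tensor (form_in_frame 4 e F p)
          (vec_in_frame g e p u) (vec_in_frame g e p v) (vec_in_frame g e p w)
      - contraction_tensor (form_in_frame 4 e F p)
          (vec_in_frame g e p v) (vec_in_frame g e p u) (vec_in_frame g e p w)"
    (is "_ = ?r")
  unfolding torsion_tensor_def
proof (rule the_equality)
  note bil = bilinear_inner_at[OF g, of p]
  have U: "open U" "\<And>i. smooth_vfield A U (e i)" using e by (auto simp: adapted_frame_def)
  interpret orthonormal_frame "inner_at g p" "\<lambda>i. e i p"
    using bil g e p by unfold_locales (auto simp: riemannian_metric_def adapted_frame_def)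
  have torsion_value: "g p [torsion A nabla_c X Y p, Z p] = ?r"
    if V: "open V" "p \<in> V" and smooth: "smooth_vfield A V X" "smooth_vfield A V Y" "smooth_vfield A V Z"
      and vals: "X p = u" "Y p = v" "Z p = w" for V X Y Z
  proof -
    \<comment> \<open>The formula for \<open>nabla_c\<close> speaks of fields that are smooth on the
      domain of an adapted frame, so the frame and the fields are restricted to a common
      domain.\<close>
    let ?W = "U \<inter> V"
    have W: "open ?W" "p \<in> ?W" "adapted_frame A g \<rho> ?W e"
      using U(1) V p adapted_frame_subset[OF e, of "U \<inter> V"] by (simp_all add: open_Int)
    have sm: "smooth_vfield A ?W X" "smooth_vfield A ?W Y" "smooth_vfield A ?W Z"
      using smooth smooth_vfield_subset by blast+
    have c: "g p [nabla_c X Y p, Z p] = g p [nabla_g X Y p, Z p] + 1/2 * T p [X p, Y p, Z p]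
        + contraction_tensor (form_in_frame 4 e F p)
          (vec_in_frame g e p (X p)) (vec_in_frame g e p (Y p)) (vec_in_frame g e p (Z p))"
      if "smooth_vfield A ?W X" "smooth_vfield A ?W Y" for X Y
      using nabla_c W that sm(3) unfolding characteristic_connection_def contraction_tensor_def by blast
    have "torsion A nabla_g X Y p = 0"
      using nabla_g W sm unfolding levi_civita_def by blast
    hence "lie_bracket A X Y p = nabla_g X Y p - nabla_g Y X p" by (simp add: torsion_def)
    hence "g p [torsion A nabla_c X Y p, Z p]
        = (g p [nabla_c X Y p, Z p] - g p [nabla_c Y X p, Z p])
          - (g p [nabla_g X Y p, Z p] - g p [nabla_g Y X p, Z p])"
      using h_diff_left by (simp add: torsion_def)
    moreover have "T p [v, u, w] = - T p [u, v, w]"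
      using differential_form_3_TT_56[OF T, of p] unfolding TT_56_def mem_Collect_eq by blast
    ultimately show ?thesis
      using c[OF sm(1,2)] c[OF sm(2,1)] by (simp add: vals)
  qed
  show "\<forall>U X Y Z. open U \<and> p \<in> U \<and> smooth_vfield A U X \<and> smooth_vfield A U Y \<and> smooth_vfield A U Z \<and>
      X p = u \<and> Y p = v \<and> Z p = w \<longrightarrow> ?r = g p [torsion A nabla_c X Y p, Z p]"
    using torsion_value by metis
  fix r
  assume r: "\<forall>U X Y Z. open U \<and> p \<in> U \<and> smooth_vfield A U X \<and> smooth_vfield A U Y \<and> smooth_vfield A U Z \<and>
      X p = u \<and> Y p = v \<and> Z p = w \<longrightarrow> r = g p [torsion A nabla_c X Y p, Z p]"
  \<comment> \<open>That r is determined requires at least one admissible extension of u, v and w: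
    combinations of the frame with constant coefficients.\<close>
  define ext where "ext y = (\<lambda>q. \<Sum>i\<in>UNIV. coords y $ i *\<^sub>R e i q)" for y
  have ext: "smooth_vfield A U (ext y)" "ext y p = y" for y
    using smooth_vfield_combination[OF A U] of_coords_coords[of y]
    by (simp_all add: ext_def of_coords_def)
  have "r = g p [torsion A nabla_c (ext u) (ext v) p, ext w p]" using r U(1) p ext by blast
  also have "\<dots> = ?r" using torsion_value[OF U(1) p] ext by blast
  finally show "r = ?r" .
qed

text \<open>At a fixed point and in a fixed frame the torsion is an instance of
  \<open>frame_torsion\<close>; its criteria in terms of T' and F' are matched with those of
  \<open>type_iff\<close> for \<Gamma>.\<close>

lemma characteristic_torsion_type:
  fixes A :: "('m::{t2_space, second_countable_topology}) chart set"
  assumes psu3: "psu3_structure A g \<rho>" and nabla_g: "levi_civita A g nabla_g"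
    and of_type: "of_type A g \<rho> nabla_g {1, 2, 3, 4, 5}"
    and forms: "characteristic_forms A g \<rho> nabla_g T F"
    and nabla_c: "characteristic_connection A g \<rho> nabla_g T F nabla_c"
    and e: "adapted_frame A g \<rho> U e" and p: "p \<in> U"
  defines "\<tau> \<equiv> torsion_tensor A g nabla_c p" and "\<Gamma> \<equiv> intrinsic_torsion g nabla_g e p"
  shows "(\<forall>X Y Z. \<tau> X Y Z = 0) \<longleftrightarrow> \<Gamma> = 0"
    and "\<tau> \<in> TT_56 \<longleftrightarrow> \<Gamma> \<in> (\<Sum>i\<in>{1, 2, 3}. WW i)"
    and "\<tau> \<in> TT_cyclic (inner_at g p) \<longleftrightarrow> \<Gamma> \<in> (\<Sum>i\<in>{4, 5}. WW i)"
    and "\<tau> \<in> TT_8 (inner_at g p) \<Longrightarrow> \<Gamma> = 0"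
    and "\<tau> \<in> TT_160 (inner_at g p) \<longleftrightarrow> \<Gamma> \<in> (\<Sum>i\<in>{5}. WW i)"
proof -
  define T' where "T' = form_in_frame 3 e T p"
  define F' where "F' = form_in_frame 4 e F p"
  have A: "oriented_smooth_atlas A" and g: "riemannian_metric A g"
    using psu3 by (auto simp: psu3_structure_def)
  have T: "differential_form A 3 T" using forms by (simp add: characteristic_forms_def)
  have "T' \<in> Lam3_0 \<and> F' \<in> Lam4_0 \<and> (\<exists>\<Gamma>'. (\<forall>i\<in>{1..6}. \<Gamma>' i \<in> WW i) \<and> \<Gamma> = (\<Sum>i\<in>{1..6}. \<Gamma>' i) \<and>
      Theta1 T' = \<Gamma>' 1 + \<Gamma>' 2 + \<Gamma>' 3 \<and> Theta2 F' = \<Gamma>' 4 + \<Gamma>' 5)"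
    using forms e p unfolding characteristic_forms_def T'_def F'_def \<Gamma>_def Lam3_0_def Lam4_0_def by blast
  then obtain \<Gamma>' where T': "T' \<in> Lam3_0" and F': "F' \<in> Lam4_0"
    and \<Gamma>': "\<And>i. i \<in> {1..6} \<Longrightarrow> \<Gamma>' i \<in> WW i" "\<Gamma> = (\<Sum>i\<in>{1..6}. \<Gamma>' i)"
      "Theta1 T' = \<Gamma>' 1 + \<Gamma>' 2 + \<Gamma>' 3" "Theta2 F' = \<Gamma>' 4 + \<Gamma>' 5"
    by blast
  have type: "\<Gamma> \<in> (\<Sum>i\<in>{1, 2, 3, 4, 5}. WW i)"
    using of_type e p unfolding of_type_def \<Gamma>_def by blast
  have \<Gamma>: "\<Gamma> = Theta1 T' + Theta2 F'"
    by (rule characteristic_decomposition[of T' F' \<Gamma>' \<Gamma>]) (fact T' F' \<Gamma>' type)+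
  have S: "(\<lambda>X Y Z. T p [X, Y, Z]) \<in> TT_56" by (rule differential_form_3_TT_56[OF T])
  interpret orthonormal_frame "inner_at g p" "\<lambda>i. e i p"
    using bilinear_inner_at[OF g, of p] g e p
    by unfold_locales (auto simp: riemannian_metric_def adapted_frame_def)
  have coords: "vec_in_frame g e p X = coords X" for X
    by (simp add: vec_in_frame_def coords_def)
  interpret frame_torsion "inner_at g p" "\<lambda>i. e i p" "\<lambda>X Y Z. T p [X, Y, Z]" \<tau> F'
    using S F' torsion_tensor_eq[OF A g nabla_g T nabla_c e p]
    by unfold_locales (simp_all only: \<tau>_def F'_def coords)
  have T'_iff: "(\<forall>X Y Z. T p [X, Y, Z] = 0) \<longleftrightarrow> T' = 0"
    unfolding T'_def using form_in_frame_3_eq_0_iff[where T = T and p = p and e = e, OF S] by blast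
  note iffs = type_iff[OF T' F', folded \<Gamma>]
  show "(\<forall>X Y Z. \<tau> X Y Z = 0) \<longleftrightarrow> \<Gamma> = 0"
    by (simp only: vanishes_iff T'_iff iffs)
  show "\<tau> \<in> TT_56 \<longleftrightarrow> \<Gamma> \<in> (\<Sum>i\<in>{1, 2, 3}. WW i)"
    by (simp only: skew_iff iffs)
  show "\<tau> \<in> TT_cyclic (inner_at g p) \<longleftrightarrow> \<Gamma> \<in> (\<Sum>i\<in>{4, 5}. WW i)"
    by (simp only: cyclic_iff T'_iff iffs)
  show "\<tau> \<in> TT_160 (inner_at g p) \<longleftrightarrow> \<Gamma> \<in> (\<Sum>i\<in>{5}. WW i)"
    by (simp only: TT_160_iff T'_iff iffs)
  assume "\<tau> \<in> TT_8 (inner_at g p)"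
  from vectorial_imp[OF this] show "\<Gamma> = 0"
    by (simp only: T'_iff iffs)
qed

theorem corollary5p1:
  fixes A :: "('m::{t2_space, second_countable_topology}) chart set"
    and g \<rho> T\<^sub>c F\<^sub>c :: "'m tensor"
    and nabla_g nabla_c :: "'m conn"
  assumes "psu3_structure A g \<rho>"
    and "levi_civita A g nabla_g"
    and "of_type A g \<rho> nabla_g {1, 2, 3, 4, 5}"
    and "characteristic_forms A g \<rho> nabla_g T\<^sub>c F\<^sub>c"
    and "characteristic_connection A g \<rho> nabla_g T\<^sub>c F\<^sub>c nabla_c"
  shows "let \<T> = torsion_tensor A g nabla_c;
             vanishes = (\<forall>p X Y Z. \<T> p X Y Z = 0)
         in (vanishes \<longleftrightarrow> integrable_structure A g \<rho> nabla_g) \<and>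
            (\<not> vanishes \<longrightarrow>
               ((\<forall>p. \<T> p \<in> TT_56) \<longleftrightarrow> of_type A g \<rho> nabla_g {1, 2, 3}) \<and>
               ((\<forall>p. \<T> p \<in> TT_cyclic (inner_at g p)) \<longleftrightarrow> of_type A g \<rho> nabla_g {4, 5}) \<and>
               \<not> (\<forall>p. \<T> p \<in> TT_8 (inner_at g p)) \<and>
               ((\<forall>p. \<T> p \<in> TT_160 (inner_at g p)) \<longleftrightarrow> of_type A g \<rho> nabla_g {5}))"
proof -
  let ?\<tau> = "torsion_tensor A g nabla_c"
  note pointwise = characteristic_torsion_type[OF assms]
  have frames: "\<exists>U e. adapted_frame A g \<rho> U e \<and> p \<in> U" for p
    using assms(1) unfolding psu3_structure_def by blast
  \<comment> \<open>P depends on the point alone, R also on the frame. Every point has an adapted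
    frame and the equivalence holds in each, so the quantifier over frames can be added.\<close>
  have transfer: "(\<forall>p. P p) \<longleftrightarrow> (\<forall>U e p. adapted_frame A g \<rho> U e \<and> p \<in> U \<longrightarrow> R e p)"
    if "\<And>U e p. adapted_frame A g \<rho> U e \<Longrightarrow> p \<in> U \<Longrightarrow> P p \<longleftrightarrow> R e p" for P R
    using frames that by metis
  have 0: "(\<forall>p X Y Z. ?\<tau> p X Y Z = 0) \<longleftrightarrow> integrable_structure A g \<rho> nabla_g"
    unfolding integrable_structure_def by (rule transfer) (rule pointwise(1))
  have 1: "(\<forall>p. ?\<tau> p \<in> TT_56) \<longleftrightarrow> of_type A g \<rho> nabla_g {1, 2, 3}"
    unfolding of_type_def by (rule transfer) (rule pointwise(2))
  have 2: "(\<forall>p. ?\<tau> p \<in> TT_cyclic (inner_at g p)) \<longleftrightarrow> of_type A g \<rho> nabla_g {4, 5}"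
    unfolding of_type_def by (rule transfer) (rule pointwise(3))
  have 3: "(\<forall>p. ?\<tau> p \<in> TT_160 (inner_at g p)) \<longleftrightarrow> of_type A g \<rho> nabla_g {5}"
    unfolding of_type_def by (rule transfer) (rule pointwise(5))
  \<comment> \<open>At each point a vectorial torsion forces the intrinsic torsion, and with it the
    characteristic torsion, to vanish there.\<close>
  have 4: "\<forall>p X Y Z. ?\<tau> p X Y Z = 0" if "\<forall>p. ?\<tau> p \<in> TT_8 (inner_at g p)"
    using that pointwise(1,4) frames by metis
  show ?thesis
    unfolding Let_def using 0 1 2 3 4 by blast
qed

end
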